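(* Let $K$ be a convex billiard table in either the hyperbolic plane $\mathbb{H}^2$ or the open hemisphere $\mathbb{S}^2_+$, with $C^1$-smooth and piecewise $C^2$-smooth boundary. Assume further that the (geodesic) curvature of $\partial K$ is continuous except for finitely many jump discontinuities, is bounded away from zero, and has at least one discontinuity point. Then the boundary $\partial K$ has a neighborhood which no convex caustic of $K$ other than $\partial K$ itself can intersect.
   Context: $\mathbb{H}^2$ is the hyperbolic plane (curvature $-1$), and $\mathbb{S}^2_+$ is an open hemisphere of the unit sphere (curvature $+1$). A set is convex if for every two of its points the unique geodesic segment joining them is contained in the set. A convex billiard table is a compact convex set $K$ with nonempty interior. The curvature of $\partial K$ is its geodesic curvature, with the sign making it nonnegative for convex $K$; a jump discontinuity is a point at which both one-sided limits of the curvature exist and are different. Billiard dynamics: a point particle moves along geodesics inside $K$ and reflects at $\partial K$ making equal angles with the tangent line to $\partial K$ at the impact point. A convex caustic in $K$ is a simple closed curve $\gamma\subset K$ which bounds a convex set and is such that any billiard trajectory tangent to $\gamma$ remains tangent to $\gamma$ after the reflection at $\partial K$. (If $\gamma$ is not smooth, a tangent line to $\gamma$ means a supporting geodesic line of the convex set it bounds.) *)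

theory Defs
  imports "HOL-Analysis.Analysis"
begin

text \<open>
  Both geometries are realised in R^3: the open hemisphere as the part of the unit sphere with
  positive third coordinate, the hyperbolic plane as the upper sheet of the hyperboloid
  x1^2 + x2^2 - x3^2 = -1.  The Riemannian metric is the restriction to tangent planes of the
  form x1 y1 + x2 y2 + kappa x3 y3, where kappa is the curvature; the induced topology is the
  subspace topology of R^3.
\<close>

datatype geometry = Hyperbolic | Spherical

fun kappa :: "geometry \<Rightarrow> real" where
  "kappa Hyperbolic = -1"
| "kappa Spherical = 1"

definition ip :: "geometry \<Rightarrow> real^3 \<Rightarrow> real^3 \<Rightarrow> real" where
  "ip G x y = x$1 * y$1 + x$2 * y$2 + kappa G * (x$3 * y$3)"

definition surf :: "geometry \<Rightarrow> (real^3) set" where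
  "surf G = {x. ip G x x = kappa G \<and> x$3 > 0}"

definition unit_tangents :: "geometry \<Rightarrow> real^3 \<Rightarrow> (real^3) set" where
  "unit_tangents G p = {u. ip G p u = 0 \<and> ip G u u = 1}"

text \<open>
  The unit-speed geodesic starting at p with velocity u.  In the spherical case it is a full great
  circle, which leaves the hemisphere; uses below restrict it to the hemisphere.
\<close>
definition geod :: "geometry \<Rightarrow> real^3 \<Rightarrow> real^3 \<Rightarrow> real \<Rightarrow> real^3" where
  "geod G p u t = (case G of
     Hyperbolic \<Rightarrow> cosh t *\<^sub>R p + sinh t *\<^sub>R u
   | Spherical \<Rightarrow> cos t *\<^sub>R p + sin t *\<^sub>R u)"

definition geodesic_segment :: "geometry \<Rightarrow> real^3 \<Rightarrow> real^3 \<Rightarrow> (real^3) set \<Rightarrow> bool" where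
  "geodesic_segment G p q \<sigma> \<longleftrightarrow>
     p \<in> surf G \<and> (\<exists>u\<in>unit_tangents G p. \<exists>l\<ge>0.
       geod G p u l = q \<and> \<sigma> = geod G p u ` {0..l} \<and> \<sigma> \<subseteq> surf G)"

definition geo_convex :: "geometry \<Rightarrow> (real^3) set \<Rightarrow> bool" where
  "geo_convex G C \<longleftrightarrow>
     C \<subseteq> surf G \<and> (\<forall>p\<in>C. \<forall>q\<in>C. \<forall>\<sigma>. geodesic_segment G p q \<sigma> \<longrightarrow> \<sigma> \<subseteq> C)"

abbreviation surf_top :: "geometry \<Rightarrow> (real^3) topology" where
  "surf_top G \<equiv> top_of_set (surf G)"

abbreviation inter :: "geometry \<Rightarrow> (real^3) set \<Rightarrow> (real^3) set" where
  "inter G K \<equiv> surf_top G interior_of K"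

abbreviation bdry :: "geometry \<Rightarrow> (real^3) set \<Rightarrow> (real^3) set" where
  "bdry G K \<equiv> surf_top G frontier_of K"

definition convex_billiard_table :: "geometry \<Rightarrow> (real^3) set \<Rightarrow> bool" where
  "convex_billiard_table G K \<longleftrightarrow> compact K \<and> geo_convex G K \<and> inter G K \<noteq> {}"

text \<open>
  Rotation by a quarter turn in the tangent plane at p: cross3 p u with the index lowered by the
  form, so that ip G w (rot90 G p u) is the determinant of (p, u, w).
\<close>
definition rot90 :: "geometry \<Rightarrow> real^3 \<Rightarrow> real^3 \<Rightarrow> real^3" where
  "rot90 G p u = (\<chi> i. if i = 3 then kappa G * cross3 p u $ 3 else cross3 p u $ i)"

lemma ip_rot90: "ip G w (rot90 G p u) = w \<bullet> cross3 p u"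
  by (cases G) (simp_all add: ip_def rot90_def inner_vec_def sum_3)

lemma rot90_unit_tangent:
  assumes p: "p \<in> surf G" and u: "u \<in> unit_tangents G p"
  shows "rot90 G p u \<in> unit_tangents G p" and "ip G u (rot90 G p u) = 0"
proof -
  have "ip G (rot90 G p u) (rot90 G p u) = kappa G * (ip G p p * ip G u u - (ip G p u)\<^sup>2)"
    by (cases G) (simp_all add: ip_def rot90_def cross3_def power2_eq_square algebra_simps)
  then show "rot90 G p u \<in> unit_tangents G p"
    using p u by (cases G) (simp_all add: unit_tangents_def surf_def ip_rot90 dot_cross_self)
  show "ip G u (rot90 G p u) = 0"
    by (simp add: ip_rot90 dot_cross_self)
qed

abbreviation velocity :: "(real \<Rightarrow> real^3) \<Rightarrow> real \<Rightarrow> real^3" where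
  "velocity c \<equiv> \<lambda>t. vector_derivative c (at t)"

text \<open>
  c is an L-periodic C^1 parametrisation of the boundary of K by arc length, traversed so that
  the normal obtained by rotating the velocity by a quarter turn points into K.
\<close>
definition arclength_boundary ::
  "geometry \<Rightarrow> (real^3) set \<Rightarrow> (real \<Rightarrow> real^3) \<Rightarrow> real \<Rightarrow> bool" where
  "arclength_boundary G K c L \<longleftrightarrow>
     L > 0 \<and> (\<forall>t. c (t + L) = c t) \<and> inj_on c {0..<L} \<and> range c = bdry G K \<and>
     (\<forall>t. c differentiable at t) \<and> continuous_on UNIV (velocity c) \<and>
     (\<forall>t. ip G (velocity c t) (velocity c t) = 1) \<and>
     (\<forall>t. \<exists>\<epsilon>>0. \<forall>s\<in>{0<..<\<epsilon>}. geod G (c t) (rot90 G (c t) (velocity c t)) s \<in> K)"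

definition C2_on :: "(real \<Rightarrow> real^3) \<Rightarrow> real set \<Rightarrow> bool" where
  "C2_on f I \<longleftrightarrow> (\<exists>f' f''. continuous_on I f'' \<and>
     (\<forall>t\<in>I. (f has_vector_derivative f' t) (at t within I) \<and>
            (f' has_vector_derivative f'' t) (at t within I)))"

text \<open>S is a finite partition of one period; c is C^2 on each closed piece, one-sidedly at its ends.\<close>
definition piecewise_C2 :: "(real \<Rightarrow> real^3) \<Rightarrow> real \<Rightarrow> bool" where
  "piecewise_C2 c L \<longleftrightarrow> (\<exists>S. finite S \<and> {0, L} \<subseteq> S \<and> S \<subseteq> {0..L} \<and>
     (\<forall>a\<in>S. \<forall>b\<in>S. a < b \<and> {a<..<b} \<inter> S = {} \<longrightarrow> C2_on c {a..b}))"

text \<open>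
  Geodesic curvature of a unit-speed curve with respect to the normal rot90 (which is tangent to
  the surface, so c'' need not be projected to the tangent plane first).  Where c'' does not exist
  the value is junk.  For a C^1, piecewise C^2 curve this happens only where the one-sided limits
  of the curvature differ, hence the points with not isCont are exactly the discontinuities of the
  curvature, whatever the junk value.
\<close>
definition geodesic_curvature :: "geometry \<Rightarrow> (real \<Rightarrow> real^3) \<Rightarrow> real \<Rightarrow> real" where
  "geodesic_curvature G c t = ip G (velocity (velocity c) t) (rot90 G (c t) (velocity c t))"

definition jump_discontinuity :: "(real \<Rightarrow> real) \<Rightarrow> real \<Rightarrow> bool" where
  "jump_discontinuity k t \<longleftrightarrow>
     (\<exists>a b. (k \<longlongrightarrow> a) (at_left t) \<and> (k \<longlongrightarrow> b) (at_right t) \<and> a \<noteq> b)"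

text \<open>Unit tangent vectors at q of a (C^1) curve, given as a point set S.\<close>
definition unit_tangents_curve :: "geometry \<Rightarrow> (real^3) set \<Rightarrow> real^3 \<Rightarrow> (real^3) set" where
  "unit_tangents_curve G S q = {T. ip G T T = 1 \<and>
     (\<exists>\<alpha>::real \<Rightarrow> real^3. \<alpha> 0 = q \<and> range \<alpha> \<subseteq> S \<and> (\<alpha> has_vector_derivative T) (at 0))}"

text \<open>Mirror image of v in the line spanned by the unit vector T: the T-component is kept and the
  orthogonal one is reversed, so that v and its image make equal angles with that line.\<close>
definition reflect :: "geometry \<Rightarrow> real^3 \<Rightarrow> real^3 \<Rightarrow> real^3" where
  "reflect G T v = (2 * ip G v T) *\<^sub>R T - v"

text \<open>
  The particle leaves the boundary point p in direction u, moves along a geodesic through the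
  interior, hits the boundary at q, and leaves q in the reflected direction w.
\<close>
definition billiard_step ::
  "geometry \<Rightarrow> (real^3) set \<Rightarrow> real^3 \<Rightarrow> real^3 \<Rightarrow> real^3 \<Rightarrow> real^3 \<Rightarrow> bool" where
  "billiard_step G K p u q w \<longleftrightarrow>
     p \<in> bdry G K \<and> u \<in> unit_tangents G p \<and> q \<in> bdry G K \<and>
     (\<exists>l>0. (\<forall>t\<in>{0<..<l}. geod G p u t \<in> inter G K) \<and> geod G p u l = q \<and>
        (\<exists>T\<in>unit_tangents_curve G (bdry G K) q. w = reflect G T (velocity (geod G p u) l)))"

text \<open>
  The geodesic line through p in direction u is a supporting line of C: it meets C, and C lies in
  one of the two closed half-planes that it bounds.
\<close>
definition supporting_line :: "geometry \<Rightarrow> (real^3) set \<Rightarrow> real^3 \<Rightarrow> real^3 \<Rightarrow> bool" where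
  "supporting_line G C p u \<longleftrightarrow>
     range (geod G p u) \<inter> surf G \<inter> C \<noteq> {} \<and>
     ((\<forall>x\<in>C. ip G x (rot90 G p u) \<ge> 0) \<or> (\<forall>x\<in>C. ip G x (rot90 G p u) \<le> 0))"

text \<open>
  The set C is determined by the curve \<gamma>, and for smooth \<gamma> the supporting lines of C are
  exactly the tangent lines of \<gamma>.
\<close>
definition convex_caustic :: "geometry \<Rightarrow> (real^3) set \<Rightarrow> (real^3) set \<Rightarrow> bool" where
  "convex_caustic G K \<gamma> \<longleftrightarrow>
     \<gamma> \<subseteq> K \<and>
     (\<exists>g. simple_path g \<and> pathfinish g = pathstart g \<and> path_image g = \<gamma>) \<and>
     (\<exists>C. compact C \<and> geo_convex G C \<and> bdry G C = \<gamma> \<and>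
        (\<forall>p u q w. billiard_step G K p u q w \<and> supporting_line G C p u
                     \<longrightarrow> supporting_line G C q w))"

end

theory Submission
  imports Defs
begin

text \<open>
  Let c be the boundary and f the map sending s to the parameter of the next impact of the
  trajectory that leaves c s with the caustic on its left.  The reflection law makes
  P = dist (c s) (c (f s)) - (integral over [s, f s] of the cosine of the angle between the
  boundary and the outgoing trajectory) independent of s.  It is positive and at most the length of
  the chord, and it can be small only if all the steps f s - s are small.  A caustic that touches
  the boundary without being equal to it would have P = 0, which is impossible; and for caustics
  approaching the boundary at some point P tends to 0, so that f tends to the identity everywhere.

  At a jump of the curvature, from kl to kr, this is contradictory.  Where the curvature is close to
  k, a chord of length h has angle close to k h / 2 at both ends, so that consecutive steps are
  almost equal, and comparing the interlacing orbits of two points shows that all the steps near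
  the jump have nearly the same angle \<theta> on either side.  But a chord joining the points at
  distances a before and b after the jump has angles (kl a^2 + 2 kl a b + kr b^2) / (2 (a + b)) and
  (kl a^2 + 2 kr a b + kr b^2) / (2 (a + b)) to leading order, which cannot both be \<theta> when
  a = \<theta> / kl is half a step.
\<close>

text \<open>Both geometries are handled at once by linear algebra in R^3: a geodesic is the section
  of the surface by a plane through the origin, so sides of geodesics are signs of
  \<open>det3\<close>, convex sets are treated as convex cones, and supporting lines are linear
  functionals. The caustic enters only through the convex set C that it bounds; C may have corners,
  so f is known only to be monotone and continuous, and P is shown to be constant by the first
  variation of length along the graph of f, without a derivative of f. The lower bound for P has to
  be uniform over all caustics: P is the integral of E u (f s) - E u (f u) over [s, f s], and
  replacing E u (f u) by its upper bound - E u s leaves an integrand that depends on s and f s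
  alone. At the jump the two angles differ by a multiple of a b / (a + b); equality forces b to be
  negligible against a, and then the angle is that of a chord on the left alone, whose length would
  be a full step 2 \<theta> / kl and not the half step that was chosen.\<close>

section \<open>Determinants and the bilinear form\<close>

definition det3 :: "real^3 \<Rightarrow> real^3 \<Rightarrow> real^3 \<Rightarrow> real" where
  "det3 x y z = x \<bullet> cross3 y z"

lemma det3_comps:
  "det3 x y z = x$1 * (y$2 * z$3 - y$3 * z$2) + x$2 * (y$3 * z$1 - y$1 * z$3)
     + x$3 * (y$1 * z$2 - y$2 * z$1)"
  by (simp add: det3_def cross3_def inner_vec_def sum_3)

lemma det3_add [simp]:
  "det3 (x + x') y z = det3 x y z + det3 x' y z"
  "det3 x (y + y') z = det3 x y z + det3 x y' z"
  "det3 x y (z + z') = det3 x y z + det3 x y z'"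
  "det3 (x - x') y z = det3 x y z - det3 x' y z"
  "det3 x (y - y') z = det3 x y z - det3 x y' z"
  "det3 x y (z - z') = det3 x y z - det3 x y z'"
  by (simp_all add: det3_comps algebra_simps)

lemma det3_scale [simp]:
  "det3 (r *\<^sub>R x) y z = r * det3 x y z"
  "det3 x (r *\<^sub>R y) z = r * det3 x y z"
  "det3 x y (r *\<^sub>R z) = r * det3 x y z"
  "det3 (- x) y z = - det3 x y z"
  "det3 x (- y) z = - det3 x y z"
  "det3 x y (- z) = - det3 x y z"
  by (simp_all add: det3_comps algebra_simps)

lemma det3_same [simp]: "det3 x x z = 0" "det3 x y x = 0" "det3 x y y = 0"
  by (simp_all add: det3_comps algebra_simps)

lemma det3_rot: "det3 x y z = det3 y z x"
  by (simp add: det3_comps algebra_simps)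

lemma det3_swap: "det3 x y z = - det3 y x z" "det3 x y z = - det3 x z y"
  by (simp_all add: det3_comps algebra_simps)

lemma det3_inner: "det3 x y z = z \<bullet> cross3 x y"
  by (simp add: det3_comps cross3_def inner_vec_def sum_3 algebra_simps)

text \<open>The linear dependence between four vectors of R^3. Pairing it with a functional that
  kills some of them gives the coordinate formulas used below.\<close>

lemma cramer3:
  "det3 t q x *\<^sub>R p - det3 p q x *\<^sub>R t + det3 p t x *\<^sub>R q - det3 p t q *\<^sub>R x = (0 :: real^3)"
  by (simp add: vec_eq_iff forall_3 det3_comps algebra_simps)

lemma ip_lin [simp]:
  "ip G (x + y) z = ip G x z + ip G y z" "ip G z (x + y) = ip G z x + ip G z y"
  "ip G (x - y) z = ip G x z - ip G y z" "ip G z (x - y) = ip G z x - ip G z y"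
  "ip G (r *\<^sub>R x) z = r * ip G x z" "ip G z (r *\<^sub>R x) = r * ip G z x"
  "ip G (- x) z = - ip G x z" "ip G z (- x) = - ip G z x"
  "ip G 0 z = 0" "ip G z 0 = 0"
  by (simp_all add: ip_def algebra_simps)

lemma ip_commute: "ip G x y = ip G y x"
  by (simp add: ip_def mult.commute)

lemma bounded_bilinear_ip: "bounded_bilinear (ip G)"
proof
  show "\<exists>B. \<forall>a b. norm (ip G a b) \<le> norm a * norm b * B"
  proof (intro exI allI)
    fix a b :: "real^3"
    have c: "\<bar>a$i * b$i\<bar> \<le> norm a * norm b" for i
      by (simp add: abs_mult mult_mono component_le_norm_cart)
    have "norm (ip G a b) \<le> \<bar>a$1 * b$1\<bar> + \<bar>a$2 * b$2\<bar> + \<bar>a$3 * b$3\<bar>"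
      unfolding ip_def by (cases G; simp; linarith)
    then show "norm (ip G a b) \<le> norm a * norm b * 3"
      using c[of 1] c[of 2] c[of 3] by linarith
  qed
qed simp_all

lemmas continuous_on_ip [continuous_intros] = bounded_bilinear.continuous_on[OF bounded_bilinear_ip]
lemmas tendsto_ip [tendsto_intros] = bounded_bilinear.tendsto[OF bounded_bilinear_ip]
lemmas has_derivative_ip [derivative_intros] = bounded_bilinear.FDERIV[OF bounded_bilinear_ip]

lemma continuous_on_det3 [continuous_intros]:
  assumes "continuous_on S f" "continuous_on S g" "continuous_on S h"
  shows "continuous_on S (\<lambda>x. det3 (f x) (g x) (h x))"
  unfolding det3_comps using assms by (intro continuous_intros)

lemma tendsto_det3 [tendsto_intros]:
  assumes "(f \<longlongrightarrow> a) F" "(g \<longlongrightarrow> b) F" "(h \<longlongrightarrow> d) F"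
  shows "((\<lambda>x. det3 (f x) (g x) (h x)) \<longlongrightarrow> det3 a b d) F"
  unfolding det3_comps by (intro tendsto_intros assms)

lemma kappa_sq [simp]: "kappa G * kappa G = 1" "kappa G * (kappa G * x) = x" "\<bar>kappa G\<bar> = 1"
  by (cases G; simp)+

text \<open>Gram's identity: the Gram determinant of three vectors is
  \<open>(det3 p t x)\<^sup>2\<close> times the determinant of the form, which is
  \<open>kappa G\<close> and its own inverse.\<close>

lemma det3_gram:
  "(det3 p t x)\<^sup>2 = kappa G *
     (ip G p p * (ip G t t * ip G x x - (ip G t x)\<^sup>2)
      - ip G p t * (ip G p t * ip G x x - ip G t x * ip G p x)
      + ip G p x * (ip G p t * ip G t x - ip G t t * ip G p x))"
  by (cases G) (simp_all add: det3_comps ip_def power2_eq_square algebra_simps)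

text \<open>\<open>det3 p t x\<close> is the component of x along \<open>rot90 G p t\<close>, so
  this is Pythagoras in the orthogonal frame of p, t and that normal.\<close>

lemma frame_norm:
  assumes "p \<in> surf G" "t \<in> unit_tangents G p"
  shows "(det3 p t x)\<^sup>2 + (ip G t x)\<^sup>2 = ip G x x - kappa G * (ip G p x)\<^sup>2"
  using assms det3_gram[of p t x G]
  by (simp add: surf_def unit_tangents_def power2_eq_square algebra_simps)

text \<open>In the frame at p, a determinant with p reduces to the 2 x 2 determinant of the
  components along t and along the normal.\<close>

lemma frame_det:
  assumes "p \<in> surf G" "t \<in> unit_tangents G p"
  shows "det3 p x y = ip G t x * det3 p t y - det3 p t x * ip G t y"
proof -
  have "ip G t (det3 t x y *\<^sub>R p - det3 p x y *\<^sub>R t + det3 p t y *\<^sub>R x - det3 p t x *\<^sub>R y) = 0"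
    by (subst cramer3) simp
  moreover have "ip G t p = 0" "ip G t t = 1"
    using assms by (auto simp: unit_tangents_def ip_commute)
  ultimately show ?thesis by (simp add: mult.commute)
qed

subsection \<open>Geodesics\<close>

definition gcos :: "geometry \<Rightarrow> real \<Rightarrow> real" where
  "gcos G t = (case G of Hyperbolic \<Rightarrow> cosh t | Spherical \<Rightarrow> cos t)"

definition gsin :: "geometry \<Rightarrow> real \<Rightarrow> real" where
  "gsin G t = (case G of Hyperbolic \<Rightarrow> sinh t | Spherical \<Rightarrow> sin t)"

lemma geod_eq: "geod G p u t = gcos G t *\<^sub>R p + gsin G t *\<^sub>R u"
  by (cases G) (simp_all add: geod_def gcos_def gsin_def)

definition arc :: "geometry \<Rightarrow> real \<Rightarrow> real" where
  "arc G w = (case G of Hyperbolic \<Rightarrow> arcosh w | Spherical \<Rightarrow> arccos w)"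

text \<open>
  For points of the surface, wip is cosh or cos of their distance, rad is sinh or sin of it, and
  gdir is the initial unit vector of the segment from the first to the second.
\<close>
definition wip :: "geometry \<Rightarrow> real^3 \<Rightarrow> real^3 \<Rightarrow> real" where
  "wip G p q = kappa G * ip G p q"

definition rad :: "geometry \<Rightarrow> real^3 \<Rightarrow> real^3 \<Rightarrow> real" where
  "rad G p q = sqrt (kappa G * (1 - (wip G p q)\<^sup>2))"

abbreviation gdist :: "geometry \<Rightarrow> real^3 \<Rightarrow> real^3 \<Rightarrow> real" where
  "gdist G p q \<equiv> arc G (wip G p q)"

definition gdir :: "geometry \<Rightarrow> real^3 \<Rightarrow> real^3 \<Rightarrow> real^3" where
  "gdir G p q = (1 / rad G p q) *\<^sub>R (q - wip G p q *\<^sub>R p)"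

lemma wip_commute: "wip G p q = wip G q p"
  by (simp add: wip_def ip_commute)

lemma rad_commute: "rad G p q = rad G q p"
  by (simp add: rad_def wip_commute)

lemma wip_self: "p \<in> surf G \<Longrightarrow> wip G p p = 1"
  by (simp add: wip_def surf_def)

lemma surf_scale_unique:
  assumes "x \<in> surf G" "r *\<^sub>R x \<in> surf G" "r > 0"
  shows "r = 1"
proof -
  have "r * r * kappa G = kappa G" using assms by (simp add: surf_def)
  then have "r * r = 1" by (cases G) auto
  then show ?thesis using assms(3) by (auto simp: square_eq_1_iff)
qed

lemma ip_diff_wip:
  assumes "p \<in> surf G" "q \<in> surf G"
  shows "ip G (q - p) (q - p) = 2 * kappa G * (1 - wip G p q)"
  using assms by (simp add: surf_def wip_def ip_commute[of G q p] algebra_simps)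

lemma wip_range_spherical:
  assumes "p \<in> surf Spherical" "q \<in> surf Spherical" "p \<noteq> q"
  shows "\<bar>wip Spherical p q\<bar> < 1"
proof -
  have 1: "ip Spherical x x = x \<bullet> x" for x
    by (simp add: ip_def inner_vec_def sum_3)
  have "ip Spherical (q - p) (q - p) > 0" using assms(3) unfolding 1 by simp
  then have a: "wip Spherical p q < 1" using ip_diff_wip[OF assms(1,2)] by simp
  \<comment> \<open>Antipodal points cannot both have a positive third coordinate.\<close>
  have "q + p \<noteq> 0"
    using assms by (auto simp: surf_def vec_eq_iff forall_3)
  then have "ip Spherical (q + p) (q + p) > 0" unfolding 1 by simp
  then have "wip Spherical p q > -1"
    using assms(1,2) by (simp add: surf_def wip_def ip_commute[of Spherical q p])
  with a show ?thesis by auto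
qed

lemma wip_range_hyperbolic:
  assumes "p \<in> surf Hyperbolic" "q \<in> surf Hyperbolic" "p \<noteq> q"
  shows "wip Hyperbolic p q > 1"
proof -
  have p: "p$3 * p$3 = 1 + p$1 * p$1 + p$2 * p$2" "p$3 > 0"
    and q: "q$3 * q$3 = 1 + q$1 * q$1 + q$2 * q$2" "q$3 > 0"
    using assms by (auto simp: surf_def ip_def)
  define a where "a = p$1 * q$1 + p$2 * q$2 + 1"
  \<comment> \<open>Lagrange's identity for (1, p1, p2) and (1, q1, q2): \<open>a\<close> is their
    scalar product, and the third coordinates of p and q are their lengths.\<close>
  have id: "(p$3 * q$3)\<^sup>2 - a\<^sup>2 = (p$1 - q$1)\<^sup>2 + (p$2 - q$2)\<^sup>2 + (p$1 * q$2 - p$2 * q$1)\<^sup>2"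
  proof -
    have "(p$3 * q$3)\<^sup>2 = (p$3 * p$3) * (q$3 * q$3)" by (simp add: power2_eq_square)
    then show ?thesis unfolding p(1) q(1) a_def by (simp add: power2_eq_square algebra_simps)
  qed
  have "p$1 \<noteq> q$1 \<or> p$2 \<noteq> q$2"
  proof (rule ccontr)
    assume "\<not> ?thesis"
    then have e: "p$1 = q$1" "p$2 = q$2" by auto
    then have "p$3 * p$3 = q$3 * q$3" using p q by simp
    then have "p$3 = q$3" using p(2) q(2) by (metis abs_of_pos power2_eq_square real_sqrt_abs)
    then show False using e assms(3) by (simp add: vec_eq_iff forall_3)
  qed
  then have "(p$1 - q$1)\<^sup>2 + (p$2 - q$2)\<^sup>2 > 0"
    by (auto simp: sum_power2_gt_zero_iff)
  then have "a\<^sup>2 < (p$3 * q$3)\<^sup>2" using id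
    by (smt (verit) zero_le_power2)
  then have "a < p$3 * q$3" using p(2) q(2)
    by (meson less_eq_real_def mult_pos_pos power2_less_imp_less)
  then show ?thesis by (simp add: wip_def ip_def a_def)
qed

lemma rad_sq:
  assumes "p \<in> surf G" "q \<in> surf G"
  shows "(rad G p q)\<^sup>2 = kappa G * (1 - (wip G p q)\<^sup>2)"
    and "p \<noteq> q \<Longrightarrow> rad G p q > 0"
proof -
  have pos: "kappa G * (1 - (wip G p q)\<^sup>2) > 0" if "p \<noteq> q"
  proof (cases G)
    case Hyperbolic
    then show ?thesis using wip_range_hyperbolic assms that by (simp add: one_less_power)
  next
    case Spherical
    then show ?thesis using wip_range_spherical assms that
      by (simp add: abs_square_less_1)
  qed
  then show "p \<noteq> q \<Longrightarrow> rad G p q > 0" by (simp add: rad_def)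
  show "(rad G p q)\<^sup>2 = kappa G * (1 - (wip G p q)\<^sup>2)"
  proof (cases "p = q")
    case True
    then show ?thesis using assms by (simp add: rad_def wip_self)
  next
    case False
    then show ?thesis using pos by (simp add: rad_def)
  qed
qed

text \<open>(e, a) and (e', a') lie on the upper half of the unit circle. The last hypothesis
  compares the cotangents e / a and e' / a', which are ordered in the same way as the
  cosines.\<close>

lemma unit_cot_less:
  fixes e a e' a' :: real
  assumes "e\<^sup>2 + a\<^sup>2 = 1" "e'\<^sup>2 + a'\<^sup>2 = 1" "a > 0" "a' > 0" "e * a' > a * e'"
  shows "e > e'"
proof (rule ccontr)
  assume "\<not> e > e'"
  then have le: "e \<le> e'" by simp
  show False
  proof (cases "e \<ge> 0")
    case True
    then have "e\<^sup>2 \<le> e'\<^sup>2" using le by (simp add: power_mono)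
    then have "a'\<^sup>2 \<le> a\<^sup>2" using assms by linarith
    then have "a' \<le> a" using assms(3) power2_le_imp_le[of a' a] by linarith
    then have "e * a' \<le> e' * a" using le True assms by (intro mult_mono) auto
    then show False using assms(5) by (simp add: mult.commute)
  next
    case False
    show False
    proof (cases "e' \<ge> 0")
      case True
      then have "a * e' \<ge> 0" "e * a' < 0" using assms False by (auto simp: mult_neg_pos)
      then show False using assms(5) by simp
    next
      case F: False
      have "e'\<^sup>2 \<le> e\<^sup>2" using le F power_mono[of "- e'" "- e" 2] by simp
      then have "a\<^sup>2 \<le> a'\<^sup>2" using assms by linarith
      then have "a \<le> a'" using assms(4) power2_le_imp_le[of a a'] by linarith
      then have "(- e') * a \<le> (- e) * a'" using le F assms by (intro mult_mono) auto
      then show False using assms(5) by (simp add: mult.commute)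
    qed
  qed
qed

lemma gdir_unit_tangent:
  assumes "p \<in> surf G" "q \<in> surf G" "p \<noteq> q"
  shows "gdir G p q \<in> unit_tangents G p"
proof -
  have r: "rad G p q > 0" "(rad G p q)\<^sup>2 = kappa G * (1 - (wip G p q)\<^sup>2)"
    using rad_sq assms by auto
  have i: "ip G p p = kappa G" "ip G q q = kappa G" "ip G p q = kappa G * wip G p q"
    "ip G q p = kappa G * wip G p q"
    using assms by (auto simp: surf_def wip_def ip_commute)
  have "ip G (q - wip G p q *\<^sub>R p) (q - wip G p q *\<^sub>R p) = (rad G p q)\<^sup>2"
    unfolding r(2) by (simp add: i power2_eq_square algebra_simps)
  moreover have "ip G (gdir G p q) (gdir G p q)
      = ip G (q - wip G p q *\<^sub>R p) (q - wip G p q *\<^sub>R p) / (rad G p q)\<^sup>2"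
    by (simp add: gdir_def power2_eq_square del: ip_lin(1-4))
  ultimately have "ip G (gdir G p q) (gdir G p q) = 1"
    using r(1) by simp
  moreover have "ip G p (gdir G p q) = 0" by (simp add: gdir_def i)
  ultimately show ?thesis by (simp add: unit_tangents_def)
qed

lemma gdist_facts:
  assumes "p \<in> surf G" "q \<in> surf G" "p \<noteq> q"
  shows "gdist G p q > 0" "gcos G (gdist G p q) = wip G p q" "gsin G (gdist G p q) = rad G p q"
    "\<And>t. 0 < t \<Longrightarrow> t \<le> gdist G p q \<Longrightarrow> gsin G t > 0"
proof -
  have "gdist G p q > 0 \<and> gcos G (gdist G p q) = wip G p q \<and> gsin G (gdist G p q) = rad G p q
    \<and> (\<forall>t. 0 < t \<longrightarrow> t \<le> gdist G p q \<longrightarrow> gsin G t > 0)"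
  proof (cases G)
    case Hyperbolic
    then have w: "wip G p q > 1" using wip_range_hyperbolic assms by auto
    then show ?thesis using Hyperbolic
      by (simp add: arc_def gcos_def gsin_def rad_def sinh_arcosh_real)
  next
    case Spherical
    then have w: "\<bar>wip G p q\<bar> < 1" using wip_range_spherical assms by auto
    have "arccos (wip G p q) < pi" "0 < arccos (wip G p q)"
      using w arccos_lt_bounded[of "wip G p q"] by auto
    then show ?thesis using w Spherical
      by (auto simp: arc_def gcos_def gsin_def rad_def sin_arccos_abs cos_arccos_abs intro: sin_gt_zero)
  qed
  then show "gdist G p q > 0" "gcos G (gdist G p q) = wip G p q" "gsin G (gdist G p q) = rad G p q"
    "\<And>t. 0 < t \<Longrightarrow> t \<le> gdist G p q \<Longrightarrow> gsin G t > 0" by auto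
qed

lemma gsin_diff: "gsin G (a - b) = gsin G a * gcos G b - gcos G a * gsin G b"
  by (cases G) (simp_all add: gsin_def gcos_def sinh_diff sin_diff)

lemma gsin_0 [simp]: "gsin G 0 = 0" "gcos G 0 = 1"
  by (cases G; simp add: gsin_def gcos_def)+

text \<open>Interpolation by the sines of the distances to the two ends. On the segment both
  coefficients are nonnegative, so that the segment lies in the cone spanned by p and q.\<close>

lemma geod_gdir:
  assumes "p \<in> surf G" "q \<in> surf G" "p \<noteq> q"
  shows "geod G p (gdir G p q) t =
    (gsin G (gdist G p q - t) / rad G p q) *\<^sub>R p + (gsin G t / rad G p q) *\<^sub>R q"
proof -
  have r: "rad G p q > 0" using rad_sq assms by auto
  have g: "gcos G t = (rad G p q * gcos G t - wip G p q * gsin G t) / rad G p q + wip G p q * gsin G t / rad G p q"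
    using r by (simp add: field_simps)
  show ?thesis
    unfolding geod_eq gdir_def gsin_diff gdist_facts[OF assms]
    by (subst g) (simp add: algebra_simps scaleR_diff_right)
qed

lemma geod_gdir_end:
  assumes "p \<in> surf G" "q \<in> surf G" "p \<noteq> q"
  shows "geod G p (gdir G p q) (gdist G p q) = q"
  using rad_sq(2)[OF assms] unfolding geod_gdir[OF assms] by (simp add: gdist_facts[OF assms])

lemma velocity_geod: "velocity (geod G p u) t = (- kappa G * gsin G t) *\<^sub>R p + gcos G t *\<^sub>R u"
proof (cases G)
  case Hyperbolic
  have "((\<lambda>t. cosh t *\<^sub>R p + sinh t *\<^sub>R u) has_vector_derivative (sinh t *\<^sub>R p + cosh t *\<^sub>R u)) (at t)"
    by (auto intro!: derivative_eq_intros)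
  moreover have "geod G p u = (\<lambda>t. cosh t *\<^sub>R p + sinh t *\<^sub>R u)"
    using Hyperbolic by (simp add: fun_eq_iff geod_def)
  ultimately show ?thesis using Hyperbolic
    by (simp add: gsin_def gcos_def vector_derivative_at)
next
  case Spherical
  have "((\<lambda>t. cos t *\<^sub>R p + sin t *\<^sub>R u) has_vector_derivative (- sin t *\<^sub>R p + cos t *\<^sub>R u)) (at t)"
    by (auto intro!: derivative_eq_intros)
  moreover have "geod G p u = (\<lambda>t. cos t *\<^sub>R p + sin t *\<^sub>R u)"
    using Spherical by (simp add: fun_eq_iff geod_def)
  ultimately show ?thesis using Spherical
    by (simp add: gsin_def gcos_def vector_derivative_at)
qed

lemma velocity_geod_end:
  assumes "p \<in> surf G" "q \<in> surf G" "p \<noteq> q"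
  shows "velocity (geod G p (gdir G p q)) (gdist G p q) = - gdir G q p"
proof -
  have r: "rad G p q > 0" "(rad G p q)\<^sup>2 = kappa G * (1 - (wip G p q)\<^sup>2)"
    using rad_sq assms by auto
  have e: "kappa G * rad G p q = (1 - (wip G p q)\<^sup>2) / rad G p q"
  proof -
    have "kappa G * rad G p q * rad G p q = 1 - (wip G p q)\<^sup>2"
      using r(2) by (simp add: power2_eq_square mult.assoc)
    then show ?thesis using r(1) by (simp add: eq_divide_eq)
  qed
  have "(- kappa G * rad G p q) *\<^sub>R p + wip G p q *\<^sub>R gdir G p q = - gdir G q p"
    unfolding mult_minus_left e
    by (simp add: gdir_def rad_commute[of G q p] wip_commute[of G q p] diff_divide_distrib
        power2_eq_square algebra_simps)
  then show ?thesis unfolding velocity_geod gdist_facts[OF assms] .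
qed

lemma surf_smult_geod:
  assumes "p \<in> surf G" "u \<in> unit_tangents G p"
  shows "ip G (geod G p u t) (geod G p u t) = kappa G"
proof -
  have "kappa G * (gcos G t)\<^sup>2 + (gsin G t)\<^sup>2 = kappa G"
    using cosh_square_eq[of t] by (cases G) (auto simp: gcos_def gsin_def)
  then show ?thesis using assms
    by (simp add: geod_eq surf_def unit_tangents_def power2_eq_square ip_commute[of G u p] algebra_simps)
qed

lemma continuous_gsin: "continuous_on S (gsin G)"
  by (cases G) (auto simp: gsin_def[abs_def] intro!: continuous_intros)

lemma gsin_nonneg:
  assumes "p \<in> surf G" "q \<in> surf G" "p \<noteq> q" "0 \<le> t" "t \<le> gdist G p q"
  shows "gsin G t \<ge> 0"
  using gdist_facts(4)[OF assms(1-3), of t] assms(4,5) by (cases "t = 0") auto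

text \<open>The converse of the previous remark: the segment meets every ray of the cone. The ratio
  of the two coefficients in \<open>geod_gdir\<close> passes continuously from p to q, and the
  intermediate value theorem finds la : nu.\<close>

lemma geod_cone:
  assumes "p \<in> surf G" "q \<in> surf G" "p \<noteq> q" "la \<ge> 0" "nu \<ge> 0" "la + nu > 0"
  obtains t r where "0 \<le> t" "t \<le> gdist G p q" "r > 0"
    "geod G p (gdir G p q) t = r *\<^sub>R (la *\<^sub>R p + nu *\<^sub>R q)"
proof -
  define l where "l = gdist G p q"
  have l: "l > 0" and r0: "rad G p q > 0" using gdist_facts(1) rad_sq(2) assms unfolding l_def by auto
  have sl: "gsin G l > 0" using gdist_facts[OF assms(1-3)] r0 l_def by auto
  have "\<exists>t. 0 \<le> t \<and> t \<le> l \<and> la * gsin G t - nu * gsin G (l - t) = 0"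
  proof (rule IVT')
    show "continuous_on {0..l} (\<lambda>t. la * gsin G t - nu * gsin G (l - t))"
      by (intro continuous_intros continuous_on_compose2[OF continuous_gsin[of UNIV]]) auto
  qed (use l sl assms in auto)
  then obtain t where t: "0 \<le> t" "t \<le> l" "la * gsin G t = nu * gsin G (l - t)" by auto
  have s: "gsin G t \<ge> 0" "gsin G (l - t) \<ge> 0"
    using gsin_nonneg[OF assms(1-3)] t unfolding l_def by auto
  have s2: "gsin G t > 0 \<or> gsin G (l - t) > 0"
    using gdist_facts(4)[OF assms(1-3), of t] gdist_facts(4)[OF assms(1-3), of "l - t"] t l
    unfolding l_def[symmetric] by (cases "t = 0") auto
  \<comment> \<open>The factor is forced by comparing the sums of the two coefficients.\<close>
  define r where "r = (gsin G t + gsin G (l - t)) / ((la + nu) * rad G p q)"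
  have rp: "r > 0" unfolding r_def using s s2 assms r0 by (auto intro!: divide_pos_pos)
  have a: "gsin G (l - t) / rad G p q = r * la" "gsin G t / rad G p q = r * nu"
  proof -
    have "gsin G (l - t) * (la + nu) = la * (gsin G t + gsin G (l - t))"
      "gsin G t * (la + nu) = nu * (gsin G t + gsin G (l - t))"
      using t(3) by (simp_all add: algebra_simps)
    then show "gsin G (l - t) / rad G p q = r * la" "gsin G t / rad G p q = r * nu"
      using assms(6) r0 unfolding r_def by (simp_all add: frac_eq_eq mult.commute mult.left_commute)
  qed
  have "geod G p (gdir G p q) t = r *\<^sub>R (la *\<^sub>R p + nu *\<^sub>R q)"
    unfolding geod_gdir[OF assms(1-3)] l_def[symmetric] a by (simp add: scaleR_add_right)
  with t rp that show ?thesis unfolding l_def by blast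
qed

text \<open>A great circle leaves the hemisphere, but this part of it does not: by
  \<open>geod_gdir\<close> its points are nonnegative combinations of p and q, which keep a positive
  third coordinate.\<close>

lemma geodesic_segment_gdir:
  assumes "p \<in> surf G" "q \<in> surf G" "p \<noteq> q"
  shows "geodesic_segment G p q (geod G p (gdir G p q) ` {0..gdist G p q})"
proof -
  have r0: "rad G p q > 0" using rad_sq(2) assms by auto
  have "geod G p (gdir G p q) t \<in> surf G" if "t \<in> {0..gdist G p q}" for t
  proof -
    define l where "l = gdist G p q"
    have l: "l > 0" using gdist_facts(1) assms unfolding l_def by auto
    have s: "gsin G t \<ge> 0" "gsin G (l - t) \<ge> 0"
      using gsin_nonneg[OF assms(1-3)] that unfolding l_def by auto
    have s2: "gsin G t > 0 \<or> gsin G (l - t) > 0"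
      using gdist_facts(4)[OF assms(1-3), of t] gdist_facts(4)[OF assms(1-3), of "l - t"] that l
      unfolding l_def[symmetric] by (cases "t = 0") auto
    have "(geod G p (gdir G p q) t) $ 3 > 0"
    proof -
      define a b where "a = gsin G (l - t) / rad G p q" and "b = gsin G t / rad G p q"
      have ab: "a \<ge> 0" "b \<ge> 0" "a > 0 \<or> b > 0" using s s2 r0 by (auto simp: a_def b_def)
      have "p$3 > 0" "q$3 > 0" using assms(1,2) by (auto simp: surf_def)
      then have "a * p$3 + b * q$3 > 0" using ab
        by (metis add_nonneg_pos add_pos_nonneg less_imp_le mult_nonneg_nonneg mult_pos_pos)
      then show ?thesis
        unfolding geod_gdir[OF assms(1-3)] l_def[symmetric] a_def[symmetric] b_def[symmetric] by simp
    qed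
    then show ?thesis
      using surf_smult_geod[OF assms(1) gdir_unit_tangent[OF assms(1-3)], of t] by (simp add: surf_def)
  qed
  then show ?thesis unfolding geodesic_segment_def
    using assms(1) gdir_unit_tangent[OF assms(1-3)] gdist_facts(1)[OF assms(1-3)] geod_gdir_end[OF assms(1-3)]
    by (intro conjI bexI[of _ "gdir G p q"] exI[of _ "gdist G p q"]) auto
qed

subsection \<open>Convex sets as cones\<close>

text \<open>Geodesic convexity becomes convexity of the cone over C, so that linear functionals on
  R^3 apply; r brings the combination back to the surface.\<close>

lemma geo_convex_cone:
  assumes "geo_convex G C" "p \<in> C" "q \<in> C" "la \<ge> 0" "nu \<ge> 0" "la + nu > 0"
  shows "\<exists>r>0. r *\<^sub>R (la *\<^sub>R p + nu *\<^sub>R q) \<in> C"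
proof (cases "p = q")
  case True
  then have "(1 / (la + nu)) *\<^sub>R (la *\<^sub>R p + nu *\<^sub>R q) = p"
    using assms(6) by (simp add: scaleR_add_left[symmetric])
  then show ?thesis using assms by (intro exI[of _ "1 / (la + nu)"]) auto
next
  case False
  have s: "p \<in> surf G" "q \<in> surf G" using assms by (auto simp: geo_convex_def)
  obtain t r where t: "0 \<le> t" "t \<le> gdist G p q" "r > 0"
    "geod G p (gdir G p q) t = r *\<^sub>R (la *\<^sub>R p + nu *\<^sub>R q)"
    using geod_cone[OF s False assms(4-6)] by blast
  have "geod G p (gdir G p q) ` {0..gdist G p q} \<subseteq> C"
    using geodesic_segment_gdir[OF s False] assms(1-3) unfolding geo_convex_def by blast
  then have "r *\<^sub>R (la *\<^sub>R p + nu *\<^sub>R q) \<in> C"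
    unfolding t(4)[symmetric] using t(1,2) by auto
  then show ?thesis using t by blast
qed

lemma surf_third_pos: "x \<in> surf G \<Longrightarrow> x $ 3 > 0"
  by (simp add: surf_def)

text \<open>Separation takes place in the plane with third coordinate 1, onto which geodesics project as lines.\<close>
lemma geo_convex_separate:
  assumes "geo_convex G C" "compact C" "x \<in> surf G" "x \<notin> C"
  obtains n where "n \<bullet> x < 0" "\<And>y. y \<in> C \<Longrightarrow> n \<bullet> y > 0"
proof -
  have sC: "C \<subseteq> surf G" using assms by (simp add: geo_convex_def)
  define h :: "real^3 \<Rightarrow> real^3" where "h y = (1 / y$3) *\<^sub>R y" for y
  have h3: "h y $ 3 = 1" if "y \<in> surf G" for y using surf_third_pos[OF that] by (simp add: h_def)
  have "convex (h ` C)"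
    unfolding convex_alt
  proof clarify
    fix p q and u :: real assume pq: "p \<in> C" "q \<in> C" and u: "0 \<le> u" "u \<le> 1"
    have p3: "p$3 > 0" "q$3 > 0" using pq sC surf_third_pos by blast+
    have "(1 - u) / p$3 \<ge> 0" "u / q$3 \<ge> 0" using u p3 by auto
    moreover have "(1 - u) / p$3 + u / q$3 > 0"
      using u p3 by (cases "u = 0") (auto intro!: add_nonneg_pos divide_pos_pos)
    ultimately obtain r where r: "r > 0" "r *\<^sub>R (((1 - u) / p$3) *\<^sub>R p + (u / q$3) *\<^sub>R q) \<in> C"
      using geo_convex_cone[OF assms(1) pq] by blast
    define z where "z = r *\<^sub>R (((1 - u) / p$3) *\<^sub>R p + (u / q$3) *\<^sub>R q)"
    have z3: "z $ 3 = r" using p3 by (simp add: z_def)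
    have "h z = (1 - u) *\<^sub>R h p + u *\<^sub>R h q"
      unfolding h_def z3 using r by (simp add: z_def scaleR_add_right)
    then show "(1 - u) *\<^sub>R h p + u *\<^sub>R h q \<in> h ` C" using r(2) unfolding z_def[symmetric] by (metis imageI)
  qed
  moreover have "compact (h ` C)"
    unfolding h_def
    by (intro compact_continuous_image continuous_intros assms(2)) (use sC surf_third_pos in force)
  moreover have "h x \<notin> h ` C"
  proof
    assume "h x \<in> h ` C"
    then obtain y where y: "y \<in> C" "h x = h y" by auto
    have pos: "x$3 > 0" "y$3 > 0" using y sC assms(3) surf_third_pos by blast+
    have "x = (x$3 / y$3) *\<^sub>R y"
    proof -
      have "x = x$3 *\<^sub>R h x" using pos by (simp add: h_def)
      also have "\<dots> = (x$3 / y$3) *\<^sub>R y" unfolding y(2) by (simp add: h_def)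
      finally show ?thesis .
    qed
    moreover from this have "x$3 / y$3 = 1"
      using surf_scale_unique[of y G "x$3 / y$3"] y sC assms(3) pos by auto
    ultimately have "x = y" by simp
    then show False using y assms(4) by simp
  qed
  ultimately obtain a b where ab: "a \<bullet> h x < b" "\<And>z. z \<in> h ` C \<Longrightarrow> a \<bullet> z > b"
    using separating_hyperplane_closed_point[of "h ` C" "h x"] compact_imp_closed by blast
  \<comment> \<open>On the plane the third coordinate is 1; putting it in place of the constant
    makes the affine inequality linear, hence valid on the whole cone.\<close>
  define n where "n = a - b *\<^sub>R (axis 3 1 :: real^3)"
  have n: "n \<bullet> y = y$3 * (a \<bullet> h y - b)" if "y \<in> surf G" for y
    using surf_third_pos[OF that] by (simp add: n_def h_def inner_diff_left inner_axis' field_simps)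
  show ?thesis
  proof
    show "n \<bullet> x < 0" using n[OF assms(3)] ab(1) surf_third_pos[OF assms(3)] by (simp add: mult_pos_neg)
    show "n \<bullet> y > 0" if "y \<in> C" for y
      using n[of y] ab(2)[of "h y"] surf_third_pos[of y G] that sC by auto
  qed
qed

text \<open>The direction d is arbitrary, so y + e d need not lie on the surface. Near e = 0 its
  square is close to that of y, and dividing by the square root of the ratio \<open>q e\<close>
  projects it back close to y.\<close>

lemma inter_move:
  assumes "y \<in> inter G K" "K \<subseteq> surf G"
  shows "\<exists>e>0. \<exists>r>0. r *\<^sub>R (y + e *\<^sub>R d) \<in> K"
proof -
  obtain V where V: "open V" "y \<in> V" "surf G \<inter> V \<subseteq> K" and ys: "y \<in> surf G"
  proof -
    obtain T where T: "openin (surf_top G) T" "y \<in> T" "T \<subseteq> K"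
      using assms(1) unfolding interior_of_def by blast
    then obtain V where "open V" "T = surf G \<inter> V" by (auto simp: openin_open)
    with T show thesis by (intro that[of V]) auto
  qed
  define q where "q e = kappa G * ip G (y + e *\<^sub>R d) (y + e *\<^sub>R d)" for e
  define z where "z e = (1 / sqrt (q e)) *\<^sub>R (y + e *\<^sub>R d)" for e
  have q0: "q 0 = 1" using ys by (simp add: q_def surf_def)
  have tq: "(q \<longlongrightarrow> 1) (at_right 0)"
  proof -
    have "(q \<longlongrightarrow> q 0) (at_right 0)" unfolding q_def by (intro tendsto_intros)
    then show ?thesis by (simp add: q0)
  qed
  have tz: "(z \<longlongrightarrow> y) (at_right 0)"
  proof -
    have "(z \<longlongrightarrow> (1 / sqrt 1) *\<^sub>R (y + 0 *\<^sub>R d)) (at_right 0)"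
      unfolding z_def by (intro tendsto_intros tq) auto
    then show ?thesis by simp
  qed
  have "\<forall>\<^sub>F e in at_right 0. q e > 0" using order_tendstoD(1)[OF tq] by simp
  moreover have "\<forall>\<^sub>F e in at_right 0. z e \<in> V" using tz V topological_tendstoD by blast
  moreover have "\<forall>\<^sub>F e in at_right 0. z e $ 3 > 0"
    using order_tendstoD(1)[OF tendsto_vec_nth[OF tz], of 0 3] surf_third_pos[OF ys] by simp
  moreover have "\<forall>\<^sub>F e in at_right 0. e > (0::real)" by (rule eventually_at_right_less)
  ultimately have "\<forall>\<^sub>F e in at_right 0. q e > 0 \<and> z e \<in> V \<and> z e $ 3 > 0 \<and> e > (0::real)"
    by eventually_elim auto
  then obtain e where e: "q e > 0" "z e \<in> V" "z e $ 3 > 0" "e > 0"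
    using eventually_happens'[OF trivial_limit_at_right_real] by blast
  define v where "v = y + e *\<^sub>R d"
  have "ip G (z e) (z e) = ip G v v / (sqrt (q e) * sqrt (q e))"
    unfolding z_def v_def[symmetric] by simp
  also have "\<dots> = kappa G * q e / q e"
    using e(1) unfolding q_def v_def[symmetric] by simp
  finally have "z e \<in> surf G" using e by (simp add: surf_def)
  then have "z e \<in> K" using V e by blast
  then show ?thesis using e unfolding z_def by (intro exI[of _ e] conjI exI[of _ "1 / sqrt (q e)"]) auto
qed

text \<open>A small move from y in the direction -n would make the functional negative if it were
  not positive at y.\<close>

lemma inter_functional_pos:
  assumes "y \<in> inter G K" "K \<subseteq> surf G" "\<And>x. x \<in> K \<Longrightarrow> n \<bullet> x \<ge> 0" "n \<noteq> 0"
  shows "n \<bullet> y > 0"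
proof -
  obtain e r where er: "e > 0" "r > 0" "r *\<^sub>R (y + e *\<^sub>R (- n)) \<in> K"
    using inter_move[OF assms(1,2)] by blast
  have "0 \<le> r * (n \<bullet> y - e * (n \<bullet> n))"
    using assms(3)[OF er(3)] by (simp add: inner_diff_right)
  then have "n \<bullet> y \<ge> e * (n \<bullet> n)" using er by (simp add: zero_le_mult_iff)
  moreover have "e * (n \<bullet> n) > 0" using er assms(4) by simp
  ultimately show ?thesis by simp
qed

lemma closedin_surf_compact:
  assumes "compact K" "K \<subseteq> surf G"
  shows "bdry G K = K - inter G K"
  using assms by (simp add: frontier_of_def closure_of_closedin closed_subset compact_imp_closed)

text \<open>Points outside K converge to y; normalised functionals separating them from K have a
  limit, by compactness of the sphere, and this limit vanishes at y.\<close>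

lemma support_exists:
  assumes "geo_convex G K" "compact K" "y \<in> bdry G K"
  obtains n where "n \<noteq> 0" "n \<bullet> y = 0" "\<And>x. x \<in> K \<Longrightarrow> n \<bullet> x \<ge> 0"
proof -
  have sK: "K \<subseteq> surf G" using assms by (simp add: geo_convex_def)
  have yK: "y \<in> K" "y \<notin> inter G K" using assms closedin_surf_compact[OF assms(2) sK] by auto
  have "\<exists>x. x \<in> surf G \<and> x \<notin> K \<and> dist x y < 1 / real (Suc k)" for k
  proof (rule ccontr)
    assume "\<not> ?thesis"
    then have "surf G \<inter> ball y (1 / real (Suc k)) \<subseteq> K" by (auto simp: dist_commute)
    then have "y \<in> inter G K" unfolding interior_of_def
      using yK sK by (auto intro!: exI[of _ "surf G \<inter> ball y (1 / real (Suc k))"])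
    then show False using yK by simp
  qed
  then obtain x where x: "\<And>k. x k \<in> surf G" "\<And>k. x k \<notin> K" "\<And>k. dist (x k) y < 1 / real (Suc k)"
    by metis
  have "\<exists>n. norm n = 1 \<and> n \<bullet> x k \<le> 0 \<and> (\<forall>z\<in>K. n \<bullet> z \<ge> 0)" for k
  proof -
    obtain n where n: "n \<bullet> x k < 0" "\<And>z. z \<in> K \<Longrightarrow> n \<bullet> z > 0"
      using geo_convex_separate[OF assms(1,2) x(1) x(2), of k] by blast
    then have "n \<noteq> 0" by auto
    then show ?thesis using n
      by (intro exI[of _ "(1 / norm n) *\<^sub>R n"])
        (auto simp: field_simps less_imp_le)
  qed
  then obtain n where n: "\<And>k. norm (n k) = 1" "\<And>k. n k \<bullet> x k \<le> 0" "\<And>k z. z \<in> K \<Longrightarrow> n k \<bullet> z \<ge> 0"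
    by metis
  have "\<exists>l\<in>sphere 0 1. \<exists>r::nat\<Rightarrow>nat. strict_mono r \<and> (n \<circ> r) \<longlonglongrightarrow> l"
    using compact_sphere[of "0::real^3" 1] n(1) unfolding compact_def by (metis mem_sphere_0)
  then obtain m r where m: "norm m = 1" "strict_mono r" "(n \<circ> r) \<longlonglongrightarrow> m" by auto
  have xl: "x \<longlonglongrightarrow> y"
  proof (rule LIMSEQ_I)
    fix e :: real assume "e > 0"
    then obtain k0 where k0: "1 / real (Suc k0) < e" using nat_approx_posE by blast
    have "norm (x k - y) < e" if "k \<ge> k0" for k
    proof -
      have "1 / real (Suc k) \<le> 1 / real (Suc k0)" using that by (simp add: frac_le)
      then show ?thesis using x(3)[of k] k0 by (simp add: dist_norm)
    qed
    then show "\<exists>no. \<forall>k\<ge>no. norm (x k - y) < e" by blast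
  qed
  have "(\<lambda>k. n (r k) \<bullet> x (r k)) \<longlonglongrightarrow> m \<bullet> y"
    using tendsto_inner[OF m(3) LIMSEQ_subseq_LIMSEQ[OF xl m(2)]] by (simp add: o_def)
  then have "m \<bullet> y \<le> 0" using n(2) by (intro LIMSEQ_le_const2) auto
  moreover have ge: "m \<bullet> z \<ge> 0" if "z \<in> K" for z
  proof -
    have "(\<lambda>k. n (r k) \<bullet> z) \<longlonglongrightarrow> m \<bullet> z"
      using tendsto_inner[OF m(3) tendsto_const[of z]] by (simp add: o_def)
    then show ?thesis using n(3)[OF that] by (intro LIMSEQ_le_const) auto
  qed
  ultimately have "m \<bullet> y = 0" using yK(1) by (meson antisym)
  moreover have "m \<noteq> 0" using m(1) by auto
  ultimately show ?thesis using that ge by blast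
qed

text \<open>A functional that separates a point of C from K attains its minimum over C, relative to
  the third coordinate, at a boundary point of C. That point belongs to K, where the functional is
  positive. The lemma is applied to a caustic inside the table and also with the two sets
  exchanged.\<close>

lemma compact_convex_subset_if_bdry_subset:
  assumes "geo_convex G K" "compact K" "K \<noteq> {}" "geo_convex G C" "compact C" "bdry G C \<subseteq> K"
  shows "C \<subseteq> K"
proof (rule ccontr)
  assume "\<not> C \<subseteq> K"
  then obtain x where x: "x \<in> C" "x \<notin> K" by auto
  have sC: "C \<subseteq> surf G" and sK: "K \<subseteq> surf G" using assms by (auto simp: geo_convex_def)
  obtain n where n: "n \<bullet> x < 0" "\<And>y. y \<in> K \<Longrightarrow> n \<bullet> y > 0"
    using geo_convex_separate[OF assms(1,2), of x] x sC by auto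
  have c3: "continuous_on C (\<lambda>y. (n \<bullet> y) / y$3)"
    by (intro continuous_intros) (use sC surf_third_pos in force)
  obtain y where y: "y \<in> C" "\<And>z. z \<in> C \<Longrightarrow> (n \<bullet> y) / y$3 \<le> (n \<bullet> z) / z$3"
    using continuous_attains_inf[OF assms(5) _ c3] x by blast
  define m where "m = (n \<bullet> y) / y$3"
  have "m \<le> (n \<bullet> x) / x$3" unfolding m_def using y(2) x(1) by blast
  moreover have "(n \<bullet> x) / x$3 < 0" using n(1) x(1) sC surf_third_pos by (intro divide_neg_pos) auto
  ultimately have m: "m < 0" by simp
  \<comment> \<open>Subtracting the minimal ratio gives a functional that is nonnegative on C and
    vanishes at the minimiser, which is therefore not an interior point.\<close>
  define n' where "n' = n - m *\<^sub>R (axis 3 1 :: real^3)"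
  have n'z: "n' \<bullet> z = n \<bullet> z - m * z$3" for z
    by (simp add: n'_def inner_diff_left inner_axis')
  have ge: "n' \<bullet> z \<ge> 0" if "z \<in> C" for z
  proof -
    have "z$3 > 0" using that sC surf_third_pos by blast
    then show ?thesis using y(2)[OF that] unfolding n'z m_def[symmetric] by (simp add: field_simps)
  qed
  have y3: "y$3 > 0" using y sC surf_third_pos by blast
  have y0: "n' \<bullet> y = 0" unfolding n'z m_def using y3 by simp
  have "n' \<noteq> 0"
  proof
    assume "n' = 0"
    obtain z where z: "z \<in> K" using assms by auto
    then have "n \<bullet> z = m * z$3" using \<open>n' = 0\<close> n'z[of z] by simp
    moreover have "m * z$3 < 0" using m z sK surf_third_pos by (intro mult_neg_pos) auto
    ultimately show False using n(2)[OF z] by simp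
  qed
  then have "y \<notin> inter G C" using inter_functional_pos[of y G C n'] ge sC y0 by auto
  then have "y \<in> K" using assms(6) y closedin_surf_compact[OF assms(5) sC] by blast
  then have "n \<bullet> y > 0" using n by blast
  then show False using m y3 unfolding m_def by (simp add: zero_less_divide_iff divide_less_0_iff)
qed

subsection \<open>Second-order estimates\<close>

text \<open>Taylor estimates from either end of the interval, each obtained from the monotonicity of
  the function minus its quadratic comparison. Derivatives are taken within the interval because the
  boundary is only one-sidedly twice differentiable at the ends of its pieces.\<close>

lemma second_order_lower:
  fixes \<phi> \<phi>' \<phi>'' :: "real \<Rightarrow> real"
  assumes "p \<le> q"
    and 1: "\<And>t. t \<in> {p..q} \<Longrightarrow> (\<phi> has_real_derivative \<phi>' t) (at t within {p..q})"
    and 2: "\<And>t. t \<in> {p..q} \<Longrightarrow> (\<phi>' has_real_derivative \<phi>'' t) (at t within {p..q})"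
    and m: "\<And>t. t \<in> {p..q} \<Longrightarrow> m \<le> \<phi>'' t"
  shows "\<phi>' q - \<phi>' p \<ge> m * (q - p)"
    and "\<phi> q - \<phi> p - \<phi>' p * (q - p) \<ge> m / 2 * (q - p)\<^sup>2"
    and "\<phi> p - \<phi> q + \<phi>' q * (q - p) \<ge> m / 2 * (q - p)\<^sup>2"
proof -
  have c: "continuous_on {p..q} \<phi>" "continuous_on {p..q} \<phi>'"
    using 1 2 by (meson DERIV_continuous continuous_on_eq_continuous_within)+
  have inc: "\<phi>' y - \<phi>' x \<ge> m * (y - x)" if "p \<le> x" "x \<le> y" "y \<le> q" for x y
  proof -
    have "\<phi>' x - m * x \<le> \<phi>' y - m * y"
    proof (rule DERIV_nonneg_imp_increasing_open[where f = "\<lambda>t. \<phi>' t - m * t"])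
      fix t assume t: "x < t" "t < y"
      then have "(\<phi>' has_real_derivative \<phi>'' t) (at t)"
        using 2[of t] that by (simp add: at_within_Icc_at)
      then show "\<exists>z. ((\<lambda>t. \<phi>' t - m * t) has_real_derivative z) (at t) \<and> 0 \<le> z"
        using m[of t] t that by (intro exI[of _ "\<phi>'' t - m"]) (auto intro!: derivative_eq_intros)
    qed (use that c in \<open>auto intro!: continuous_intros intro: continuous_on_subset\<close>)
    then show ?thesis by (simp add: algebra_simps)
  qed
  show "\<phi>' q - \<phi>' p \<ge> m * (q - p)" using inc assms(1) by auto
  have "\<phi> p - \<phi>' p * (p - p) - m / 2 * (p - p)\<^sup>2 \<le> \<phi> q - \<phi>' p * (q - p) - m / 2 * (q - p)\<^sup>2"
  proof (rule DERIV_nonneg_imp_increasing_open[where f = "\<lambda>t. \<phi> t - \<phi>' p * (t - p) - m / 2 * (t - p)\<^sup>2"])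
    fix t assume t: "p < t" "t < q"
    then have "(\<phi> has_real_derivative \<phi>' t) (at t)"
      using 1[of t] by (simp add: at_within_Icc_at)
    then show "\<exists>z. ((\<lambda>t. \<phi> t - \<phi>' p * (t - p) - m / 2 * (t - p)\<^sup>2) has_real_derivative z) (at t) \<and> 0 \<le> z"
      using inc[of p t] t
      by (intro exI[of _ "\<phi>' t - \<phi>' p - m * (t - p)"]) (auto intro!: derivative_eq_intros)
  qed (use assms(1) c in \<open>auto intro!: continuous_intros\<close>)
  then show "\<phi> q - \<phi> p - \<phi>' p * (q - p) \<ge> m / 2 * (q - p)\<^sup>2" by simp
  have "- \<phi> p - \<phi>' q * (q - p) + m / 2 * (q - p)\<^sup>2 \<le> - \<phi> q - \<phi>' q * (q - q) + m / 2 * (q - q)\<^sup>2"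
  proof (rule DERIV_nonneg_imp_increasing_open[where f = "\<lambda>t. - \<phi> t - \<phi>' q * (q - t) + m / 2 * (q - t)\<^sup>2"])
    fix t assume t: "p < t" "t < q"
    then have "(\<phi> has_real_derivative \<phi>' t) (at t)"
      using 1[of t] by (simp add: at_within_Icc_at)
    then show "\<exists>z. ((\<lambda>t. - \<phi> t - \<phi>' q * (q - t) + m / 2 * (q - t)\<^sup>2) has_real_derivative z) (at t) \<and> 0 \<le> z"
      using inc[of t q] t
      by (intro exI[of _ "\<phi>' q - \<phi>' t - m * (q - t)"]) (auto intro!: derivative_eq_intros simp: field_simps)
  qed (use assms(1) c in \<open>auto intro!: continuous_intros\<close>)
  then show "\<phi> p - \<phi> q + \<phi>' q * (q - p) \<ge> m / 2 * (q - p)\<^sup>2" by simp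
qed

lemma second_order_bounds:
  fixes \<phi> \<phi>' \<phi>'' :: "real \<Rightarrow> real"
  assumes "p \<le> q"
    and 1: "\<And>t. t \<in> {p..q} \<Longrightarrow> (\<phi> has_real_derivative \<phi>' t) (at t within {p..q})"
    and 2: "\<And>t. t \<in> {p..q} \<Longrightarrow> (\<phi>' has_real_derivative \<phi>'' t) (at t within {p..q})"
    and k: "\<And>t. t \<in> {p..q} \<Longrightarrow> \<bar>\<phi>'' t - k\<bar> \<le> \<epsilon>"
  shows "\<bar>\<phi>' q - \<phi>' p - k * (q - p)\<bar> \<le> \<epsilon> * (q - p)"
    and "\<bar>\<phi> q - \<phi> p - \<phi>' p * (q - p) - k / 2 * (q - p)\<^sup>2\<bar> \<le> \<epsilon> / 2 * (q - p)\<^sup>2"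
    and "\<bar>\<phi> p - \<phi> q + \<phi>' q * (q - p) - k / 2 * (q - p)\<^sup>2\<bar> \<le> \<epsilon> / 2 * (q - p)\<^sup>2"
proof -
  have lo: "k - \<epsilon> \<le> \<phi>'' t" and hi: "- k - \<epsilon> \<le> - \<phi>'' t" if "t \<in> {p..q}" for t
    using k[OF that] by auto
  note A = second_order_lower[OF assms(1) 1 2 lo]
  note B = second_order_lower[of p q "\<lambda>t. - \<phi> t" "\<lambda>t. - \<phi>' t", OF assms(1) DERIV_minus[OF 1] DERIV_minus[OF 2] hi]
  show "\<bar>\<phi>' q - \<phi>' p - k * (q - p)\<bar> \<le> \<epsilon> * (q - p)"
    using A(1) B(1) by (simp add: algebra_simps abs_le_iff)
  have e: "(k - \<epsilon>) / 2 * x = k / 2 * x - \<epsilon> / 2 * x" "(- k - \<epsilon>) / 2 * x = - (k / 2 * x) - \<epsilon> / 2 * x" for x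
    by (simp_all add: algebra_simps diff_divide_distrib)
  show "\<bar>\<phi> q - \<phi> p - \<phi>' p * (q - p) - k / 2 * (q - p)\<^sup>2\<bar> \<le> \<epsilon> / 2 * (q - p)\<^sup>2"
    using A(2) B(2) unfolding e by linarith
  show "\<bar>\<phi> p - \<phi> q + \<phi>' q * (q - p) - k / 2 * (q - p)\<^sup>2\<bar> \<le> \<epsilon> / 2 * (q - p)\<^sup>2"
    using A(3) B(3) unfolding e by linarith
qed

text \<open>The frame is taken at u and the second derivative at t, independently: for a chord
  across a jump they lie on different sides of s, and g is available on one side only.\<close>

lemma det3_joint_eps:
  fixes c v g :: "real \<Rightarrow> real^3"
  assumes "continuous_on UNIV c" "continuous_on UNIV v" "continuous_on J g" "s \<in> J" "\<epsilon> > 0"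
  obtains \<delta> where "\<delta> > 0"
    "\<And>t u. t \<in> J \<Longrightarrow> \<bar>t - s\<bar> \<le> \<delta> \<Longrightarrow> \<bar>u - s\<bar> \<le> \<delta> \<Longrightarrow>
      \<bar>det3 (c u) (v u) (g t) - det3 (c s) (v s) (g s)\<bar> \<le> \<epsilon>"
proof -
  have "continuous_on (UNIV \<times> J) (\<lambda>z. det3 (c (fst z)) (v (fst z)) (g (snd z)))"
    by (intro continuous_intros continuous_on_compose2[OF assms(1)] continuous_on_compose2[OF assms(2)]
        continuous_on_compose2[OF assms(3)]) auto
  then obtain d where d: "d > 0" "\<And>z. z \<in> UNIV \<times> J \<Longrightarrow> dist z (s, s) < d \<Longrightarrow>
      dist (det3 (c (fst z)) (v (fst z)) (g (snd z))) (det3 (c s) (v s) (g s)) < \<epsilon>"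
    using assms(4,5) unfolding continuous_on_iff by (metis SigmaI UNIV_I fst_conv snd_conv)
  show thesis
  proof (rule that[of "d / 3"])
    show "\<bar>det3 (c u) (v u) (g t) - det3 (c s) (v s) (g s)\<bar> \<le> \<epsilon>"
      if "t \<in> J" "\<bar>t - s\<bar> \<le> d / 3" "\<bar>u - s\<bar> \<le> d / 3" for t u
    proof -
      have "dist (u, t) (s, s) \<le> dist u s + dist t s"
        by (metis dist_Pair_Pair sqrt_sum_squares_le_sum zero_le_dist)
      then have "dist (u, t) (s, s) < d" using that d(1) by (simp add: dist_real_def)
      then show ?thesis using d(2)[of "(u, t)"] that by (simp add: dist_real_def)
    qed
  qed (use d in auto)
qed

lemma nonzero_same_sign:
  fixes F :: "real \<Rightarrow> real"
  assumes "continuous_on {a<..<b} F" "\<And>x. a < x \<Longrightarrow> x < b \<Longrightarrow> F x \<noteq> 0"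
    "a < x" "x < b" "F x > 0" "a < y" "y < b"
  shows "F y > 0"
proof (rule ccontr)
  assume "\<not> F y > 0"
  then have y: "F y < 0" using assms(2)[of y] assms by force
  have "connected (F ` {a<..<b})" using assms(1) by (intro connected_continuous_image) auto
  then have "0 \<in> F ` {a<..<b}"
    unfolding connected_iff_interval using y assms(3-7)
    by (meson greaterThanLessThan_iff image_eqI less_imp_le)
  then show False using assms(2) by auto
qed

subsection \<open>The boundary curve\<close>

locale table =
  fixes G :: geometry and K :: "(real^3) set" and c :: "real \<Rightarrow> real^3" and L m :: real
  assumes tab: "convex_billiard_table G K"
    and arcl: "arclength_boundary G K c L"
    and pw: "piecewise_C2 c L"
    and m_pos: "m > 0"
    and curv: "\<And>t. isCont (geodesic_curvature G c) t \<Longrightarrow> geodesic_curvature G c t \<ge> m"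
begin

abbreviation "v \<equiv> velocity c"

lemma L_pos: "L > 0" and per: "c (t + L) = c t" and inj0: "inj_on c {0..<L}"
  and range_c: "range c = bdry G K" and vcont: "continuous_on UNIV v"
  and v_unit: "ip G (v t) (v t) = 1"
  and inward: "\<exists>\<epsilon>>0. \<forall>s\<in>{0<..<\<epsilon>}. geod G (c t) (rot90 G (c t) (v t)) s \<in> K"
  using arcl unfolding arclength_boundary_def by blast+

lemma K_convex: "geo_convex G K" and K_compact: "compact K" and K_surf: "K \<subseteq> surf G"
  using tab by (auto simp: convex_billiard_table_def geo_convex_def)

lemma bdry_K: "bdry G K = K - inter G K"
  by (rule closedin_surf_compact[OF K_compact K_surf])

lemma c_K [simp]: "c t \<in> K"
  using range_c bdry_K by auto

lemma c_surf [simp]: "c t \<in> surf G"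
  using c_K K_surf by blast

lemma c_deriv: "(c has_vector_derivative v t) (at t within S)"
proof -
  have "c differentiable at t" using arcl unfolding arclength_boundary_def by (elim conjE) (erule spec)
  then show ?thesis
    using vector_derivative_works has_vector_derivative_at_within by blast
qed

lemma c_cont: "continuous_on S c"
  unfolding continuous_on_eq_continuous_within
  by (intro ballI has_vector_derivative_continuous[OF c_deriv])

lemma isCont_c: "isCont c s" and isCont_v: "isCont v s"
  using c_cont[of UNIV] vcont by (simp_all add: continuous_on_eq_continuous_at)

lemma c_has_derivative: "(c has_derivative (\<lambda>h. h *\<^sub>R v t)) (at t within S)"
  using c_deriv by (simp add: has_vector_derivative_def)

lemma v_tangent: "v t \<in> unit_tangents G (c t)"
proof -
  have "((\<lambda>t. ip G (c t) (c t)) has_derivative (\<lambda>h. ip G (c t) (h *\<^sub>R v t) + ip G (h *\<^sub>R v t) (c t))) (at t)"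
    by (intro has_derivative_ip c_has_derivative)
  moreover have "ip G (c x) (c x) = kappa G" for x using c_surf by (auto simp: surf_def)
  then have "((\<lambda>t. ip G (c t) (c t)) has_derivative (\<lambda>h. 0)) (at t)" by simp
  ultimately have "(\<lambda>h::real. ip G (c t) (h *\<^sub>R v t) + ip G (h *\<^sub>R v t) (c t)) = (\<lambda>h. 0)"
    by (rule has_derivative_unique)
  from fun_cong[OF this, of 1] show ?thesis
    using v_unit by (simp add: unit_tangents_def ip_commute)
qed

lemma ip_c_v [simp]: "ip G (c t) (v t) = 0" "ip G (v t) (c t) = 0"
  using v_tangent by (auto simp: unit_tangents_def ip_commute)

lemma per_int: "c (t + of_int n * L) = c t"
proof -
  have a: "c (t + of_nat k * L) = c t" for t k
  proof (induction k)
    case (Suc k)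
    then show ?case using per[of "t + of_nat k * L"] by (simp add: algebra_simps)
  qed simp
  show ?thesis
  proof (cases n rule: int_cases2)
    case (nonneg k) then show ?thesis using a[of t k] by simp
  next
    case (nonpos k)
    then show ?thesis using a[of "t - of_nat k * L" k] by simp
  qed
qed

lemma v_per_int: "v (t + of_int n * L) = v t"
proof -
  have "((\<lambda>x. x + of_int n * L) has_vector_derivative 1) (at t)"
    by (auto intro!: derivative_eq_intros)
  from vector_diff_chain_at[OF this c_deriv]
  have "((\<lambda>x. c (x + of_int n * L)) has_vector_derivative v (t + of_int n * L)) (at t)"
    by (simp add: o_def)
  then show ?thesis unfolding per_int by (simp add: vector_derivative_at)
qed

lemma shift_to_period:
  obtains n :: int where "t - of_int n * L \<in> {a..<a + L}"
proof
  define n where "n = \<lfloor>(t - a) / L\<rfloor>"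
  have "of_int n \<le> (t - a) / L" "(t - a) / L < of_int n + 1" unfolding n_def by linarith+
  then have "of_int n * L \<le> t - a" "t - a < (of_int n + 1) * L"
    using L_pos by (simp_all add: field_simps)
  then show "t - of_int n * L \<in> {a..<a + L}" by (simp add: algebra_simps)
qed

lemma c_inj: assumes "0 < t - s" "t - s < L" shows "c s \<noteq> c t"
proof
  assume e: "c s = c t"
  obtain n where n: "s - of_int n * L \<in> {0..<0 + L}" using shift_to_period .
  obtain k where k: "t - of_int k * L \<in> {0..<0 + L}" using shift_to_period .
  have "c (s - of_int n * L) = c (t - of_int k * L)"
    using per_int[of "s - of_int n * L" n] per_int[of "t - of_int k * L" k] e by simp
  then have "s - of_int n * L = t - of_int k * L" using inj0 n k by (auto dest: inj_onD)
  then have e2: "t - s = of_int (k - n) * L" by (simp add: algebra_simps)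
  then have "0 < of_int (k - n) * L" "of_int (k - n) * L < 1 * L" using assms by auto
  then have "0 < real_of_int (k - n)" "real_of_int (k - n) < 1"
    using L_pos by (simp_all only: zero_less_mult_iff mult_less_cancel_right_pos) auto
  then have "0 < k - n" "k - n < 1" by linarith+
  then show False by simp
qed

lemma c_inj': "\<bar>t - s\<bar> < L \<Longrightarrow> t \<noteq> s \<Longrightarrow> c s \<noteq> c t"
  using c_inj[of s t] c_inj[of t s] by (cases "s < t") (auto dest: not_sym)

lemma bdry_param: assumes "y \<in> bdry G K" obtains t where "y = c t" "a \<le> t" "t < a + L"
proof -
  obtain t0 where t0: "y = c t0" using assms range_c by auto
  obtain n where "t0 - of_int n * L \<in> {a..<a + L}" using shift_to_period .
  then show thesis using that[of "t0 - of_int n * L"] t0 per_int[of "t0 - of_int n * L" n] by simp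
qed

text \<open>g is the second derivative of c on the piece I, one-sided at its ends. It is carried
  along as a separate function because \<open>velocity v\<close> may be meaningless at a
  breakpoint.\<close>

definition velocity_C1_on :: "real set \<Rightarrow> (real \<Rightarrow> real^3) \<Rightarrow> bool" where
  "velocity_C1_on I g \<longleftrightarrow> continuous_on I g \<and> (\<forall>t\<in>I. (v has_vector_derivative g t) (at t within I))"

lemma velocity_C1_on_subset: "velocity_C1_on I g \<Longrightarrow> J \<subseteq> I \<Longrightarrow> velocity_C1_on J g"
  unfolding velocity_C1_on_def
  by (meson continuous_on_subset has_vector_derivative_within_subset subsetD)

text \<open>Take the neighbouring partition points around s. When s itself is a partition point it
  must serve as the left one for a piece to the right, and as the right one for a piece to the left;
  hence the exchange of strict and weak inequalities between the two halves.\<close>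

lemma velocity_C1_near:
  assumes "0 \<le> s" "s \<le> L"
  shows "s < L \<Longrightarrow> \<exists>e>s. \<exists>g. velocity_C1_on {s..e} g"
    and "0 < s \<Longrightarrow> \<exists>e<s. \<exists>g. velocity_C1_on {e..s} g"
proof -
  obtain S where S: "finite S" "{0, L} \<subseteq> S" "S \<subseteq> {0..L}"
    "\<And>a b. a \<in> S \<Longrightarrow> b \<in> S \<Longrightarrow> a < b \<Longrightarrow> {a<..<b} \<inter> S = {} \<Longrightarrow> C2_on c {a..b}"
    using pw unfolding piecewise_C2_def by (elim exE conjE) metis
  have g: "\<exists>g. velocity_C1_on {a..b} g" if ab: "a \<in> S" "b \<in> S" "a < b" "{a<..<b} \<inter> S = {}" for a b
  proof -
    obtain f' f'' where f: "continuous_on {a..b} f''"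
      "\<And>t. t \<in> {a..b} \<Longrightarrow> (c has_vector_derivative f' t) (at t within {a..b})"
      "\<And>t. t \<in> {a..b} \<Longrightarrow> (f' has_vector_derivative f'' t) (at t within {a..b})"
      using S(4)[OF ab] unfolding C2_on_def by blast
    \<comment> \<open>\<open>C2_on\<close> comes with its own first derivative, which has to be
      identified with v.\<close>
    have e: "v t = f' t" if "t \<in> {a..b}" for t
      using vector_derivative_unique_within_closed_interval[of a b t c "v t" "f' t"] ab(3) that f(2) c_deriv
      by auto
    have "(v has_vector_derivative f'' t) (at t within {a..b})" if "t \<in> {a..b}" for t
      using has_vector_derivative_transform[OF that e f(3)[OF that]] by blast
    then show ?thesis using f(1) unfolding velocity_C1_on_def by blast
  qed
  show "\<exists>e>s. \<exists>g. velocity_C1_on {s..e} g" if "s < L"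
  proof -
    define a where "a = Max {x\<in>S. x \<le> s}"
    define b where "b = Min {x\<in>S. x > s}"
    have a: "a \<in> {x\<in>S. x \<le> s}" unfolding a_def using S(1,2) assms by (intro Max_in) auto
    have b: "b \<in> {x\<in>S. x > s}" unfolding b_def using S(1,2) that by (intro Min_in) auto
    have "x \<le> a" if "x \<in> S" "x \<le> s" for x unfolding a_def using S(1) that by (intro Max_ge) auto
    moreover have "b \<le> x" if "x \<in> S" "x > s" for x unfolding b_def using S(1) that by (intro Min_le) auto
    ultimately have "{a<..<b} \<inter> S = {}" by (force simp: not_less)
    then obtain g where "velocity_C1_on {a..b} g" using g[of a b] a b by auto
    moreover have "{s..b} \<subseteq> {a..b}" using a by auto
    ultimately show ?thesis using b velocity_C1_on_subset by blast
  qed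
  show "\<exists>e<s. \<exists>g. velocity_C1_on {e..s} g" if "0 < s"
  proof -
    define a where "a = Max {x\<in>S. x < s}"
    define b where "b = Min {x\<in>S. x \<ge> s}"
    have a: "a \<in> {x\<in>S. x < s}" unfolding a_def using S(1,2) that by (intro Max_in) auto
    have b: "b \<in> {x\<in>S. x \<ge> s}" unfolding b_def using S(1,2) assms by (intro Min_in) auto
    have "x \<le> a" if "x \<in> S" "x < s" for x unfolding a_def using S(1) that by (intro Max_ge) auto
    moreover have "b \<le> x" if "x \<in> S" "x \<ge> s" for x unfolding b_def using S(1) that by (intro Min_le) auto
    ultimately have "{a<..<b} \<inter> S = {}" by (force simp: not_less)
    then obtain g where "velocity_C1_on {a..b} g" using g[of a b] a b by auto
    moreover have "{a..s} \<subseteq> {a..b}" using b by auto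
    ultimately show ?thesis using a velocity_C1_on_subset by blast
  qed
qed

lemma velocity_C1_on_shift:
  assumes "velocity_C1_on {p..q} g"
  shows "velocity_C1_on {p + of_int n * L..q + of_int n * L} (\<lambda>t. g (t - of_int n * L))"
  unfolding velocity_C1_on_def
proof (intro conjI ballI)
  have g: "continuous_on {p..q} g" "\<forall>t\<in>{p..q}. (v has_vector_derivative g t) (at t within {p..q})"
    using assms by (auto simp: velocity_C1_on_def)
  define h where "h = of_int n * L"
  show "continuous_on {p + of_int n * L..q + of_int n * L} (\<lambda>t. g (t - of_int n * L))"
    by (intro continuous_on_compose2[OF g(1)] continuous_intros) auto
  fix t assume t: "t \<in> {p + of_int n * L..q + of_int n * L}"
  have im: "(\<lambda>t. t - h) ` {p + h..q + h} = {p..q}" by (auto simp: image_def intro: bexI[of _ "_ + h"])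
  have "((v \<circ> (\<lambda>t. t - h)) has_vector_derivative 1 *\<^sub>R g (t - h)) (at t within {p + h..q + h})"
    by (rule vector_diff_chain_within)
      (use g(2) t in \<open>auto simp: h_def[symmetric] im intro!: derivative_eq_intros\<close>)
  moreover have "v \<circ> (\<lambda>t. t - h) = v"
    using v_per_int[of _ n] by (auto simp: fun_eq_iff h_def) (metis diff_add_cancel)
  ultimately show "(v has_vector_derivative g (t - of_int n * L)) (at t within {p + of_int n * L..q + of_int n * L})"
    by (simp add: h_def)
qed

lemma velocity_C1_right: "\<exists>e>s. \<exists>g. velocity_C1_on {s..e} g"
proof -
  obtain n where n: "s - of_int n * L \<in> {0..<0 + L}" using shift_to_period .
  then obtain e g where e: "e > s - of_int n * L" "velocity_C1_on {s - of_int n * L..e} g"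
    using velocity_C1_near(1)[of "s - of_int n * L"] by auto
  show ?thesis using velocity_C1_on_shift[OF e(2), of n] e(1)
    by (intro exI[of _ "e + of_int n * L"]) auto
qed

lemma velocity_C1_left: "\<exists>e<s. \<exists>g. velocity_C1_on {e..s} g"
proof -
  \<comment> \<open>A piece to the left needs a representative in (0, L] instead of [0, L); negating
    s turns one half-open period into the other.\<close>
  obtain n where n: "- s - of_int n * L \<in> {- L..<- L + L}" using shift_to_period .
  define k where "k = - n"
  have k: "0 < s - of_int k * L" "s - of_int k * L \<le> L" using n by (auto simp: k_def)
  then obtain e g where e: "e < s - of_int k * L" "velocity_C1_on {e..s - of_int k * L} g"
    using velocity_C1_near(2)[of "s - of_int k * L"] by auto
  show ?thesis using velocity_C1_on_shift[OF e(2), of k] e(1)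
    by (intro exI[of _ "e + of_int k * L"]) auto
qed

text \<open>Inside a piece the curvature equals a continuous determinant, so it is continuous there
  and the bound m applies; the value and the bound pass to the ends in the limit.\<close>

lemma curvature_limit:
  assumes pq: "p < q" and g: "velocity_C1_on {p..q} g" and s: "s \<in> {p..q}"
  shows "(geodesic_curvature G c \<longlongrightarrow> det3 (c s) (v s) (g s)) (at s within {p..q})"
    and "det3 (c s) (v s) (g s) \<ge> m"
proof -
  define k where "k x = det3 (c x) (v x) (g x)" for x
  have gc: "continuous_on {p..q} g" using g by (simp add: velocity_C1_on_def)
  have eq: "geodesic_curvature G c x = k x" if x: "p < x" "x < q" for x
  proof -
    have "(v has_vector_derivative g x) (at x within {p..q})" using g x by (auto simp: velocity_C1_on_def)
    then have "velocity v x = g x" using x by (simp add: at_within_Icc_at vector_derivative_at)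
    then show ?thesis by (simp add: geodesic_curvature_def ip_rot90 det3_inner k_def)
  qed
  have kc: "continuous_on {p..q} k" unfolding k_def
    by (intro continuous_intros c_cont continuous_on_subset[OF vcont] gc) auto
  have km: "k x \<ge> m" if x: "x \<in> {p<..<q}" for x
  proof -
    have "continuous_on {p<..<q} (geodesic_curvature G c)"
      by (rule continuous_on_eq[OF continuous_on_subset[OF kc]]) (auto simp: eq)
    then have "isCont (geodesic_curvature G c) x" using x by (simp add: continuous_on_eq_continuous_at)
    then show ?thesis using curv[of x] eq[of x] x by simp
  qed
  have lim: "(k \<longlongrightarrow> k s) (at s within {p..q})" using kc s by (auto simp: continuous_on_def)
  have nt: "at s within {p..q} \<noteq> bot"
    using s pq by (simp add: trivial_limit_within)
  have "open (- ({p, q} - {s}))" by (intro open_Compl finite_imp_closed) auto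
  then have "\<forall>\<^sub>F x in at s within {p..q}. x \<in> - ({p, q} - {s})"
    by (rule topological_tendstoD[OF tendsto_ident_at]) simp
  then have ev: "\<forall>\<^sub>F x in at s within {p..q}. x \<in> {p<..<q}"
    unfolding eventually_at_filter by eventually_elim auto
  show "(geodesic_curvature G c \<longlongrightarrow> det3 (c s) (v s) (g s)) (at s within {p..q})"
    unfolding k_def[symmetric] by (rule Lim_transform_eventually[OF lim]) (use ev eq in \<open>auto elim: eventually_mono\<close>)
  show "det3 (c s) (v s) (g s) \<ge> m"
    unfolding k_def[symmetric] by (rule tendsto_lowerbound[OF lim _ nt]) (use ev km in \<open>auto elim: eventually_mono\<close>)
qed

text \<open>The component of c t along the inner normal at c s: the sinh or the sine of the height
  of c t over the tangent geodesic at c s.\<close>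

definition D :: "real \<Rightarrow> real \<Rightarrow> real" where
  "D s t = det3 (c s) (v s) (c t)"

lemma D_deriv:
  "((\<lambda>t. D u t) has_real_derivative det3 (c u) (v u) (v t)) (at t within S)"
  "(v has_vector_derivative w) (at t within S) \<Longrightarrow>
     ((\<lambda>t. det3 (c u) (v u) (v t)) has_real_derivative det3 (c u) (v u) w) (at t within S)"
  unfolding D_def det3_inner has_real_derivative_iff_has_vector_derivative
  by (auto intro!: bounded_linear.has_vector_derivative[OF bounded_linear_inner_left] c_deriv)

lemma D_self [simp]: "D s s = 0"
  by (simp add: D_def)

text \<open>The one-sided curvatures at s together with the second-order expansions of D, uniform in
  both ends of the chord because later both ends move. In the mixed case, the curve seen from s - a
  reaches the jump with height kl a^2 / 2 and slope kl a; the slope contributes kl a b over the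
  remaining length b, and the curvature there contributes kr b^2 / 2. Seen from s + b the slope is
  governed by kr.\<close>

definition two_sided_curvature :: "real \<Rightarrow> real \<Rightarrow> real \<Rightarrow> bool" where
  "two_sided_curvature s kl kr \<longleftrightarrow> kl > 0 \<and> kr > 0 \<and>
     (geodesic_curvature G c \<longlongrightarrow> kl) (at_left s) \<and>
     (geodesic_curvature G c \<longlongrightarrow> kr) (at_right s) \<and>
     (\<forall>\<epsilon>>0. \<exists>\<delta>>0.
       (\<forall>u v. s \<le> u \<and> u \<le> v \<and> v \<le> s + \<delta> \<longrightarrow>
          \<bar>D u v - kr / 2 * (v - u)\<^sup>2\<bar> \<le> \<epsilon> * (v - u)\<^sup>2 \<and> \<bar>D v u - kr / 2 * (v - u)\<^sup>2\<bar> \<le> \<epsilon> * (v - u)\<^sup>2) \<and>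
       (\<forall>u v. s - \<delta> \<le> u \<and> u \<le> v \<and> v \<le> s \<longrightarrow>
          \<bar>D u v - kl / 2 * (v - u)\<^sup>2\<bar> \<le> \<epsilon> * (v - u)\<^sup>2 \<and> \<bar>D v u - kl / 2 * (v - u)\<^sup>2\<bar> \<le> \<epsilon> * (v - u)\<^sup>2) \<and>
       (\<forall>a b. 0 \<le> a \<and> a \<le> \<delta> \<and> 0 \<le> b \<and> b \<le> \<delta> \<longrightarrow>
          \<bar>D (s - a) (s + b) - (kl * a\<^sup>2 + 2 * kl * a * b + kr * b\<^sup>2) / 2\<bar> \<le> \<epsilon> * (a + b)\<^sup>2 \<and>
          \<bar>D (s + b) (s - a) - (kl * a\<^sup>2 + 2 * kr * a * b + kr * b\<^sup>2) / 2\<bar> \<le> \<epsilon> * (a + b)\<^sup>2))"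

lemma D_expansion:
  assumes "p \<le> q"
    and "\<forall>t\<in>{p..q}. (v has_vector_derivative g t) (at t within {p..q})"
    and "\<forall>t\<in>{p..q}. \<bar>det3 (c u) (v u) (g t) - k\<bar> \<le> \<epsilon>"
  shows "\<bar>det3 (c u) (v u) (v q) - det3 (c u) (v u) (v p) - k * (q - p)\<bar> \<le> \<epsilon> * (q - p)"
    and "\<bar>D u q - D u p - det3 (c u) (v u) (v p) * (q - p) - k / 2 * (q - p)\<^sup>2\<bar> \<le> \<epsilon> / 2 * (q - p)\<^sup>2"
    and "\<bar>D u p - D u q + det3 (c u) (v u) (v q) * (q - p) - k / 2 * (q - p)\<^sup>2\<bar> \<le> \<epsilon> / 2 * (q - p)\<^sup>2"
proof -
  have A: "(D u has_real_derivative det3 (c u) (v u) (v t)) (at t within {p..q})" for t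
    using D_deriv(1)[of u t] by simp
  have B: "((\<lambda>t. det3 (c u) (v u) (v t)) has_real_derivative det3 (c u) (v u) (g t)) (at t within {p..q})"
    if "t \<in> {p..q}" for t
    using D_deriv(2) assms(2) that by blast
  have C: "\<bar>det3 (c u) (v u) (g t) - k\<bar> \<le> \<epsilon>" if "t \<in> {p..q}" for t
    using assms(3) that by blast
  show "\<bar>det3 (c u) (v u) (v q) - det3 (c u) (v u) (v p) - k * (q - p)\<bar> \<le> \<epsilon> * (q - p)"
    and "\<bar>D u q - D u p - det3 (c u) (v u) (v p) * (q - p) - k / 2 * (q - p)\<^sup>2\<bar> \<le> \<epsilon> / 2 * (q - p)\<^sup>2"
    and "\<bar>D u p - D u q + det3 (c u) (v u) (v q) * (q - p) - k / 2 * (q - p)\<^sup>2\<bar> \<le> \<epsilon> / 2 * (q - p)\<^sup>2"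
    by (rule second_order_bounds[OF assms(1) A B C]; assumption)+
qed

text \<open>Y is the height at the jump and Z the contribution of the slope there. The bound is
  shaped so that the errors \<epsilon> a^2, \<epsilon> a b and \<epsilon> b^2 add up to \<epsilon>
  (a + b)^2.\<close>

lemma glue_estimate:
  fixes X :: real
  assumes "\<bar>Y - P\<bar> \<le> e1 / 2" "\<bar>X - Y - Z - Q\<bar> \<le> e2 / 2" "\<bar>Z - R\<bar> \<le> e3"
    "0 \<le> e1" "0 \<le> e2" "0 \<le> e3" "T = P + R + Q"
  shows "\<bar>X - T\<bar> \<le> e1 + 2 * e3 + e2"
  using assms by linarith

lemma two_sided_exists: "\<exists>kl kr. two_sided_curvature s kl kr"
proof -
  obtain e1 g1 where g1: "e1 > s" "velocity_C1_on {s..e1} g1" using velocity_C1_right by blast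
  obtain e2 g2 where g2: "e2 < s" "velocity_C1_on {e2..s} g2" using velocity_C1_left by blast
  define kr where "kr = det3 (c s) (v s) (g1 s)"
  define kl where "kl = det3 (c s) (v s) (g2 s)"
  have kr: "(geodesic_curvature G c \<longlongrightarrow> kr) (at_right s)" "kr \<ge> m"
    using curvature_limit[OF g1, of s] g1(1) by (auto simp: kr_def at_within_Icc_at_right)
  have kl: "(geodesic_curvature G c \<longlongrightarrow> kl) (at_left s)" "kl \<ge> m"
    using curvature_limit[OF g2, of s] g2(1) by (auto simp: kl_def at_within_Icc_at_left)
  have cont: "continuous_on {s..e1} g1" "continuous_on {e2..s} g2"
    using g1(2) g2(2) by (auto simp: velocity_C1_on_def)
  have main: "\<exists>\<delta>>0.
       (\<forall>u v. s \<le> u \<and> u \<le> v \<and> v \<le> s + \<delta> \<longrightarrow>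
          \<bar>D u v - kr / 2 * (v - u)\<^sup>2\<bar> \<le> \<epsilon> * (v - u)\<^sup>2 \<and> \<bar>D v u - kr / 2 * (v - u)\<^sup>2\<bar> \<le> \<epsilon> * (v - u)\<^sup>2) \<and>
       (\<forall>u v. s - \<delta> \<le> u \<and> u \<le> v \<and> v \<le> s \<longrightarrow>
          \<bar>D u v - kl / 2 * (v - u)\<^sup>2\<bar> \<le> \<epsilon> * (v - u)\<^sup>2 \<and> \<bar>D v u - kl / 2 * (v - u)\<^sup>2\<bar> \<le> \<epsilon> * (v - u)\<^sup>2) \<and>
       (\<forall>a b. 0 \<le> a \<and> a \<le> \<delta> \<and> 0 \<le> b \<and> b \<le> \<delta> \<longrightarrow>
          \<bar>D (s - a) (s + b) - (kl * a\<^sup>2 + 2 * kl * a * b + kr * b\<^sup>2) / 2\<bar> \<le> \<epsilon> * (a + b)\<^sup>2 \<and>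
          \<bar>D (s + b) (s - a) - (kl * a\<^sup>2 + 2 * kr * a * b + kr * b\<^sup>2) / 2\<bar> \<le> \<epsilon> * (a + b)\<^sup>2)" if eps: "\<epsilon> > 0" for \<epsilon>
  proof -
    obtain d1 where d1: "d1 > 0" "\<And>t u. t \<in> {s..e1} \<Longrightarrow> \<bar>t - s\<bar> \<le> d1 \<Longrightarrow> \<bar>u - s\<bar> \<le> d1 \<Longrightarrow>
        \<bar>det3 (c u) (v u) (g1 t) - kr\<bar> \<le> \<epsilon>"
      using det3_joint_eps[OF c_cont vcont cont(1) _ eps, where s = s] g1(1) unfolding kr_def by auto
    obtain d2 where d2: "d2 > 0" "\<And>t u. t \<in> {e2..s} \<Longrightarrow> \<bar>t - s\<bar> \<le> d2 \<Longrightarrow> \<bar>u - s\<bar> \<le> d2 \<Longrightarrow>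
        \<bar>det3 (c u) (v u) (g2 t) - kl\<bar> \<le> \<epsilon>"
      using det3_joint_eps[OF c_cont vcont cont(2) _ eps, where s = s] g2(1) unfolding kl_def by auto
    define d where "d = min (min d1 d2) (min (e1 - s) (s - e2))"
    have d: "d > 0" "d \<le> d1" "d \<le> d2" "s + d \<le> e1" "e2 \<le> s - d"
      using d1(1) d2(1) g1(1) g2(1) by (auto simp: d_def)
    have der1: "\<forall>t\<in>{p..q}. (v has_vector_derivative g1 t) (at t within {p..q})" if "s \<le> p" "q \<le> s + d" for p q
      using velocity_C1_on_subset[OF g1(2), of "{p..q}"] that d by (auto simp: velocity_C1_on_def)
    have der2: "\<forall>t\<in>{p..q}. (v has_vector_derivative g2 t) (at t within {p..q})" if "s - d \<le> p" "q \<le> s" for p q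
      using velocity_C1_on_subset[OF g2(2), of "{p..q}"] that d by (auto simp: velocity_C1_on_def)
    have eps1: "\<forall>t\<in>{p..q}. \<bar>det3 (c u) (v u) (g1 t) - kr\<bar> \<le> \<epsilon>" if "s \<le> p" "q \<le> s + d" "\<bar>u - s\<bar> \<le> d" for p q u
      using d1(2) that d by auto
    have eps2: "\<forall>t\<in>{p..q}. \<bar>det3 (c u) (v u) (g2 t) - kl\<bar> \<le> \<epsilon>" if "s - d \<le> p" "q \<le> s" "\<bar>u - s\<bar> \<le> d" for p q u
      using d2(2) that d by auto
    have half: "\<epsilon> / 2 * x \<le> \<epsilon> * x" if "x \<ge> 0" for x using that eps by (simp add: field_simps)
    show ?thesis
    proof (intro exI[of _ d] conjI allI impI d)
      fix x y assume xy: "s \<le> x \<and> x \<le> y \<and> y \<le> s + d"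
      have "\<bar>x - s\<bar> \<le> d" "\<bar>y - s\<bar> \<le> d" using xy by auto
      then show "\<bar>D x y - kr / 2 * (y - x)\<^sup>2\<bar> \<le> \<epsilon> * (y - x)\<^sup>2" "\<bar>D y x - kr / 2 * (y - x)\<^sup>2\<bar> \<le> \<epsilon> * (y - x)\<^sup>2"
        using D_expansion(2)[OF _ der1 eps1, of x y x] D_expansion(3)[OF _ der1 eps1, of x y y] xy
          half[of "(y - x)\<^sup>2"] by auto
    next
      fix x y assume xy: "s - d \<le> x \<and> x \<le> y \<and> y \<le> s"
      have "\<bar>x - s\<bar> \<le> d" "\<bar>y - s\<bar> \<le> d" using xy by auto
      then show "\<bar>D x y - kl / 2 * (y - x)\<^sup>2\<bar> \<le> \<epsilon> * (y - x)\<^sup>2" "\<bar>D y x - kl / 2 * (y - x)\<^sup>2\<bar> \<le> \<epsilon> * (y - x)\<^sup>2"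
        using D_expansion(2)[OF _ der2 eps2, of x y x] D_expansion(3)[OF _ der2 eps2, of x y y] xy
          half[of "(y - x)\<^sup>2"] by auto
    next
      fix a b assume ab: "0 \<le> a \<and> a \<le> d \<and> 0 \<le> b \<and> b \<le> d"
      have exp: "\<epsilon> * (a + b)\<^sup>2 = \<epsilon> * a\<^sup>2 + 2 * (\<epsilon> * a * b) + \<epsilon> * b\<^sup>2"
        by (simp add: power2_eq_square algebra_simps)
      have pos: "\<epsilon> * a\<^sup>2 \<ge> 0" "\<epsilon> * b\<^sup>2 \<ge> 0" "\<epsilon> * a * b \<ge> 0" using ab eps by auto
      let ?u = "s - a" let ?w = "s + b"
      \<comment> \<open>Slope and height on arrival at the jump; they are the initial data for the
        expansion over the other side in B.\<close>
      have A: "\<bar>det3 (c ?u) (v ?u) (v s) - kl * a\<bar> \<le> \<epsilon> * a" "\<bar>D ?u s - kl / 2 * a\<^sup>2\<bar> \<le> \<epsilon> / 2 * a\<^sup>2"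
        using D_expansion(1,2)[OF _ der2 eps2, of ?u s ?u] ab by auto
      have B: "\<bar>D ?u ?w - D ?u s - det3 (c ?u) (v ?u) (v s) * b - kr / 2 * b\<^sup>2\<bar> \<le> \<epsilon> / 2 * b\<^sup>2"
        using D_expansion(2)[OF _ der1 eps1, of s ?w ?u] ab by auto
      have "\<bar>det3 (c ?u) (v ?u) (v s) - kl * a\<bar> * b \<le> \<epsilon> * a * b"
        using A(1) ab by (intro mult_right_mono) auto
      then have C: "\<bar>det3 (c ?u) (v ?u) (v s) * b - kl * a * b\<bar> \<le> \<epsilon> * a * b"
        using ab abs_mult_pos[of b "det3 (c ?u) (v ?u) (v s) - kl * a"] by (simp add: left_diff_distrib)
      show "\<bar>D ?u ?w - (kl * a\<^sup>2 + 2 * kl * a * b + kr * b\<^sup>2) / 2\<bar> \<le> \<epsilon> * (a + b)\<^sup>2"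
        unfolding exp
        by (rule glue_estimate[OF _ _ C pos(1,2,3)], use A(2) in simp, use B in simp) (simp add: field_simps)
      have A': "\<bar>det3 (c ?w) (v ?w) (v s) + kr * b\<bar> \<le> \<epsilon> * b" "\<bar>D ?w s - kr / 2 * b\<^sup>2\<bar> \<le> \<epsilon> / 2 * b\<^sup>2"
        using D_expansion(1,3)[OF _ der1 eps1, of s ?w ?w] ab by auto
      have B': "\<bar>D ?w ?u - D ?w s + det3 (c ?w) (v ?w) (v s) * a - kl / 2 * a\<^sup>2\<bar> \<le> \<epsilon> / 2 * a\<^sup>2"
        using D_expansion(3)[OF _ der2 eps2, of ?u s ?w] ab by auto
      have "\<bar>det3 (c ?w) (v ?w) (v s) + kr * b\<bar> * a \<le> \<epsilon> * b * a"
        using A'(1) ab by (intro mult_right_mono) auto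
      then have C': "\<bar>det3 (c ?w) (v ?w) (v s) * a + kr * b * a\<bar> \<le> \<epsilon> * b * a"
        using ab abs_mult_pos[of a "det3 (c ?w) (v ?w) (v s) + kr * b"] by (simp add: distrib_right)
      have sw: "kr * b * a = kr * a * b" "\<epsilon> * b * a = \<epsilon> * a * b" by simp_all
      show "\<bar>D ?w ?u - (kl * a\<^sup>2 + 2 * kr * a * b + kr * b\<^sup>2) / 2\<bar> \<le> \<epsilon> * (a + b)\<^sup>2"
      proof -
        have "\<bar>D ?w ?u - (kl * a\<^sup>2 + 2 * kr * a * b + kr * b\<^sup>2) / 2\<bar> \<le> \<epsilon> * b\<^sup>2 + 2 * (\<epsilon> * b * a) + \<epsilon> * a\<^sup>2"
          by (rule glue_estimate[of "D ?w s" "kr / 2 * b\<^sup>2" "\<epsilon> * b\<^sup>2" "D ?w ?u"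
                "- (det3 (c ?w) (v ?w) (v s) * a)" "kl / 2 * a\<^sup>2" "\<epsilon> * a\<^sup>2" "kr * b * a"])
            (use A'(2) B' C' pos in \<open>auto simp: sw field_simps\<close>)
        then show ?thesis unfolding exp sw by linarith
      qed
    qed
  qed
  have "kl > 0" "kr > 0" using kl(2) kr(2) m_pos by auto
  then show ?thesis unfolding two_sided_curvature_def using kl(1) kr(1)
    by (rule_tac x = kl in exI, rule_tac x = kr in exI) (intro conjI allI impI main; assumption)
qed

text \<open>The quadratic terms kl / 2 and kr / 2 dominate an error of a quarter of the smaller
  curvature. This is where strict convexity comes from.\<close>

lemma D_local_pos: "\<exists>\<delta>>0. \<forall>t. t \<noteq> s \<and> \<bar>t - s\<bar> \<le> \<delta> \<longrightarrow> D s t > 0"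
proof -
  obtain kl kr where k: "two_sided_curvature s kl kr" using two_sided_exists by blast
  define e where "e = min kl kr / 4"
  have "e > 0" using k by (auto simp: e_def two_sided_curvature_def)
  then obtain d where d: "d > 0" 
    "\<And>v. s \<le> v \<and> v \<le> s + d \<Longrightarrow> \<bar>D s v - kr / 2 * (v - s)\<^sup>2\<bar> \<le> e * (v - s)\<^sup>2"
    "\<And>u. s - d \<le> u \<and> u \<le> s \<Longrightarrow> \<bar>D s u - kl / 2 * (s - u)\<^sup>2\<bar> \<le> e * (s - u)\<^sup>2"
    using k unfolding two_sided_curvature_def by (metis order_refl)
  have "D s t > 0" if "t \<noteq> s" "\<bar>t - s\<bar> \<le> d" for t
  proof -
    have sq: "(t - s)\<^sup>2 > 0" "(s - t)\<^sup>2 = (t - s)\<^sup>2" using that by (auto simp: power2_commute)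
    have e: "e * (t - s)\<^sup>2 < kr / 2 * (t - s)\<^sup>2" "e * (t - s)\<^sup>2 < kl / 2 * (t - s)\<^sup>2"
      using sq k by (auto simp: e_def two_sided_curvature_def)
    show ?thesis using d(2)[of t] d(3)[of t] that e unfolding sq(2) by (cases "s \<le> t"; linarith)
  qed
  then show ?thesis using d(1) by blast
qed

end

lemma isCont_gcos: "isCont (gcos G) t"
proof -
  have "continuous_on UNIV (gcos G)"
    by (cases G) (auto simp: gcos_def[abs_def] intro!: continuous_intros)
  then show ?thesis by (simp add: continuous_on_eq_continuous_at)
qed

lemma isCont_gsin: "isCont (gsin G) t"
  using continuous_gsin[of UNIV G] by (simp add: continuous_on_eq_continuous_at)

context table
begin

subsection \<open>Strict convexity\<close>

lemma c_neq: "s < t \<Longrightarrow> t < s + L \<Longrightarrow> c s \<noteq> c t" "s < t \<Longrightarrow> t < s + L \<Longrightarrow> c t \<noteq> c s"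
proof -
  assume "s < t" "t < s + L"
  then have "0 < t - s" "t - s < L" by auto
  then show "c s \<noteq> c t" "c t \<noteq> c s" using c_inj[of t s] by auto
qed

abbreviation DD :: "real \<Rightarrow> real^3 \<Rightarrow> real" where
  "DD s x \<equiv> det3 (c s) (v s) x"

text \<open>A supporting functional at c s is minimal along c at s, hence vanishes on c s and v s
  and is a multiple of \<open>DD s\<close>. The factor is positive because geodesics along the inner
  normal start inside K.\<close>

lemma DD_nonneg:
  assumes "x \<in> K"
  shows "DD s x \<ge> 0"
proof -
  obtain n where n: "n \<noteq> 0" "n \<bullet> c s = 0" "\<And>x. x \<in> K \<Longrightarrow> n \<bullet> x \<ge> 0"
    using support_exists[OF K_convex K_compact, of "c s"] range_c by blast
  have nv: "n \<bullet> v s = 0"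
  proof (rule DERIV_local_min)
    show "((\<lambda>t. n \<bullet> c t) has_real_derivative n \<bullet> v s) (at s)"
      unfolding has_real_derivative_iff_has_vector_derivative
      by (intro bounded_linear.has_vector_derivative[OF bounded_linear_inner_right] c_deriv)
    show "\<forall>y. \<bar>s - y\<bar> < 1 \<longrightarrow> n \<bullet> c s \<le> n \<bullet> c y" using n by simp
  qed simp
  define N where "N = rot90 G (c s) (v s)"
  have N: "N \<in> unit_tangents G (c s)" unfolding N_def by (rule rot90_unit_tangent(1)[OF c_surf v_tangent])
  have DN: "DD s N = 1"
    using N ip_rot90[of G N "c s" "v s"] unfolding N_def by (simp add: det3_inner unit_tangents_def)
  have nx: "n \<bullet> x = (n \<bullet> N) * DD s x" for x
  proof -
    have "n \<bullet> (det3 (v s) N x *\<^sub>R c s - det3 (c s) N x *\<^sub>R v s + DD s x *\<^sub>R N - DD s N *\<^sub>R x) = 0"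
      by (subst cramer3) simp
    then show ?thesis using n(2) nv DN by (simp add: inner_add_right inner_diff_right mult.commute)
  qed
  obtain e where e: "e > 0" "\<And>t. t \<in> {0<..<e} \<Longrightarrow> geod G (c s) N t \<in> K" using inward[of s] unfolding N_def by blast
  \<comment> \<open>At most 1, hence below pi, so that \<open>gsin G t\<close> is positive on the
    sphere as well.\<close>
  define t where "t = min (e / 2) 1"
  have t: "0 < t" "t < e" "t \<le> 1" using e(1) by (auto simp: t_def)
  have gs: "gsin G t > 0"
    using t pi_gt3 by (cases G) (auto simp: gsin_def intro!: sin_gt_zero)
  have "n \<bullet> geod G (c s) N t = gsin G t * (n \<bullet> N)" by (simp add: geod_eq inner_add_right n(2))
  then have "0 \<le> gsin G t * (n \<bullet> N)" using n(3)[OF e(2)[of t]] t by simp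
  then have "n \<bullet> N \<ge> 0" using gs by (simp add: zero_le_mult_iff)
  moreover have "n \<bullet> N \<noteq> 0"
  proof
    assume "n \<bullet> N = 0"
    then have "n \<bullet> n = 0" using nx[of n] by simp
    then show False using n(1) by simp
  qed
  ultimately have "n \<bullet> N > 0" by simp
  then show ?thesis using nx[of x] n(3)[OF assms] by (simp add: zero_le_mult_iff)
qed

lemma cross_nz: "cross3 (c s) (v s) \<noteq> 0"
proof
  assume "cross3 (c s) (v s) = 0"
  then have "DD s (rot90 G (c s) (v s)) = 0" by (simp add: det3_inner)
  moreover have "DD s (rot90 G (c s) (v s)) = 1"
    using rot90_unit_tangent(1)[OF c_surf v_tangent] ip_rot90[of G "rot90 G (c s) (v s)" "c s" "v s"]
    by (simp add: det3_inner unit_tangents_def)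
  ultimately show False by simp
qed

lemma DD_inter:
  assumes "y \<in> inter G K"
  shows "DD s y > 0"
proof -
  have *: "DD s x = cross3 (c s) (v s) \<bullet> x" for x
    unfolding det3_inner by (rule inner_commute)
  show ?thesis unfolding *
    by (rule inter_functional_pos[OF assms K_surf _ cross_nz]) (use DD_nonneg in \<open>simp add: *[symmetric]\<close>)
qed

text \<open>If x were on the tangent at c s, the segment from c s to x would lie in K and on that
  tangent, hence in the boundary. Its points near c s would be boundary points of zero height
  arbitrarily close to s, against \<open>D_local_pos\<close>.\<close>

lemma DD_pos:
  assumes "x \<in> K" "x \<noteq> c s"
  shows "DD s x > 0"
proof (rule ccontr)
  assume "\<not> DD s x > 0"
  then have D0: "DD s x = 0" using DD_nonneg[OF assms(1), of s] by simp
  have sx: "c s \<in> surf G" "x \<in> surf G" "c s \<noteq> x" using assms K_surf by auto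
  define l where "l = gdist G (c s) x"
  have l: "l > 0" using gdist_facts(1)[OF sx] by (simp add: l_def)
  define y where "y \<tau> = geod G (c s) (gdir G (c s) x) \<tau>" for \<tau>
  have yK: "y \<tau> \<in> K" if "\<tau> \<in> {0..l}" for \<tau>
    using geodesic_segment_gdir[OF sx] K_convex assms(1) c_K[of s] that
    unfolding geo_convex_def y_def l_def by blast
  have yD: "DD s (y \<tau>) = 0" for \<tau>
    unfolding y_def geod_gdir[OF sx] by (simp add: D0)
  have ynz: "y \<tau> \<noteq> c s" if "0 < \<tau>" "\<tau> \<le> l" for \<tau>
  proof
    assume eq: "y \<tau> = c s"
    define a b where "a = gsin G (l - \<tau>) / rad G (c s) x" and "b = gsin G \<tau> / rad G (c s) x"
    have b: "b > 0" using gdist_facts(4)[OF sx] that rad_sq(2)[OF sx] by (simp add: b_def l_def)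
    have e: "c s = a *\<^sub>R c s + b *\<^sub>R x" using eq unfolding y_def geod_gdir[OF sx] a_def b_def l_def by simp
    then have "b *\<^sub>R x = (1 - a) *\<^sub>R c s" by (simp add: algebra_simps)
    then have "(1 / b) *\<^sub>R (b *\<^sub>R x) = ((1 - a) / b) *\<^sub>R c s" by simp
    then have x: "x = ((1 - a) / b) *\<^sub>R c s" using b by simp
    moreover have "(1 - a) / b > 0"
    proof -
      have "x $ 3 = ((1 - a) / b) * c s $ 3" by (subst x) simp
      then show ?thesis using surf_third_pos[OF sx(1)] surf_third_pos[OF sx(2)]
        by (metis zero_less_mult_pos2)
    qed
    ultimately have "(1 - a) / b = 1" using surf_scale_unique[OF sx(1), of "(1 - a) / b"] sx(2) by metis
    then show False using x sx(3) by simp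
  qed
  obtain d where d: "d > 0" "\<And>t. t \<noteq> s \<Longrightarrow> \<bar>t - s\<bar> \<le> d \<Longrightarrow> D s t > 0" using D_local_pos by blast
  define \<tau> where "\<tau> k = l / real (Suc k)" for k
  have \<tau>: "0 < \<tau> k" "\<tau> k \<le> l" for k using l by (auto simp: \<tau>_def field_simps)
  \<comment> \<open>The parameters are taken in the period centred at s: any limit of them is at
    distance less than L from s, and injectivity identifies it with s.\<close>
  have "\<exists>t. y (\<tau> k) = c t \<and> s - L / 2 \<le> t \<and> t < s + L / 2" for k
  proof -
    have "y (\<tau> k) \<notin> inter G K" using DD_inter[of "y (\<tau> k)" s] yD[of "\<tau> k"] by auto
    then have "y (\<tau> k) \<in> bdry G K" using yK[of "\<tau> k"] \<tau>[of k] bdry_K by auto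
    from bdry_param[OF this, of "s - L / 2"] obtain t where
      "y (\<tau> k) = c t" "s - L / 2 \<le> t" "t < s - L / 2 + L" by blast
    then show ?thesis by (intro exI[of _ t]) auto
  qed
  then obtain w where w: "\<And>k. y (\<tau> k) = c (w k)" "\<And>k. w k \<in> {s - L / 2..s + L / 2}" 
    by (metis atLeastAtMost_iff less_imp_le)
  obtain w0 r where r: "w0 \<in> {s - L / 2..s + L / 2}" "strict_mono r" "(w \<circ> r) \<longlonglongrightarrow> w0"
    using compact_Icc[of "s - L / 2" "s + L / 2"] w(2) unfolding compact_def by blast
  have "\<tau> \<longlonglongrightarrow> 0" unfolding \<tau>_def using LIMSEQ_Suc[OF lim_const_over_n[of l]] by simp
  moreover have "isCont y 0"
  proof -
    show ?thesis unfolding y_def geod_eq by (intro continuous_intros isCont_gcos isCont_gsin)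
  qed
  ultimately have "(\<lambda>k. y (\<tau> k)) \<longlonglongrightarrow> y 0" using isCont_tendsto_compose by blast
  moreover have "y 0 = c s" by (simp add: y_def geod_eq)
  ultimately have l1: "(\<lambda>k. c (w k)) \<longlonglongrightarrow> c s" by (simp add: w(1))
  have "(\<lambda>k. c ((w \<circ> r) k)) \<longlonglongrightarrow> c w0" using isCont_tendsto_compose isCont_c r(3) by blast
  moreover have "(\<lambda>k. c ((w \<circ> r) k)) \<longlonglongrightarrow> c s" using LIMSEQ_subseq_LIMSEQ[OF l1 r(2)] by (simp add: o_def)
  ultimately have "c w0 = c s" using LIMSEQ_unique by blast
  moreover have "\<bar>w0 - s\<bar> < L" using r(1) L_pos by (simp add: abs_less_iff)
  ultimately have "w0 = s" using c_inj'[of w0 s] by auto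
  then have "eventually (\<lambda>k. dist ((w \<circ> r) k) s < d) sequentially" using r(3) d(1) by (auto simp: tendsto_iff)
  then obtain k where k: "\<bar>w (r k) - s\<bar> < d" by (auto simp: eventually_sequentially dist_real_def)
  have "w (r k) \<noteq> s" using ynz[OF \<tau>, of "r k"] w(1) by auto
  then have "D s (w (r k)) > 0" using d(2) k by simp
  moreover have "D s (w (r k)) = 0" using yD[of "\<tau> (r k)"] w(1) by (simp add: D_def)
  ultimately show False by simp
qed

lemma D_pos: "t \<noteq> s \<Longrightarrow> \<bar>t - s\<bar> < L \<Longrightarrow> D s t > 0"
proof -
  assume "t \<noteq> s" "\<bar>t - s\<bar> < L"
  then have "c t \<noteq> c s" using c_inj'[of t s] by metis
  then show ?thesis unfolding D_def by (intro DD_pos c_K)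
qed

subsection \<open>Chords\<close>

text \<open>The coefficients are quotients of determinants. The tangent functional at c s sees only
  nu and the one at c t sees only la, which fixes their signs.\<close>

lemma on_chord:
  assumes "x \<in> K" "c s \<noteq> c t" "det3 (c s) (c t) x = 0" "x \<noteq> c s"
  obtains la nu where "la \<ge> 0" "nu > 0" "x = la *\<^sub>R c s + nu *\<^sub>R c t"
proof -
  have D: "DD s (c t) > 0" "DD s x > 0" using DD_pos assms by auto
  define la nu where "la = det3 (v s) (c t) x / DD s (c t)" and "nu = DD s x / DD s (c t)"
  have "DD s (c t) *\<^sub>R x = det3 (v s) (c t) x *\<^sub>R c s + DD s x *\<^sub>R c t"
    using cramer3[of "v s" "c t" x "c s"] assms(3) by (simp add: algebra_simps)
  then have "inverse (DD s (c t)) *\<^sub>R (DD s (c t) *\<^sub>R x) = la *\<^sub>R c s + nu *\<^sub>R c t"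
    by (simp add: la_def nu_def scaleR_add_right divide_inverse mult.commute)
  then have x: "x = la *\<^sub>R c s + nu *\<^sub>R c t" using D(1) by simp
  have nu: "nu > 0" using D by (simp add: nu_def)
  have "DD t x = la * DD t (c s)" by (subst x) simp
  moreover have "DD t (c s) > 0" using DD_pos[of "c s" t] assms(2) by auto
  ultimately have "la \<ge> 0" using DD_nonneg[OF assms(1), of t] by (simp add: zero_le_mult_iff)
  then show ?thesis using that x nu by blast
qed

lemma surf_eq_of_scale: "x = r *\<^sub>R y \<Longrightarrow> x \<in> surf G \<Longrightarrow> y \<in> surf G \<Longrightarrow> x = y"
proof -
  assume a: "x = r *\<^sub>R y" "x \<in> surf G" "y \<in> surf G"
  then have "x $ 3 = r * y $ 3" by simp
  then have "r > 0" using surf_third_pos[OF a(2)] surf_third_pos[OF a(3)] by (metis zero_less_mult_pos2)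
  then have "r = 1" using surf_scale_unique[OF a(3)] a by auto
  then show ?thesis using a by simp
qed

text \<open>The tangent functional at c u vanishes at c u but is positive at the two other
  points.\<close>

lemma no_three_collinear:
  assumes "det3 (c s) (c t) (c u) = 0" "c s \<noteq> c t"
  shows "c u = c s \<or> c u = c t"
proof (rule ccontr)
  assume n: "\<not> ?thesis"
  obtain la nu where l: "la \<ge> 0" "nu > 0" "c u = la *\<^sub>R c s + nu *\<^sub>R c t"
    using on_chord[of "c u" s t] assms n by auto
  have "0 = DD u (la *\<^sub>R c s + nu *\<^sub>R c t)" using l(3) by (metis det3_same(2))
  then have "0 = la * DD u (c s) + nu * DD u (c t)" by simp
  moreover have "DD u (c t) > 0" "DD u (c s) > 0" using DD_pos n c_K by (metis)+
  ultimately show False using l by (smt (verit) mult_nonneg_nonneg mult_pos_pos)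
qed

lemma det3_curve_deriv: "((\<lambda>u. det3 p q (c u)) has_real_derivative det3 p q (v t)) (at t within S)"
  unfolding det3_inner has_real_derivative_iff_has_vector_derivative
  by (intro bounded_linear.has_vector_derivative[OF bounded_linear_inner_left] c_deriv)

lemma det3_curve_cont: "continuous_on S (\<lambda>u. det3 p q (c u))"
  by (intro continuous_intros c_cont)

text \<open>As a function of u the determinant has no zero inside the period except t, by
  \<open>no_three_collinear\<close>, and at t its derivative \<open>D t s\<close> is positive; so it
  changes sign there from negative to positive.\<close>

lemma chord_sign:
  assumes "s < t" "t < s + L"
  shows "t < u \<Longrightarrow> u < s + L \<Longrightarrow> det3 (c s) (c t) (c u) > 0"
    and "s < u \<Longrightarrow> u < t \<Longrightarrow> det3 (c s) (c t) (c u) < 0"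
proof -
  define F where "F u = det3 (c s) (c t) (c u)" for u
  have dF: "(F has_real_derivative D t s) (at t)"
    unfolding F_def[abs_def] D_def using det3_curve_deriv[of "c s" "c t" t UNIV] det3_rot[of "c s" "c t" "v t"]
    by simp
  have Dp: "D t s > 0" using D_pos assms by auto
  have F0: "F t = 0" by (simp add: F_def)
  have st: "c s \<noteq> c t" using c_inj assms by simp
  have nz: "F u \<noteq> 0" if "s < u" "u < s + L" "u \<noteq> t" for u
    using no_three_collinear[of s t u] st c_neq[of s u] c_neq[of u t] c_neq[of t u] that assms unfolding F_def
    by (cases "u < t") auto
  have cF: "continuous_on S F" for S unfolding F_def[abs_def] by (rule det3_curve_cont)
  {
    assume u: "t < u" "u < s + L"
    obtain d where d: "d > 0" "\<And>h. h > 0 \<Longrightarrow> h < d \<Longrightarrow> F t < F (t + h)" using DERIV_pos_inc_right[OF dF Dp] by blast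
    define h where "h = min (d / 2) ((s + L - t) / 2)"
    have h: "h > 0" "h < d" "t + h < s + L" using d(1) assms by (auto simp: h_def min_def field_simps)
    show "det3 (c s) (c t) (c u) > 0" unfolding F_def[symmetric]
      by (rule nonzero_same_sign[OF cF, of t "s + L" "t + h"]) (use nz assms h d(2)[of h] F0 u in auto)
  }
  {
    assume u: "s < u" "u < t"
    obtain d where d: "d > 0" "\<And>h. h > 0 \<Longrightarrow> h < d \<Longrightarrow> F (t - h) < F t" using DERIV_pos_inc_left[OF dF Dp] by blast
    define h where "h = min (d / 2) ((t - s) / 2)"
    have h: "h > 0" "h < d" "s < t - h" using d(1) assms by (auto simp: h_def min_def field_simps)
    have "- F u > 0"
      by (rule nonzero_same_sign[of s t "\<lambda>u. - F u" "t - h"]) (use nz assms h d(2)[of h] F0 u in \<open>auto intro!: continuous_intros cF\<close>)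
    then show "det3 (c s) (c t) (c u) < 0" unfolding F_def by simp
  }
qed

text \<open>Follow the side on which c u lies with respect to the line through x and c s. The
  determinant vanishes at s and at s + L with the same positive derivative, so it has a zero
  strictly in between.\<close>

lemma ray_exit:
  assumes "x \<in> K" "x \<noteq> c s"
  obtains t la nu where "s < t" "t < s + L" "la \<ge> 0" "nu > 0" "x = la *\<^sub>R c s + nu *\<^sub>R c t"
proof -
  define F where "F u = det3 (c s) (c u) x" for u
  have F: "F = (\<lambda>u. det3 x (c s) (c u))" unfolding F_def using det3_rot[of x "c s"] by auto
  have vs: "v (s + L) = v s" "c (s + L) = c s" using v_per_int[of s 1] per by auto
  have Dp: "det3 x (c s) (v s) > 0" using DD_pos[OF assms] det3_rot[of x "c s" "v s"] by simp
  have d1: "(F has_real_derivative det3 x (c s) (v s)) (at s)"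
    and d2: "(F has_real_derivative det3 x (c s) (v s)) (at (s + L))"
    unfolding F using det3_curve_deriv[of x "c s" s UNIV] det3_curve_deriv[of x "c s" "s + L" UNIV] vs by auto
  have F0: "F s = 0" "F (s + L) = 0" by (auto simp: F_def vs)
  obtain e1 where e1: "e1 > 0" "\<And>h. h > 0 \<Longrightarrow> h < e1 \<Longrightarrow> F s < F (s + h)" using DERIV_pos_inc_right[OF d1 Dp] by blast
  obtain e2 where e2: "e2 > 0" "\<And>h. h > 0 \<Longrightarrow> h < e2 \<Longrightarrow> F (s + L - h) < F (s + L)" using DERIV_pos_inc_left[OF d2 Dp] by blast
  define h where "h = min (min (e1 / 2) (e2 / 2)) (L / 3)"
  have h: "h > 0" "h < e1" "h < e2" "h \<le> L / 3" using e1(1) e2(1) L_pos by (auto simp: h_def min_def field_simps)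
  have cF: "continuous_on S F" for S unfolding F by (rule det3_curve_cont)
  have "\<exists>t. s + h \<le> t \<and> t \<le> s + L - h \<and> F t = 0"
    by (rule IVT2') (use e1(2)[of h] e2(2)[of h] h F0 L_pos cF in auto)
  then obtain t where t: "s + h \<le> t" "t \<le> s + L - h" "F t = 0" by blast
  have "c s \<noteq> c t" using c_neq[of s t] t h by auto
  then obtain la nu where "la \<ge> 0" "nu > 0" "x = la *\<^sub>R c s + nu *\<^sub>R c t"
    using on_chord[OF assms(1) _ _ assms(2), of t] t(3) unfolding F_def by auto
  then show ?thesis using that[of t la nu] t h by auto
qed

subsection \<open>Angles\<close>

text \<open>E and A are the cosine and the sine of the angle at c s between the velocity and the chord to c t.\<close>
definition R :: "real \<Rightarrow> real \<Rightarrow> real" where "R s t = rad G (c s) (c t)"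
definition W :: "real \<Rightarrow> real \<Rightarrow> real" where "W s t = wip G (c s) (c t)"
definition E :: "real \<Rightarrow> real \<Rightarrow> real" where "E s t = ip G (v s) (c t) / R s t"
definition A :: "real \<Rightarrow> real \<Rightarrow> real" where "A s t = D s t / R s t"

lemma R_commute: "R s t = R t s" by (simp add: R_def rad_commute)

lemma R_pos: "c s \<noteq> c t \<Longrightarrow> R s t > 0"
  unfolding R_def by (intro rad_sq(2) c_surf)

lemma R_pos': "t \<noteq> s \<Longrightarrow> \<bar>t - s\<bar> < L \<Longrightarrow> R s t > 0"
  by (intro R_pos c_inj')

lemma A_pos: "c s \<noteq> c t \<Longrightarrow> A s t > 0"
  unfolding A_def D_def by (intro divide_pos_pos R_pos DD_pos c_K) auto

lemma EA_unit: "c s \<noteq> c t \<Longrightarrow> (E s t)\<^sup>2 + (A s t)\<^sup>2 = 1"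
proof -
  assume n: "c s \<noteq> c t"
  have "(D s t)\<^sup>2 + (ip G (v s) (c t))\<^sup>2 = kappa G - kappa G * (ip G (c s) (c t))\<^sup>2"
    using frame_norm[OF c_surf v_tangent, of s "c t"] c_surf[of t] unfolding D_def by (simp add: surf_def)
  also have "\<dots> = (R s t)\<^sup>2"
    unfolding R_def rad_sq(1)[OF c_surf c_surf] wip_def by (simp add: power_mult_distrib right_diff_distrib power2_eq_square)
  finally show ?thesis using R_pos[OF n] unfolding E_def A_def by (simp add: power_divide add_divide_distrib[symmetric] add.commute)
qed

lemma E_decreasing:
  assumes "s < t" "t < u" "u < s + L"
  shows "E s u < E s t"
proof -
  have n: "c s \<noteq> c t" "c s \<noteq> c u" using c_inj assms by auto
  have r: "R s t > 0" "R s u > 0" using R_pos n by auto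
  have "0 < det3 (c s) (c t) (c u)" using chord_sign(1)[of s t u] assms by simp
  also have "\<dots> = ip G (v s) (c t) * D s u - D s t * ip G (v s) (c u)"
    unfolding D_def by (rule frame_det[OF c_surf v_tangent])
  also have "\<dots> = R s t * R s u * (E s t * A s u - A s t * E s u)"
    using r by (simp add: E_def A_def field_simps)
  finally have "E s t * A s u > A s t * E s u" using r
    by (metis diff_gt_0_iff_gt mult_pos_pos zero_less_mult_pos)
  then show ?thesis using unit_cot_less EA_unit A_pos n by metis
qed

lemma E_per: "E s (t + L) = E s t" "A s (t + L) = A s t" "E (s + L) t = E s t" "A (s + L) t = A s t"
proof -
  have "v (s + L) = v s" using v_per_int[of s 1] by simp
  then show "E s (t + L) = E s t" "A s (t + L) = A s t" "E (s + L) t = E s t" "A (s + L) t = A s t"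
    unfolding E_def A_def D_def R_def per by simp_all
qed

lemma E_continuous: "t \<noteq> s \<Longrightarrow> \<bar>t - s\<bar> < L \<Longrightarrow> isCont (\<lambda>z. E (fst z) (snd z)) (s, t)"
proof -
  assume a: "t \<noteq> s" "\<bar>t - s\<bar> < L"
  have f: "(fst \<longlongrightarrow> s) (at (s, t))" "(snd \<longlongrightarrow> t) (at (s, t))"
    using tendsto_fst[OF tendsto_ident_at[of "(s, t)" UNIV]] tendsto_snd[OF tendsto_ident_at[of "(s, t)" UNIV]]
    by simp_all
  note t = isCont_tendsto_compose[OF isCont_c f(1)] isCont_tendsto_compose[OF isCont_c f(2)] isCont_tendsto_compose[OF isCont_v f(1)]
  have w: "((\<lambda>z. wip G (c (fst z)) (c (snd z))) \<longlongrightarrow> wip G (c s) (c t)) (at (s, t))"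
    unfolding wip_def by (rule tendsto_mult[OF tendsto_const tendsto_ip[OF t(1,2)]])
  have r: "((\<lambda>z. R (fst z) (snd z)) \<longlongrightarrow> R s t) (at (s, t))"
    unfolding R_def rad_def
    by (rule tendsto_real_sqrt[OF tendsto_mult[OF tendsto_const tendsto_diff[OF tendsto_const tendsto_power[OF w]]]])
  have "R s t \<noteq> 0" using R_pos'[OF a] by simp
  then show ?thesis unfolding E_def isCont_def fst_conv snd_conv
    by (rule tendsto_divide[OF tendsto_ip[OF t(3,2)] r])
qed

lemma v_close:
  assumes "e > 0"
  obtains d where "d > 0" "\<And>t. \<bar>t - s\<bar> < d \<Longrightarrow> norm (v t - v s) < e"
proof -
  have "isCont v s" by (rule isCont_v)
  then show ?thesis using assms that unfolding continuous_at_eps_delta by (metis dist_norm real_norm_def)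
qed

text \<open>Difference quotients with both ends free converge because v is continuous: apply the
  mean value inequality to c t - t v s.\<close>

lemma chord_quotient:
  assumes "\<mu> > 0"
  obtains d where "d > 0" "\<And>x y. x \<noteq> y \<Longrightarrow> \<bar>x - s\<bar> < d \<Longrightarrow> \<bar>y - s\<bar> < d \<Longrightarrow>
     norm ((1 / (y - x)) *\<^sub>R (c y - c x) - v s) \<le> \<mu>"
proof -
  obtain d where d: "d > 0" "\<And>t. \<bar>t - s\<bar> < d \<Longrightarrow> norm (v t - v s) < \<mu>" using v_close[OF assms] by blast
  have main: "norm ((1 / (y - x)) *\<^sub>R (c y - c x) - v s) \<le> \<mu>" if "x < y" "\<bar>x - s\<bar> < d" "\<bar>y - s\<bar> < d" for x y
  proof -
    have "norm ((c y - y *\<^sub>R v s) - (c x - x *\<^sub>R v s)) \<le> \<mu> * norm (y - x)"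
    proof (rule differentiable_bound[of "{x..y}" "\<lambda>t. c t - t *\<^sub>R v s" "\<lambda>t h. h *\<^sub>R (v t - v s)"])
      fix t assume t: "t \<in> {x..y}"
      show "((\<lambda>t. c t - t *\<^sub>R v s) has_derivative (\<lambda>h. h *\<^sub>R (v t - v s))) (at t within {x..y})"
        by (auto intro!: derivative_eq_intros c_has_derivative simp: algebra_simps)
      have "norm (v t - v s) < \<mu>" using d(2)[of t] t that by auto
      then show "onorm (\<lambda>h::real. h *\<^sub>R (v t - v s)) \<le> \<mu>"
        by (intro onorm_bound) (use assms in \<open>auto simp: mult.commute[of \<mu>] intro!: mult_left_mono\<close>)
    qed (use that in auto)
    moreover have "(c y - y *\<^sub>R v s) - (c x - x *\<^sub>R v s) = (y - x) *\<^sub>R ((1 / (y - x)) *\<^sub>R (c y - c x) - v s)"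
      using that by (simp add: algebra_simps)
    ultimately have "(y - x) * norm ((1 / (y - x)) *\<^sub>R (c y - c x) - v s) \<le> (y - x) * \<mu>"
      using that by (simp add: mult.commute)
    then show ?thesis using that by simp
  qed
  have "norm ((1 / (y - x)) *\<^sub>R (c y - c x) - v s) \<le> \<mu>" if "x \<noteq> y" "\<bar>x - s\<bar> < d" "\<bar>y - s\<bar> < d" for x y
  proof (cases "x < y")
    case True then show ?thesis using main that by blast
  next
    case False
    then have "y < x" using that by simp
    moreover have "(1 / (y - x)) *\<^sub>R (c y - c x) = (1 / (x - y)) *\<^sub>R (c x - c y)"
    proof -
      have "1 / (y - x) = - (1 / (x - y))" by (simp add: minus_divide_right)
      then show ?thesis by (metis minus_diff_eq scaleR_minus_left scaleR_minus_right minus_minus)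
    qed
    ultimately show ?thesis using main[of y x] that by simp
  qed
  then show ?thesis using that d(1) by blast
qed

text \<open>For short chords the length is asymptotic to the parameter difference and the direction
  to that of v s. Seen from the later end the chord points backwards, whence -1.\<close>

lemma diagonal_limits:
  assumes x: "x \<longlonglongrightarrow> s" and y: "y \<longlonglongrightarrow> s" and lt: "\<And>n. x n < y n"
  shows "(\<lambda>n. R (x n) (y n) / (y n - x n)) \<longlonglongrightarrow> 1"
    and "(\<lambda>n. E (x n) (y n)) \<longlonglongrightarrow> 1" and "(\<lambda>n. E (y n) (x n)) \<longlonglongrightarrow> -1"
proof -
  define q where "q n = (1 / (y n - x n)) *\<^sub>R (c (y n) - c (x n))" for n
  have q: "q \<longlonglongrightarrow> v s"
  proof (rule tendstoI)
    fix e :: real assume "e > 0"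
    then have e2: "e / 2 > 0" by simp
    obtain d where d: "d > 0" "\<And>x y. x \<noteq> y \<Longrightarrow> \<bar>x - s\<bar> < d \<Longrightarrow> \<bar>y - s\<bar> < d \<Longrightarrow>
      norm ((1 / (y - x)) *\<^sub>R (c y - c x) - v s) \<le> e / 2" using chord_quotient[OF e2] by blast
    have "\<forall>\<^sub>F n in sequentially. dist (x n) s < d" "\<forall>\<^sub>F n in sequentially. dist (y n) s < d"
      using x y d(1) tendstoD by blast+
    then show "\<forall>\<^sub>F n in sequentially. dist (q n) (v s) < e"
    proof eventually_elim
      case (elim n)
      have "norm (q n - v s) \<le> e / 2" unfolding q_def
        using d(2)[of "x n" "y n"] lt[of n] elim by (simp add: dist_real_def)
      then show ?case using \<open>e > 0\<close> by (simp add: dist_norm)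
    qed
  qed
  have cl: "(\<lambda>n. c (x n)) \<longlonglongrightarrow> c s" "(\<lambda>n. c (y n)) \<longlonglongrightarrow> c s"
    "(\<lambda>n. v (x n)) \<longlonglongrightarrow> v s" "(\<lambda>n. v (y n)) \<longlonglongrightarrow> v s"
    using isCont_tendsto_compose[OF isCont_c] isCont_tendsto_compose[OF isCont_v] x y by blast+
  \<comment> \<open>kappa (1 - w^2) factors as kappa (1 - w) times 1 + w, and the first factor is
    half the square of the difference vector by \<open>ip_diff_wip\<close>.\<close>
  have Rsq: "(R (x n) (y n) / (y n - x n))\<^sup>2 = ip G (q n) (q n) * (1 + wip G (c (x n)) (c (y n))) / 2" for n
  proof -
    define d where "d = c (y n) - c (x n)"
    have "ip G d d = 2 * kappa G * (1 - wip G (c (x n)) (c (y n)))"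
      unfolding d_def by (rule ip_diff_wip) auto
    then have e1: "kappa G * (1 - (wip G (c (x n)) (c (y n)))\<^sup>2) = ip G d d * (1 + wip G (c (x n)) (c (y n))) / 2"
      by (simp only:) (simp add: power2_eq_square algebra_simps)
    have e2: "ip G (q n) (q n) = ip G d d / (y n - x n)\<^sup>2"
      unfolding q_def d_def[symmetric] by (simp add: power2_eq_square)
    show ?thesis
      unfolding power_divide R_def rad_sq(1)[OF c_surf c_surf] e1 e2 by simp
  qed
  have "(\<lambda>n. ip G (q n) (q n) * (1 + wip G (c (x n)) (c (y n))) / 2) \<longlonglongrightarrow> ip G (v s) (v s) * (1 + wip G (c s) (c s)) / 2"
    unfolding wip_def by (intro tendsto_intros q cl) auto
  then have "(\<lambda>n. (R (x n) (y n) / (y n - x n))\<^sup>2) \<longlonglongrightarrow> 1"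
    unfolding Rsq by (simp add: wip_self v_unit)
  then have "(\<lambda>n. sqrt ((R (x n) (y n) / (y n - x n))\<^sup>2)) \<longlonglongrightarrow> sqrt 1" by (rule tendsto_real_sqrt)
  moreover have "sqrt ((R (x n) (y n) / (y n - x n))\<^sup>2) = R (x n) (y n) / (y n - x n)" for n
    using lt[of n] rad_sq(1)[of "c (x n)" G "c (y n)"] rad_sq(2)[of "c (x n)" G "c (y n)"]
    unfolding R_def by (cases "c (x n) = c (y n)") (auto simp: rad_def wip_self)
  ultimately show Rl: "(\<lambda>n. R (x n) (y n) / (y n - x n)) \<longlonglongrightarrow> 1" by simp
  have "E (x n) (y n) = ip G (v (x n)) (q n) / (R (x n) (y n) / (y n - x n))" for n
    using lt[of n] by (simp add: E_def q_def)
  moreover have "(\<lambda>n. ip G (v (x n)) (q n) / (R (x n) (y n) / (y n - x n))) \<longlonglongrightarrow> ip G (v s) (v s) / 1"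
    by (intro tendsto_intros q cl Rl) auto
  ultimately show "(\<lambda>n. E (x n) (y n)) \<longlonglongrightarrow> 1" by (simp add: v_unit)
  have "E (y n) (x n) = - ip G (v (y n)) (q n) / (R (x n) (y n) / (y n - x n))" for n
    using lt[of n] by (simp add: E_def q_def R_commute[of "y n"])
  moreover have "(\<lambda>n. - ip G (v (y n)) (q n) / (R (x n) (y n) / (y n - x n))) \<longlonglongrightarrow> - ip G (v s) (v s) / 1"
    by (intro tendsto_intros q cl Rl) auto
  ultimately show "(\<lambda>n. E (y n) (x n)) \<longlonglongrightarrow> -1" by (simp add: v_unit)
qed

end

lemma unit_cot_eq:
  fixes e a e' a' :: real
  assumes "e\<^sup>2 + a\<^sup>2 = 1" "e'\<^sup>2 + a'\<^sup>2 = 1" "a > 0" "a' > 0" "e * a' = a * e'"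
  shows "e = e'" "a = a'"
proof -
  have "e\<^sup>2 * a'\<^sup>2 = a\<^sup>2 * e'\<^sup>2" using assms(5) by (metis power_mult_distrib)
  moreover have "e\<^sup>2 = 1 - a\<^sup>2" "e'\<^sup>2 = 1 - a'\<^sup>2" using assms by auto
  ultimately have "a'\<^sup>2 = a\<^sup>2" by (simp add: algebra_simps)
  then show aa: "a = a'" using assms(3,4) by (simp add: power2_eq_iff)
  then show "e = e'" using assms by simp
qed

section \<open>Supporting chords of the convex set bounded by a caustic\<close>

locale caustic = table +
  fixes C :: "(real^3) set"
  assumes C_compact: "compact C" and C_convex: "geo_convex G C" and C_K: "C \<subseteq> K" and C_nonempty: "C \<noteq> {}"
    and reflecting: "\<And>p u q w. billiard_step G K p u q w \<Longrightarrow> supporting_line G C p u \<Longrightarrow> supporting_line G C q w"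
begin

text \<open>The line from c s to c t supports C and leaves it on its left.\<close>
definition T :: "real \<Rightarrow> real \<Rightarrow> bool" where
  "T s t \<longleftrightarrow> s < t \<and> t < s + L \<and> (\<forall>x\<in>C. det3 (c s) (c t) x \<ge> 0) \<and> (\<exists>x\<in>C. det3 (c s) (c t) x = 0)"

lemma DD_C: "c s \<notin> C \<Longrightarrow> x \<in> C \<Longrightarrow> DD s x > 0"
  using DD_pos[of x s] C_K by blast

text \<open>\<open>\<rho>\<close> is the cotangent of the angle at c s between the boundary and the
  line to x. Its maximum over C gives the line that leaves C on its left, its minimum the other
  supporting line; \<open>ray_exit\<close> prolongs each to the boundary.\<close>

lemma T_exists:
  assumes s: "c s \<notin> C"
  shows "\<exists>t. T s t" and "\<exists>r. T r s"
proof -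
  define \<rho> where "\<rho> x = ip G (v s) x / DD s x" for x
  have pos: "DD s x > 0" if "x \<in> C" for x using DD_C[OF s that] .
  have cont: "continuous_on C \<rho>" unfolding \<rho>_def
    by (intro continuous_intros) (use pos in force)
  have det: "det3 (c s) x y = DD s x * DD s y * (\<rho> x - \<rho> y)" if "x \<in> C" "y \<in> C" for x y
  proof -
    have "ip G (v s) z = \<rho> z * DD s z" if "z \<in> C" for z using pos[OF that] by (simp add: \<rho>_def)
    then show ?thesis
      using frame_det[OF c_surf v_tangent, of s x y] that by (simp add: algebra_simps)
  qed
  have exitx: "\<exists>t la nu. s < t \<and> t < s + L \<and> la \<ge> 0 \<and> nu > 0 \<and> x = la *\<^sub>R c s + nu *\<^sub>R c t" if "x \<in> C" for x
  proof -
    have "x \<in> K" "x \<noteq> c s" using that s C_K by auto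
    from ray_exit[OF this] show ?thesis by blast
  qed
  obtain x where x: "x \<in> C" "\<And>y. y \<in> C \<Longrightarrow> \<rho> y \<le> \<rho> x"
    using continuous_attains_sup[OF C_compact C_nonempty cont] by blast
  obtain t la nu where t: "s < t" "t < s + L" "la \<ge> 0" "nu > 0" "x = la *\<^sub>R c s + nu *\<^sub>R c t"
    using exitx[OF x(1)] by blast
  have e: "nu * det3 (c s) (c t) y = DD s x * DD s y * (\<rho> x - \<rho> y)" if "y \<in> C" for y
    unfolding det[OF x(1) that, symmetric] by (subst t(5)) simp
  have "det3 (c s) (c t) y \<ge> 0" if "y \<in> C" for y
  proof -
    have "nu * det3 (c s) (c t) y \<ge> 0" unfolding e[OF that] using pos[OF that] pos[OF x(1)] x(2)[OF that] by simp
    then show ?thesis using t(4) by (simp add: zero_le_mult_iff)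
  qed
  moreover have "det3 (c s) (c t) x = 0" using e[OF x(1)] t(4) by simp
  ultimately show "\<exists>t. T s t" unfolding T_def using t x(1) by blast
  obtain x where x: "x \<in> C" "\<And>y. y \<in> C \<Longrightarrow> \<rho> x \<le> \<rho> y"
    using continuous_attains_inf[OF C_compact C_nonempty cont] by blast
  obtain t la nu where t: "s < t" "t < s + L" "la \<ge> 0" "nu > 0" "x = la *\<^sub>R c s + nu *\<^sub>R c t"
    using exitx[OF x(1)] by blast
  \<comment> \<open>The same boundary point, one period earlier, so that its parameter precedes
    s.\<close>
  define r where "r = t - L"
  have r: "c r = c t" using per[of r] by (simp add: r_def)
  have e: "nu * det3 (c r) (c s) y = DD s x * DD s y * (\<rho> y - \<rho> x)" if "y \<in> C" for y
  proof -
    have "nu * det3 (c r) (c s) y = - (nu * det3 (c s) (c r) y)" by (subst det3_swap(1)) simp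
    also have "nu * det3 (c s) (c r) y = det3 (c s) x y" by (subst t(5)) (simp add: r)
    finally show ?thesis using det[OF x(1) that] by (simp add: algebra_simps)
  qed
  have "det3 (c r) (c s) y \<ge> 0" if "y \<in> C" for y
  proof -
    have "nu * det3 (c r) (c s) y \<ge> 0" unfolding e[OF that] using pos[OF that] pos[OF x(1)] x(2)[OF that] by simp
    then show ?thesis using t(4) by (simp add: zero_le_mult_iff)
  qed
  moreover have "det3 (c r) (c s) x = 0" using e[OF x(1)] t(4) by simp
  ultimately have "T r s" unfolding T_def
    by (intro conjI ballI bexI[of _ x]) (use t(1,2) x(1) in \<open>auto simp: r_def\<close>)
  then show "\<exists>r. T r s" by blast
qed

lemma T_neq: assumes "T s t" shows "c s \<noteq> c t" "c t \<noteq> c s"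
  using assms c_neq[of s t] by (auto simp: T_def)

text \<open>The contact point lies on the chord, between its ends. A coefficient can vanish only
  when the contact point is the opposite end, which is impossible if that end is not in C.\<close>

lemma contact:
  assumes "T s t"
  obtains la nu where "la \<ge> 0" "nu \<ge> 0" "la + nu > 0" "la *\<^sub>R c s + nu *\<^sub>R c t \<in> C"
    "c s \<notin> C \<Longrightarrow> nu > 0" "c t \<notin> C \<Longrightarrow> la > 0"
proof -
  obtain y where y: "y \<in> C" "det3 (c s) (c t) y = 0" using assms by (auto simp: T_def)
  show thesis
  proof (cases "y = c s")
    case True
    then show ?thesis using that[of 1 0] y by auto
  next
    case False
    then obtain la nu where l: "la \<ge> 0" "nu > 0" "y = la *\<^sub>R c s + nu *\<^sub>R c t"
      using on_chord[of y s t] y C_K T_neq[OF assms] by auto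
    have "la > 0" if "c t \<notin> C"
    proof (rule ccontr)
      assume "\<not> la > 0"
      then have "y = nu *\<^sub>R c t" using l by simp
      then have "y = c t" using surf_eq_of_scale y(1) C_K K_surf c_surf by blast
      then show False using that y(1) by simp
    qed
    then show ?thesis using that[of la nu] l y(1) by auto
  qed
qed

text \<open>The contact point of the second chord is a nonnegative combination of c u and c r and
  must not lie to the right of the first chord. Since c u is not on the left of it, c r cannot be
  strictly on the right. If r = t, all the weight would have to rest on c t, which is then a point
  of C.\<close>

lemma T_mono:
  assumes "T s t" "T u r" "s \<le> u" "u < t" "c u \<notin> C"
  shows "t \<le> r" and "s < u \<Longrightarrow> c t \<notin> C \<Longrightarrow> t < r"
proof -
  obtain la nu where l: "la \<ge> 0" "nu \<ge> 0" "la *\<^sub>R c u + nu *\<^sub>R c r \<in> C" "nu > 0"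
    using contact[OF assms(2)] assms(5) by metis
  have ge: "la * det3 (c s) (c t) (c u) + nu * det3 (c s) (c t) (c r) \<ge> 0"
    using assms(1) l(3) unfolding T_def by fastforce
  have st: "s < t" "t < s + L" and ur: "u < r" using assms by (auto simp: T_def)
  have u: "det3 (c s) (c t) (c u) \<le> 0"
    using chord_sign(2)[OF st, of u] assms(3,4) by (cases "s = u") auto
  show tr: "t \<le> r"
  proof (rule ccontr)
    assume "\<not> t \<le> r"
    then have "det3 (c s) (c t) (c r) < 0" using chord_sign(2)[OF st, of r] assms ur by auto
    then show False using ge l u by (smt (verit) mult_nonneg_nonpos mult_pos_neg)
  qed
  assume su: "s < u" "c t \<notin> C"
  show "t < r"
  proof (rule ccontr)
    assume "\<not> t < r"
    then have rt: "r = t" using tr by simp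
    then obtain la nu where l: "la > 0" "nu \<ge> 0" "la *\<^sub>R c u + nu *\<^sub>R c t \<in> C"
      using contact[OF assms(2)] su by metis
    have "la * det3 (c s) (c t) (c u) + nu * det3 (c s) (c t) (c t) \<ge> 0"
      using assms(1) l(3) unfolding T_def by fastforce
    moreover have "det3 (c s) (c t) (c u) < 0" using chord_sign(2)[OF st, of u] assms(4) su by auto
    ultimately show False using l by (simp add: zero_le_mult_iff)
  qed
qed

lemma T_unique: "T s t \<Longrightarrow> T s t' \<Longrightarrow> c s \<notin> C \<Longrightarrow> t = t'"
  using T_mono(1)[of s t s t'] T_mono(1)[of s t' s t] by (auto simp: T_def)

subsection \<open>The reflection law along supporting lines\<close>

lemma chord_step:
  assumes n: "c p \<noteq> c q" and la: "la \<ge> 0" "nu \<ge> 0" "la + nu > 0" "la *\<^sub>R c p + nu *\<^sub>R c q \<in> C"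
    and side: "(\<forall>x\<in>C. det3 (c p) (c q) x \<ge> 0) \<or> (\<forall>x\<in>C. det3 (c p) (c q) x \<le> 0)"
  shows "supporting_line G C (c q) (reflect G (v q) (- gdir G (c q) (c p)))"
proof (rule reflecting)
  define u where "u = gdir G (c p) (c q)"
  define l where "l = gdist G (c p) (c q)"
  note P = c_surf[of p] c_surf[of q] n
  have ut: "u \<in> unit_tangents G (c p)" unfolding u_def by (rule gdir_unit_tangent[OF P])
  have rp: "rad G (c p) (c q) > 0" by (rule rad_sq(2)[OF P])
  have seg: "geodesic_segment G (c p) (c q) (geod G (c p) u ` {0..l})"
    unfolding u_def l_def by (rule geodesic_segment_gdir[OF P])
  then have segK: "geod G (c p) u ` {0..l} \<subseteq> K" using K_convex unfolding geo_convex_def by (metis c_K)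
  show "billiard_step G K (c p) u (c q) (reflect G (v q) (- gdir G (c q) (c p)))"
    unfolding billiard_step_def
  proof (intro conjI exI[of _ l] ballI bexI[of _ "v q"] ut)
    show "c p \<in> bdry G K" "c q \<in> bdry G K" using range_c by auto
    show "l > 0" unfolding l_def by (rule gdist_facts(1)[OF P])
    show "geod G (c p) u l = c q" unfolding u_def l_def by (rule geod_gdir_end[OF P])
    show "reflect G (v q) (- gdir G (c q) (c p)) = reflect G (v q) (velocity (geod G (c p) u) l)"
      unfolding u_def l_def velocity_geod_end[OF P] ..
    show "v q \<in> unit_tangents_curve G (bdry G K) (c q)"
      unfolding unit_tangents_curve_def
    proof (intro CollectI conjI v_unit exI[of _ "\<lambda>t. c (q + t)"])
      show "range (\<lambda>t. c (q + t)) \<subseteq> bdry G K" using range_c by auto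
      have "((\<lambda>t. q + t) has_vector_derivative 1) (at 0)" by (auto intro!: derivative_eq_intros)
      from vector_diff_chain_at[OF this c_deriv]
      show "((\<lambda>t. c (q + t)) has_vector_derivative v q) (at 0)" by (simp add: o_def)
    qed simp
    fix t assume t: "t \<in> {0<..<l}"
    define a b where "a = gsin G (l - t) / rad G (c p) (c q)" and "b = gsin G t / rad G (c p) (c q)"
    have ab: "a > 0" "b > 0"
      using gdist_facts(4)[OF P, of t] gdist_facts(4)[OF P, of "l - t"] t rp by (auto simp: a_def b_def l_def)
    have y: "geod G (c p) u t = a *\<^sub>R c p + b *\<^sub>R c q"
      unfolding u_def geod_gdir[OF P] a_def b_def l_def ..
    have yK: "geod G (c p) u t \<in> K" using segK t by auto
    show "geod G (c p) u t \<in> inter G K"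
    proof (rule ccontr)
      assume "\<not> ?thesis"
      then have "geod G (c p) u t \<in> bdry G K" using yK bdry_K by simp
      then obtain w where w: "geod G (c p) u t = c w" using bdry_param by metis
      have "0 = DD w (a *\<^sub>R c p + b *\<^sub>R c q)" using w unfolding y by simp
      then have z: "a * DD w (c p) + b * DD w (c q) = 0" by simp
      \<comment> \<open>The tangent functional at c w would have to vanish at both ends of the
        chord, but it is positive at one of them since they differ.\<close>
      have "DD w (c p) \<ge> 0" "DD w (c q) \<ge> 0" "DD w (c p) > 0 \<or> DD w (c q) > 0"
        using DD_nonneg[of _ w] DD_pos[of "c p" w] DD_pos[of "c q" w] n by (cases "c p = c w"; auto)+
      then show False using z ab by (smt (verit) mult_nonneg_nonneg mult_pos_pos)
    qed
  qed
  obtain t r where t: "0 \<le> t" "t \<le> l" "r > 0" "geod G (c p) u t = r *\<^sub>R (la *\<^sub>R c p + nu *\<^sub>R c q)"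
    using geod_cone[OF P la(1-3)] unfolding l_def u_def by blast
  have gs: "geod G (c p) u t \<in> surf G"
    using subsetD[OF segK imageI[of t]] t(1,2) K_surf by auto
  moreover have "la *\<^sub>R c p + nu *\<^sub>R c q \<in> surf G" using la(4) C_K K_surf by blast
  ultimately have "geod G (c p) u t = la *\<^sub>R c p + nu *\<^sub>R c q" using surf_eq_of_scale[OF t(4)] by blast
  then have "geod G (c p) u t \<in> C" using la(4) by simp
  moreover have "ip G x (rot90 G (c p) u) = det3 (c p) (c q) x / rad G (c p) (c q)" for x
    unfolding ip_rot90 det3_inner[symmetric] u_def gdir_def by simp
  ultimately show "supporting_line G C (c p) u"
  proof -
    assume 1: "geod G (c p) u t \<in> C"
      and 2: "\<And>x. ip G x (rot90 G (c p) u) = det3 (c p) (c q) x / rad G (c p) (c q)"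
    have "range (geod G (c p) u) \<inter> surf G \<inter> C \<noteq> {}" using gs 1 by blast
    then show ?thesis unfolding supporting_line_def 2 using side rp by (auto simp: divide_nonpos_pos)
  qed
qed

lemma gdir_frame:
  assumes "c s \<noteq> c t"
  shows "ip G (v s) (gdir G (c s) (c t)) = E s t" "DD s (gdir G (c s) (c t)) = A s t"
    "c t = W s t *\<^sub>R c s + R s t *\<^sub>R gdir G (c s) (c t)"
  using R_pos[OF assms] by (simp_all add: gdir_def E_def A_def D_def R_def W_def)

text \<open>Through c s there is only one supporting line with C on a given side: the contact point
  of each line lies on the prescribed side of the other, which gives det3 (c s) d w both
  signs.\<close>

lemma two_lines:
  assumes s: "c s \<notin> C" and d: "DD s d > 0" "DD s w > 0" "(ip G (v s) d)\<^sup>2 + (DD s d)\<^sup>2 = 1" "(ip G (v s) w)\<^sup>2 + (DD s w)\<^sup>2 = 1"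
    and y: "\<alpha> *\<^sub>R c s + \<beta> *\<^sub>R d \<in> C" and z: "\<alpha>' *\<^sub>R c s + \<beta>' *\<^sub>R w \<in> C"
    and side: "(\<forall>x\<in>C. det3 (c s) d x \<ge> 0) \<and> (\<forall>x\<in>C. det3 (c s) w x \<ge> 0) \<or>
      (\<forall>x\<in>C. det3 (c s) d x \<le> 0) \<and> (\<forall>x\<in>C. det3 (c s) w x \<le> 0)"
  shows "ip G (v s) d = ip G (v s) w" "DD s d = DD s w"
proof -
  have "\<beta> * DD s d > 0" "\<beta>' * DD s w > 0" using DD_C[OF s y] DD_C[OF s z] by auto
  then have b: "\<beta> > 0" "\<beta>' > 0" using d(1,2) by (metis zero_less_mult_pos2)+
  have sw: "det3 (c s) w d = - det3 (c s) d w" by (rule det3_swap(2))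
  have "det3 (c s) d w = 0" using side
  proof
    assume "(\<forall>x\<in>C. det3 (c s) d x \<ge> 0) \<and> (\<forall>x\<in>C. det3 (c s) w x \<ge> 0)"
    then have "det3 (c s) d (\<alpha>' *\<^sub>R c s + \<beta>' *\<^sub>R w) \<ge> 0" "det3 (c s) w (\<alpha> *\<^sub>R c s + \<beta> *\<^sub>R d) \<ge> 0"
      using y z by blast+
    then have "\<beta>' * det3 (c s) d w \<ge> 0" "\<beta> * det3 (c s) w d \<ge> 0" by simp_all
    then show ?thesis using b sw by (simp add: zero_le_mult_iff mult_le_0_iff)
  next
    assume "(\<forall>x\<in>C. det3 (c s) d x \<le> 0) \<and> (\<forall>x\<in>C. det3 (c s) w x \<le> 0)"
    then have "det3 (c s) d (\<alpha>' *\<^sub>R c s + \<beta>' *\<^sub>R w) \<le> 0" "det3 (c s) w (\<alpha> *\<^sub>R c s + \<beta> *\<^sub>R d) \<le> 0"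
      using y z by blast+
    then have "\<beta>' * det3 (c s) d w \<le> 0" "\<beta> * det3 (c s) w d \<le> 0" by simp_all
    then show ?thesis using b sw by (simp add: zero_le_mult_iff mult_le_0_iff)
  qed
  then have "ip G (v s) d * DD s w = DD s d * ip G (v s) w"
    using frame_det[OF c_surf v_tangent, of s d w] by simp
  then show "ip G (v s) d = ip G (v s) w" "DD s d = DD s w" using unit_cot_eq d by blast+
qed

text \<open>
  The reflected trajectory supports C, so it lies on one of the two supporting lines through c s.
  It can lie on the incoming one only if that is normal to the boundary; this is excluded by using
  both lines as incoming ones, unless they coincide.
\<close>
lemma reflection:
  assumes s: "c s \<notin> C" and "T s t" "T r s"
  shows "E s t = - E s r" and "A s t = A s r"
proof -
  define d where "d x = gdir G (c s) (c x)" for x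
  have n: "c s \<noteq> c t" "c s \<noteq> c r" using T_neq assms by auto
  have dd: "DD s (d t) = A s t" "DD s (d r) = A s r" "ip G (v s) (d t) = E s t" "ip G (v s) (d r) = E s r"
    using gdir_frame n unfolding d_def by auto
  have Rp: "R s t > 0" "R s r > 0" using R_pos n by auto
  obtain a1 b1 where c1: "a1 \<ge> 0" "b1 \<ge> 0" "a1 + b1 > 0" "a1 *\<^sub>R c s + b1 *\<^sub>R c t \<in> C"
    using contact[OF assms(2)] by metis
  obtain a2 b2 where c2: "a2 \<ge> 0" "b2 \<ge> 0" "a2 + b2 > 0" "a2 *\<^sub>R c r + b2 *\<^sub>R c s \<in> C"
    using contact[OF assms(3)] by metis
  have side1: "det3 (c s) (c t) x \<ge> 0" if "x \<in> C" for x using assms(2) that by (simp add: T_def)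
  have side2: "det3 (c r) (c s) x \<ge> 0" if "x \<in> C" for x using assms(3) that by (simp add: T_def)
  have sd1: "det3 (c s) (d t) x \<ge> 0" if "x \<in> C" for x
    using side1[OF that] Rp(1) unfolding d_def gdir_def R_def by simp
  have sd2: "det3 (c s) (d r) x \<le> 0" if "x \<in> C" for x
  proof -
    have "det3 (c s) (c r) x \<le> 0" using side2[OF that] det3_swap(1)[of "c s" "c r" x] by simp
    then show ?thesis using Rp(2) unfolding d_def gdir_def R_def by (simp add: divide_nonpos_pos)
  qed
  have "a1 *\<^sub>R c s + b1 *\<^sub>R c t = (a1 + b1 * W s t) *\<^sub>R c s + (b1 * R s t) *\<^sub>R d t"
    unfolding d_def by (subst gdir_frame(3)[OF n(1)]) (simp add: scaleR_add_left scaleR_add_right)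
  then have y1: "(a1 + b1 * W s t) *\<^sub>R c s + (b1 * R s t) *\<^sub>R d t \<in> C" using c1(4) by simp
  have "a2 *\<^sub>R c r + b2 *\<^sub>R c s = (b2 + a2 * W s r) *\<^sub>R c s + (a2 * R s r) *\<^sub>R d r"
    unfolding d_def by (subst gdir_frame(3)[OF n(2)]) (simp add: scaleR_add_left scaleR_add_right)
  then have y2: "(b2 + a2 * W s r) *\<^sub>R c s + (a2 * R s r) *\<^sub>R d r \<in> C" using c2(4) by simp
  have unit: "(E s t)\<^sup>2 + (A s t)\<^sup>2 = 1" "(E s r)\<^sup>2 + (A s r)\<^sup>2 = 1" "A s t > 0" "A s r > 0"
    using EA_unit A_pos n by auto
  define w where "w x = reflect G (v s) (- d x)" for x
  have wE: "ip G (v s) (w x) = - ip G (v s) (d x)" for x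
    using ip_commute[of G "v s" "d x"] by (simp add: w_def reflect_def v_unit)
  have wA: "DD s (w x) = DD s (d x)" for x by (simp add: w_def reflect_def)
  \<comment> \<open>The reflected line leaves C on its left or on its right, and by
    \<open>two_lines\<close> it is the line to c t or the line to c r accordingly.\<close>
  have key: "- E s x = E s t \<and> A s x = A s t \<or> - E s x = E s r \<and> A s x = A s r"
    if sup: "supporting_line G C (c s) (w x)" and un: "(E s x)\<^sup>2 + (A s x)\<^sup>2 = 1" "A s x > 0"
      and dx: "DD s (d x) = A s x" "ip G (v s) (d x) = E s x" for x
  proof -
    obtain \<tau> where "geod G (c s) (w x) \<tau> \<in> C" using sup unfolding supporting_line_def by auto
    then have y3: "gcos G \<tau> *\<^sub>R c s + gsin G \<tau> *\<^sub>R w x \<in> C" by (simp add: geod_eq)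
    have wu: "(ip G (v s) (w x))\<^sup>2 + (DD s (w x))\<^sup>2 = 1" unfolding wE wA dx using un by simp
    have "(\<forall>z\<in>C. det3 (c s) (w x) z \<ge> 0) \<or> (\<forall>z\<in>C. det3 (c s) (w x) z \<le> 0)"
      using sup unfolding supporting_line_def ip_rot90 det3_inner[symmetric] by blast
    then show ?thesis
    proof
      assume "\<forall>z\<in>C. det3 (c s) (w x) z \<ge> 0"
      then show ?thesis
        using two_lines[OF s _ _ wu _ y3 y1] sd1 dd unit un dx wE[of x] wA[of x] by auto
    next
      assume "\<forall>z\<in>C. det3 (c s) (w x) z \<le> 0"
      then show ?thesis
        using two_lines[OF s _ _ wu _ y3 y2] sd2 dd unit un dx wE[of x] wA[of x] by auto
    qed
  qed
  have "supporting_line G C (c s) (w r)"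
    unfolding w_def d_def by (rule chord_step[OF _ c2]) (use n side2 in auto)
  then have k1: "- E s r = E s t \<or> - E s r = E s r" using key[of r] unit dd by auto
  \<comment> \<open>The chord to c t traversed backwards, arriving at c s with C on its
    right.\<close>
  have c1': "b1 *\<^sub>R c t + a1 *\<^sub>R c s \<in> C" "b1 + a1 > 0" using c1 by (simp_all add: add.commute)
  have side1': "det3 (c t) (c s) x \<le> 0" if "x \<in> C" for x
    using side1[OF that] det3_swap(1)[of "c t" "c s" x] by simp
  have "supporting_line G C (c s) (w t)"
    unfolding w_def d_def by (rule chord_step[OF _ c1(2) c1(1) c1'(2) c1'(1)]) (use n side1' in auto)
  then have k2: "- E s t = E s t \<or> - E s t = E s r" using key[of t] unit dd by auto
  \<comment> \<open>If the law failed, \<open>k1\<close> and \<open>k2\<close> would make both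
    cosines zero, and then it holds.\<close>
  show "E s t = - E s r" using k1 k2 by linarith
  then have "(E s t)\<^sup>2 = (E s r)\<^sup>2" by simp
  then have "(A s t)\<^sup>2 = (A s r)\<^sup>2" using unit(1,2) by linarith
  then show "A s t = A s r" by (rule power2_eq_imp_eq) (use unit in auto)
qed

end

section \<open>The length of chords and the conserved quantity\<close>

lemma arc_deriv:
  assumes "p \<in> surf G" "q \<in> surf G" "p \<noteq> q"
  shows "(arc G has_real_derivative - kappa G / rad G p q) (at (wip G p q))"
proof (cases G)
  case Hyperbolic
  have w: "wip G p q > 1" using wip_range_hyperbolic assms Hyperbolic by auto
  have "(arcosh has_real_derivative 1 / sqrt ((wip G p q)\<^sup>2 - 1)) (at (wip G p q))"
    using w by (auto intro!: derivative_eq_intros)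
  moreover have "arc G = arcosh" using Hyperbolic by (simp add: arc_def fun_eq_iff)
  moreover have "rad G p q = sqrt ((wip G p q)\<^sup>2 - 1)" using Hyperbolic by (simp add: rad_def)
  ultimately show ?thesis using Hyperbolic by simp
next
  case Spherical
  have w: "\<bar>wip G p q\<bar> < 1" using wip_range_spherical assms Spherical by auto
  have "(arccos has_real_derivative - 1 / sqrt (1 - (wip G p q)\<^sup>2)) (at (wip G p q))"
    using w DERIV_arccos[of "wip G p q"] by (simp add: abs_less_iff divide_inverse)
  moreover have "arc G = arccos" using Spherical by (simp add: arc_def fun_eq_iff)
  moreover have "rad G p q = sqrt (1 - (wip G p q)\<^sup>2)" using Spherical by (simp add: rad_def)
  ultimately show ?thesis using Spherical by simp
qed

text \<open>Coincident points are included, in contrast to \<open>arc_deriv\<close>: the values of H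
  near the diagonal decide whether P can be small.\<close>

lemma arc_cont:
  fixes p q :: "'a::topological_space \<Rightarrow> real^3"
  assumes "continuous_on S p" "continuous_on S q" "\<And>x. x \<in> S \<Longrightarrow> p x \<in> surf G" "\<And>x. x \<in> S \<Longrightarrow> q x \<in> surf G"
  shows "continuous_on S (\<lambda>x. gdist G (p x) (q x))"
proof -
  have c: "continuous_on S (\<lambda>x. wip G (p x) (q x))"
    unfolding wip_def by (intro continuous_intros assms)
  show ?thesis
  proof (cases G)
    case Hyperbolic
    have "wip G (p x) (q x) \<ge> 1" if "x \<in> S" for x
      using wip_range_hyperbolic[of "p x" "q x"] wip_self[of "p x" G] assms that Hyperbolic
      by (cases "p x = q x") (auto simp: less_imp_le)
    then have "continuous_on S (\<lambda>x. arcosh (wip G (p x) (q x)))"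
      by (intro continuous_on_compose2[OF continuous_on_arcosh[of "{1..}"] c]) auto
    then show ?thesis using Hyperbolic by (simp add: arc_def)
  next
    case Spherical
    have "\<bar>wip G (p x) (q x)\<bar> \<le> 1" if "x \<in> S" for x
      using wip_range_spherical[of "p x" "q x"] wip_self[of "p x" G] assms that Spherical
      by (cases "p x = q x") (auto simp: less_imp_le)
    then have "continuous_on S (\<lambda>x. arccos (wip G (p x) (q x)))"
      by (intro continuous_on_arccos[OF c]) (auto simp: abs_le_iff minus_le_iff)
    then show ?thesis using Spherical by (simp add: arc_def)
  qed
qed

lemma arc_1 [simp]: "arc G 1 = 0"
  by (cases G) (auto simp: arc_def arcosh_1)

text \<open>The graph of a monotone continuous function has finite length, hence a function whose
  Frechet derivative vanishes at each of its points is constant along it.\<close>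
lemma constant_along_monotone_graph:
  fixes \<Psi> :: "real \<times> real \<Rightarrow> real"
  assumes "p \<le> q" and mono: "\<And>x y. p \<le> x \<Longrightarrow> x \<le> y \<Longrightarrow> y \<le> q \<Longrightarrow> f x \<le> f y"
    and cont: "continuous_on {p..q} f"
    and der: "\<And>x. x \<in> {p..q} \<Longrightarrow> (\<Psi> has_derivative (\<lambda>_. 0)) (at (x, f x))"
  shows "\<Psi> (p, f p) = \<Psi> (q, f q)"
proof -
  \<comment> \<open>For a monotone f the increments of x and f x add up, so M measures the length of
    the graph in the l^1 norm.\<close>
  define M where "M x = x + f x" for x
  have bound: "\<bar>\<Psi> (q, f q) - \<Psi> (p, f p)\<bar> \<le> e * (M q - M p)" if e: "e > 0" for e
  proof -
    have "p \<le> p \<and> q \<le> q \<longrightarrow> \<bar>\<Psi> (q, f q) - \<Psi> (p, f p)\<bar> \<le> e * (M q - M p)"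
    proof (rule Bolzano[of p q "\<lambda>a b. p \<le> a \<and> b \<le> q \<longrightarrow> \<bar>\<Psi> (b, f b) - \<Psi> (a, f a)\<bar> \<le> e * (M b - M a)"])
      fix a b d
      assume "p \<le> a \<and> b \<le> q \<longrightarrow> \<bar>\<Psi> (b, f b) - \<Psi> (a, f a)\<bar> \<le> e * (M b - M a)"
        "p \<le> b \<and> d \<le> q \<longrightarrow> \<bar>\<Psi> (d, f d) - \<Psi> (b, f b)\<bar> \<le> e * (M d - M b)" "a \<le> b" "b \<le> d"
      then show "p \<le> a \<and> d \<le> q \<longrightarrow> \<bar>\<Psi> (d, f d) - \<Psi> (a, f a)\<bar> \<le> e * (M d - M a)"
        by (auto simp: right_diff_distrib)
    next
      fix x assume x: "p \<le> x" "x \<le> q"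
      then obtain d1 where d1: "d1 > 0"
        "\<And>z. norm (z - (x, f x)) < d1 \<Longrightarrow> \<bar>\<Psi> z - \<Psi> (x, f x)\<bar> \<le> e * norm (z - (x, f x))"
        using der[of x] e unfolding has_derivative_at_alt by (auto simp del: norm_Pair)
      obtain d2 where d2: "d2 > 0" "\<And>y. y \<in> {p..q} \<Longrightarrow> \<bar>y - x\<bar> < d2 \<Longrightarrow> \<bar>f y - f x\<bar> < d1 / 2"
        using cont x d1(1) unfolding continuous_on_iff dist_real_def
        by (metis atLeastAtMost_iff half_gt_zero)
      have near: "\<bar>\<Psi> (y, f y) - \<Psi> (x, f x)\<bar> \<le> e * \<bar>M y - M x\<bar>"
        if y: "y \<in> {p..q}" "\<bar>y - x\<bar> < min d2 (d1 / 2)" for y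
      proof -
        have s: "\<bar>y - x\<bar> + \<bar>f y - f x\<bar> = \<bar>M y - M x\<bar>"
          using mono[of x y] mono[of y x] y x by (auto simp: M_def abs_if)
        have n: "norm ((y, f y) - (x, f x)) \<le> \<bar>y - x\<bar> + \<bar>f y - f x\<bar>"
          using norm_Pair_le[of "y - x" "f y - f x"] by simp
        then have "norm ((y, f y) - (x, f x)) < d1" using d2(2)[of y] y by auto
        then have "\<bar>\<Psi> (y, f y) - \<Psi> (x, f x)\<bar> \<le> e * norm ((y, f y) - (x, f x))" by (rule d1(2))
        also have "\<dots> \<le> e * \<bar>M y - M x\<bar>" using n s e by (intro mult_left_mono) auto
        finally show ?thesis .
      qed
      show "\<exists>d>0. \<forall>a b. a \<le> x \<and> x \<le> b \<and> b - a < d \<longrightarrow> p \<le> a \<and> b \<le> q \<longrightarrow>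
        \<bar>\<Psi> (b, f b) - \<Psi> (a, f a)\<bar> \<le> e * (M b - M a)"
      proof (intro exI[of _ "min d2 (d1 / 2)"] conjI allI impI)
        show "min d2 (d1 / 2) > 0" using d1 d2 by auto
        fix a b assume ab: "a \<le> x \<and> x \<le> b \<and> b - a < min d2 (d1 / 2)" "p \<le> a \<and> b \<le> q"
        have "M a \<le> M x" "M x \<le> M b" using mono[of a x] mono[of x b] ab by (auto simp: M_def)
        moreover have "\<bar>\<Psi> (a, f a) - \<Psi> (x, f x)\<bar> \<le> e * \<bar>M a - M x\<bar>" "\<bar>\<Psi> (b, f b) - \<Psi> (x, f x)\<bar> \<le> e * \<bar>M b - M x\<bar>"
          using ab by (auto intro!: near)
        ultimately show "\<bar>\<Psi> (b, f b) - \<Psi> (a, f a)\<bar> \<le> e * (M b - M a)"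
          by (simp add: right_diff_distrib)
      qed
    qed (rule assms(1))
    then show ?thesis by simp
  qed
  have "\<bar>\<Psi> (q, f q) - \<Psi> (p, f p)\<bar> \<le> 0"
  proof (rule field_le_epsilon)
    fix e :: real assume e: "e > 0"
    have M: "M q - M p \<ge> 0" using mono[of p q] assms(1) by (simp add: M_def)
    have "\<bar>\<Psi> (q, f q) - \<Psi> (p, f p)\<bar> \<le> e / (M q - M p + 1) * (M q - M p)"
      using bound[of "e / (M q - M p + 1)"] e M by simp
    also have "\<dots> \<le> e" using e M by (simp add: field_simps)
    finally show "\<bar>\<Psi> (q, f q) - \<Psi> (p, f p)\<bar> \<le> 0 + e" by simp
  qed
  then show ?thesis by simp
qed

context table
begin

definition H :: "real \<Rightarrow> real \<Rightarrow> real" where "H s t = gdist G (c s) (c t)"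

lemma H_self [simp]: "H s s = 0"
  by (simp add: H_def wip_self)

lemma H_cont: "continuous_on S (\<lambda>z. H (fst z) (snd z))"
  unfolding H_def
  by (intro arc_cont continuous_on_compose2[OF c_cont[of UNIV]] continuous_intros) auto

lemma H_cont1: "continuous_on S (\<lambda>u. H u t)"
  unfolding H_def by (intro arc_cont c_cont continuous_intros) auto

text \<open>The first variation of length: moving an end shortens the chord by the cosine of the
  angle between its velocity and the direction to the other end.\<close>

lemma H_deriv:
  assumes "c s \<noteq> c t"
  shows "((\<lambda>z. H (fst z) (snd z)) has_derivative (\<lambda>h. - E s t * fst h - E t s * snd h)) (at (s, t))"
proof -
  have c1: "((\<lambda>z. c (fst z)) has_derivative (\<lambda>h. fst h *\<^sub>R v s)) (at (s, t))"
    using has_derivative_compose[OF bounded_linear_imp_has_derivative[OF bounded_linear_fst] c_has_derivative,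
        of "(s, t)" UNIV] by simp
  have c2: "((\<lambda>z. c (snd z)) has_derivative (\<lambda>h. snd h *\<^sub>R v t)) (at (s, t))"
    using has_derivative_compose[OF bounded_linear_imp_has_derivative[OF bounded_linear_snd] c_has_derivative,
        of "(s, t)" UNIV] by simp
  have w: "((\<lambda>z. wip G (c (fst z)) (c (snd z))) has_derivative
      (\<lambda>h. kappa G * (ip G (c s) (snd h *\<^sub>R v t) + ip G (fst h *\<^sub>R v s) (c t)))) (at (s, t))"
    unfolding wip_def using has_derivative_mult_right[OF has_derivative_ip[OF c1 c2], of "kappa G" G] by simp
  have a: "(arc G has_derivative (\<lambda>h. (- kappa G / rad G (c s) (c t)) * h)) (at (wip G (c (fst (s, t))) (c (snd (s, t)))))"
    unfolding fst_conv snd_conv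
    by (rule arc_deriv[OF c_surf c_surf assms, unfolded has_field_derivative_def])
  have "((\<lambda>z. arc G (wip G (c (fst z)) (c (snd z)))) has_derivative
      (\<lambda>h. (- kappa G / rad G (c s) (c t)) * (kappa G * (ip G (c s) (snd h *\<^sub>R v t) + ip G (fst h *\<^sub>R v s) (c t))))) (at (s, t))"
    by (rule has_derivative_compose[OF w a])
  moreover have "(- kappa G / rad G (c s) (c t)) * (kappa G * (ip G (c s) (snd h *\<^sub>R v t) + ip G (fst h *\<^sub>R v s) (c t)))
      = - E s t * fst h - E t s * snd h" for h :: "real \<times> real"
  proof -
    have "(- kappa G / rad G (c s) (c t)) * (kappa G * x) = - (x / rad G (c s) (c t))" for x
      by (cases G) auto
    then show ?thesis
      by (simp add: E_def R_def rad_commute[of G "c t"] ip_commute[of G "c s" "v t"] add_divide_distrib mult.commute)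
  qed
  ultimately show ?thesis unfolding H_def by simp
qed

lemma H_deriv1:
  assumes "c s \<noteq> c t"
  shows "((\<lambda>u. H u t) has_real_derivative - E s t) (at s)"
proof -
  have "((\<lambda>u. (u, t)) has_derivative (\<lambda>h. (h, 0))) (at s)" by (auto intro!: derivative_eq_intros)
  from has_derivative_compose[OF this H_deriv[OF assms]]
  have "((\<lambda>u. H u t) has_derivative (\<lambda>h. - E s t * fst (h, 0::real) - E t s * snd (h, 0::real))) (at s)" by simp
  moreover have "(\<lambda>h. - E s t * fst (h, 0::real) - E t s * snd (h, 0::real)) = (*) (- E s t)" by (simp add: fun_eq_iff)
  ultimately show ?thesis unfolding has_field_derivative_def by simp
qed

lemma E_bounds: "c s \<noteq> c t \<Longrightarrow> \<bar>E s t\<bar> < 1"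
  using EA_unit[of s t] A_pos[of s t] by (metis abs_square_less_1 less_add_same_cancel1 zero_less_power)

lemma E_decreasing_le:
  assumes "s < t" "t \<le> u" "u < s + L"
  shows "E s u \<le> E s t"
  using E_decreasing[OF assms(1) _ assms(3)] assms(2) by (cases "t = u") auto

text \<open>By periodicity a chord to an earlier point is a chord to a point one period later, where
  \<open>E_decreasing_le\<close> applies.\<close>

lemma E_backward:
  assumes "r \<le> s" "s < u" "u < r + L"
  shows "E u s \<le> E u r"
  using E_decreasing_le[of u "r + L" "s + L"] assms E_per by simp

text \<open>P is the conserved quantity H s (f s) - (F (f s) - F s), where F' u = E u (f u).\<close>
lemma potential:
  fixes a b :: ereal
  defines "I \<equiv> {s. a < ereal s \<and> ereal s < b}"
  assumes ab: "a < b"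
    and f: "\<And>s. s \<in> I \<Longrightarrow> f s \<in> I" "\<And>s. s \<in> I \<Longrightarrow> s < f s \<and> f s < s + L"
    and mono: "\<And>s t. s \<in> I \<Longrightarrow> t \<in> I \<Longrightarrow> s < t \<Longrightarrow> f s < f t"
    and cont: "\<And>s. s \<in> I \<Longrightarrow> isCont f s"
    and refl: "\<And>s. s \<in> I \<Longrightarrow> E (f s) (f (f s)) = - E (f s) s"
    and E0: "\<And>s. s \<in> I \<Longrightarrow> E s (f s) \<ge> 0"
  obtains P where "\<And>s. s \<in> I \<Longrightarrow> 0 < P \<and> P \<le> H s (f s)"
    and "\<And>s p q \<eta>. s \<in> I \<Longrightarrow> s < p \<Longrightarrow> p \<le> q \<Longrightarrow> q < f s \<Longrightarrow>
       (\<And>u. u \<in> {p..q} \<Longrightarrow> E u (f s) - E u (f u) \<ge> \<eta>) \<Longrightarrow> P \<ge> \<eta> * (q - p)"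
proof -
  \<comment> \<open>Extended ends let the interval be the whole line in one application and an arc
    between two contact points in the other.\<close>
  have Iiv: "x \<in> I" if "s \<in> I" "t \<in> I" "s \<le> x" "x \<le> t" for s t x
  proof -
    have "ereal s \<le> ereal x" "ereal x \<le> ereal t" using that by auto
    then have "a < ereal x" "ereal x < b"
      using that(1,2) less_le_trans[of a "ereal s" "ereal x"] le_less_trans[of "ereal x" "ereal t" b]
      unfolding I_def by blast+
    then show ?thesis unfolding I_def by blast
  qed
  have ne: "c s \<noteq> c (f s)" if "s \<in> I" for s using c_neq[of s "f s"] f(2)[OF that] by auto
  have econt: "isCont (\<lambda>u. E u (f u)) s" if "s \<in> I" for s
  proof -
    have "isCont (\<lambda>z. E (fst z) (snd z)) (s, f s)" using E_continuous f(2)[OF that] by auto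
    moreover have "isCont (\<lambda>u. (u, f u)) s" using cont[OF that] by (intro continuous_intros)
    ultimately show ?thesis using isCont_o2[of s "\<lambda>u. (u, f u)" "\<lambda>z. E (fst z) (snd z)"] by simp
  qed
  obtain F where F0: "\<forall>x::real. a < x \<longrightarrow> x < b \<longrightarrow> (F has_vector_derivative E x (f x)) (at x)"
    using einterval_antiderivative[OF ab, of "\<lambda>u. E u (f u)"] econt unfolding I_def by auto
  have F: "(F has_real_derivative E x (f x)) (at x)" if "x \<in> I" for x
    using F0 that by (auto simp: I_def has_real_derivative_iff_has_vector_derivative)
  define \<Psi> where "\<Psi> z = H (fst z) (snd z) - F (snd z) + F (fst z)" for z
  \<comment> \<open>In the first variable the terms cancel because F' u = E u (f u), in the second
    by the reflection law at f s.\<close>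
  have d\<Psi>: "(\<Psi> has_derivative (\<lambda>_. 0)) (at (s, f s))" if s: "s \<in> I" for s
  proof -
    have A: "(F has_derivative (\<lambda>h. E s (f s) * h)) (at (fst (s, f s)))"
      unfolding fst_conv by (rule F[OF s, unfolded has_field_derivative_def])
    have B: "(F has_derivative (\<lambda>h. E (f s) (f (f s)) * h)) (at (snd (s, f s)))"
      unfolding snd_conv by (rule F[OF f(1)[OF s], unfolded has_field_derivative_def])
    have "((\<lambda>z. F (fst z)) has_derivative (\<lambda>h. E s (f s) * fst h)) (at (s, f s))"
      "((\<lambda>z. F (snd z)) has_derivative (\<lambda>h. E (f s) (f (f s)) * snd h)) (at (s, f s))"
      by (rule has_derivative_compose[OF bounded_linear_imp_has_derivative[OF bounded_linear_fst] A]
          has_derivative_compose[OF bounded_linear_imp_has_derivative[OF bounded_linear_snd] B])+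
    from has_derivative_add[OF has_derivative_diff[OF H_deriv[OF ne[OF s]] this(2)] this(1)]
    have "(\<Psi> has_derivative (\<lambda>h. - E s (f s) * fst h - E (f s) s * snd h - E (f s) (f (f s)) * snd h + E s (f s) * fst h)) (at (s, f s))"
      unfolding \<Psi>_def .
    then show ?thesis unfolding refl[OF s] by simp
  qed
  have const: "\<Psi> (s, f s) = \<Psi> (t, f t)" if "s \<in> I" "t \<in> I" "s \<le> t" for s t
  proof (rule constant_along_monotone_graph[OF that(3)])
    have in_I: "x \<in> I" if "x \<in> {s..t}" for x using Iiv[OF \<open>s \<in> I\<close> \<open>t \<in> I\<close>] that by auto
    show "f x \<le> f y" if "s \<le> x" "x \<le> y" "y \<le> t" for x y
      using mono[of x y] in_I[of x] in_I[of y] that by (cases "x = y") auto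
    show "continuous_on {s..t} f" using in_I cont by (intro continuous_at_imp_continuous_on) auto
    show "(\<Psi> has_derivative (\<lambda>_. 0)) (at (x, f x))" if "x \<in> {s..t}" for x using d\<Psi> in_I[OF that] .
  qed
  obtain s0 where s0: "s0 \<in> I" using ereal_dense2[OF ab] unfolding I_def by auto
  define P where "P = \<Psi> (s0, f s0)"
  have P: "P = H s (f s) - F (f s) + F s" if "s \<in> I" for s
  proof -
    have "\<Psi> (s, f s) = P"
      unfolding P_def using const[OF that s0] const[OF s0 that] by (metis linear)
    then show ?thesis by (simp add: \<Psi>_def)
  qed
  \<comment> \<open>With t = f s, P is the total decrease of \<open>\<Phi> t\<close> from s to f s.
    It does decrease, because for u in between f u lies beyond f s and the chord to f s has the
    larger cosine.\<close>
  define \<Phi> where "\<Phi> t u = H u t + F u" for t u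
  have main: "(\<Phi> (f s) has_real_derivative - E u (f s) + E u (f u)) (at u)" "E u (f u) < E u (f s)"
    if s: "s \<in> I" and u: "s < u" "u < f s" for s u
  proof -
    have uI: "u \<in> I" using Iiv[OF s f(1)[OF s]] u by auto
    have "c u \<noteq> c (f s)" using c_neq[of u "f s"] u f(2)[OF s] by auto
    then show "(\<Phi> (f s) has_real_derivative - E u (f s) + E u (f u)) (at u)"
      unfolding \<Phi>_def by (intro DERIV_add H_deriv1 F uI)
    show "E u (f u) < E u (f s)"
      using E_decreasing[of u "f s" "f u"] mono[OF s uI u(1)] f(2)[OF uI] u by auto
  qed
  have \<Phi>cont: "continuous_on {x..y} (\<Phi> t)" if "x \<in> I" "y \<in> I" for x y t
    unfolding \<Phi>_def
  proof (intro continuous_intros H_cont1)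
    show "continuous_on {x..y} F"
      using F Iiv[OF that] by (intro continuous_at_imp_continuous_on ballI DERIV_isCont) auto
  qed
  have P\<Phi>: "P = \<Phi> (f s) s - \<Phi> (f s) (f s)" if "s \<in> I" for s
    using P[OF that] by (simp add: \<Phi>_def)
  have down: "\<Phi> (f s) y \<le> \<Phi> (f s) x - \<eta> * (y - x)"
    if s: "s \<in> I" and xy: "s \<le> x" "x \<le> y" "y \<le> f s" and \<eta>: "\<And>u. x < u \<Longrightarrow> u < y \<Longrightarrow> E u (f s) - E u (f u) \<ge> \<eta>" for s x y \<eta>
  proof -
    have "\<Phi> (f s) y + \<eta> * (y - x) \<le> \<Phi> (f s) x + \<eta> * (x - x)"
    proof (rule DERIV_nonpos_imp_decreasing_open[where f = "\<lambda>u. \<Phi> (f s) u + \<eta> * (u - x)", OF xy(2)])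
      fix u assume u: "x < u" "u < y"
      then have "(\<Phi> (f s) has_real_derivative - E u (f s) + E u (f u)) (at u)" using main(1)[OF s, of u] xy by auto
      then show "\<exists>z. ((\<lambda>u. \<Phi> (f s) u + \<eta> * (u - x)) has_real_derivative z) (at u) \<and> z \<le> 0"
        using \<eta>[OF u] by (intro exI[of _ "- E u (f s) + E u (f u) + \<eta>"]) (auto intro!: derivative_eq_intros)
      have "x \<in> I" "y \<in> I" using Iiv[OF s f(1)[OF s]] xy by auto
    next
      have "x \<in> I" "y \<in> I" using Iiv[OF s f(1)[OF s]] xy by auto
      then show "continuous_on {x..y} (\<lambda>u. \<Phi> (f s) u + \<eta> * (u - x))" by (intro continuous_intros \<Phi>cont)
    qed
    then show ?thesis by simp
  qed
  show thesis
  proof (rule that[of P])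
    fix s assume s: "s \<in> I"
    have "\<Phi> (f s) (f s) < \<Phi> (f s) s"
    proof (rule DERIV_neg_imp_decreasing_open[where f = "\<Phi> (f s)"])
      show "s < f s" using f(2)[OF s] by simp
      show "continuous_on {s..f s} (\<Phi> (f s))" by (rule \<Phi>cont[OF s f(1)[OF s]])
      show "\<exists>y. (\<Phi> (f s) has_real_derivative y) (at x) \<and> y < 0" if "s < x" "x < f s" for x
        using main[OF s that] by (intro exI[of _ "- E x (f s) + E x (f x)"]) simp
    qed
    then have "0 < P" using P\<Phi>[OF s] by simp
    \<comment> \<open>The cosines are nonnegative, so dropping the integral can only increase the
      value: this is the bound of P by the length of the chord.\<close>
    moreover have "F s \<le> F (f s)"
    proof (rule DERIV_nonneg_imp_nondecreasing[where f = F])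
      show "s \<le> f s" using f(2)[OF s] by simp
      show "\<exists>y. (F has_real_derivative y) (at x) \<and> 0 \<le> y" if "s \<le> x" "x \<le> f s" for x
        using F E0 Iiv[OF s f(1)[OF s] that] by blast
    qed
    ultimately show "0 < P \<and> P \<le> H s (f s)" using P[OF s] by simp
  next
    fix s p q \<eta> assume s: "s \<in> I" and pq: "s < p" "p \<le> q" "q < f s"
      and \<eta>: "\<And>u. u \<in> {p..q} \<Longrightarrow> E u (f s) - E u (f u) \<ge> \<eta>"
    have "\<Phi> (f s) p \<le> \<Phi> (f s) s - 0 * (p - s)"
      by (rule down[OF s]) (use main(2)[OF s] pq in \<open>auto simp: less_imp_le\<close>)
    moreover have "\<Phi> (f s) q \<le> \<Phi> (f s) p - \<eta> * (q - p)"
      by (rule down[OF s]) (use \<eta> pq in auto)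
    moreover have "\<Phi> (f s) (f s) \<le> \<Phi> (f s) q - 0 * (f s - q)"
      by (rule down[OF s]) (use main(2)[OF s] pq in \<open>auto simp: less_imp_le\<close>)
    ultimately show "P \<ge> \<eta> * (q - p)" using P\<Phi>[OF s] by simp
  qed
qed

end

lemma approach_left:
  fixes a b :: real
  assumes "a < b"
  obtains x where "\<And>n. a < x n" "\<And>n. x n < b" "x \<longlonglongrightarrow> b"
proof -
  \<comment> \<open>With n + 1 in the denominator the first term would be a itself.\<close>
  define x where "x n = b - (b - a) / real (n + 2)" for n
  have "(\<lambda>n. (b - a) / real (n + 2)) \<longlonglongrightarrow> 0"
    by (rule LIMSEQ_ignore_initial_segment[OF lim_const_over_n])
  then have "(\<lambda>n. b - (b - a) / real (n + 2)) \<longlonglongrightarrow> b - 0" by (intro tendsto_intros)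
  moreover have "a < x n" for n
  proof -
    have "(b - a) / real (n + 2) < (b - a) / 1" by (rule divide_strict_left_mono) (use assms in auto)
    then show ?thesis by (simp add: x_def)
  qed
  moreover have "x n < b" for n using assms by (simp add: x_def)
  ultimately show ?thesis using that[of x] by (simp add: x_def[abs_def])
qed

section \<open>Maps of caustics and uniform bounds for the conserved quantity\<close>

context table
begin

text \<open>All that is kept of a caustic, so that sequences of different caustics can be treated as
  sequences of functions. The last clause says that two consecutive supporting chords do not go
  beyond one full turn; it makes the angles at most right angles.\<close>

definition caustic_map :: "(real \<Rightarrow> real) \<Rightarrow> bool" where
  "caustic_map f \<longleftrightarrow> (\<forall>s. s < f s \<and> f s < s + L) \<and> (\<forall>s t. s < t \<longrightarrow> f s < f t) \<and>
     (\<forall>s. isCont f s) \<and> surj f \<and> (\<forall>s. E (f s) (f (f s)) = - E (f s) s) \<and>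
     (\<forall>s. A (f s) (f (f s)) = A (f s) s) \<and> (\<forall>s. f (f s) \<le> s + L)"

lemma caustic_mapD:
  assumes "caustic_map f"
  shows "s < f s" "f s < s + L" "s < t \<Longrightarrow> f s < f t" "isCont f s" "surj f"
    "E (f s) (f (f s)) = - E (f s) s" "A (f s) (f (f s)) = A (f s) s" "f (f s) \<le> s + L"
  using assms unfolding caustic_map_def by blast+

text \<open>With s = f r the cosines towards f s and towards r are opposite numbers. As f s is at
  most r + L, the first is not the smaller one.\<close>

lemma caustic_map_E_nonneg:
  assumes "caustic_map f"
  shows "E s (f s) \<ge> 0"
proof -
  obtain r where r: "s = f r" using caustic_mapD(5)[OF assms] by (metis surjD)
  have "E (f r) (r + L) \<le> E (f r) (f (f r))"
    using caustic_mapD(1)[OF assms, of "f r"] caustic_mapD(1)[OF assms, of r] caustic_mapD(8)[OF assms, of r]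
    by (intro E_decreasing_le) auto
  then show ?thesis using caustic_mapD(6)[OF assms, of r] E_per(1)[of "f r" r] r by simp
qed

text \<open>The predecessor r of u lies before s, and E u (f u) = - E u r. The bound no longer
  involves the values of f.\<close>

lemma caustic_map_E_le:
  assumes "caustic_map f" "s < u" "u < f s"
  shows "E u (f u) \<le> - E u s"
proof -
  obtain r where r: "u = f r" using caustic_mapD(5)[OF assms(1)] by (metis surjD)
  have "r < s"
    using caustic_mapD(3)[OF assms(1), of s r] assms(3) r by (cases r s rule: linorder_cases) auto
  then have "E (f r) s \<le> E (f r) r"
    using caustic_mapD(2)[OF assms(1), of r] assms(2) r by (intro E_backward) auto
  then show ?thesis using caustic_mapD(6)[OF assms(1), of r] r by simp
qed

text \<open>In the second clause f occurs only through f s; this makes the lower bounds for P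
  uniform over all maps with f s in a given range.\<close>

definition potential_value :: "(real \<Rightarrow> real) \<Rightarrow> real \<Rightarrow> bool" where
  "potential_value f P \<longleftrightarrow> (\<forall>s. 0 < P \<and> P \<le> H s (f s)) \<and>
     (\<forall>s p q \<eta>. s < p \<and> p \<le> q \<and> q < f s \<and> (\<forall>u\<in>{p..q}. E u (f s) + E u s \<ge> \<eta>) \<longrightarrow> P \<ge> \<eta> * (q - p))"

lemma potential_value_exists:
  assumes f: "caustic_map f"
  shows "\<exists>P. potential_value f P"
proof -
  have I: "{s. (-\<infinity>) < ereal s \<and> ereal s < \<infinity>} = UNIV" by auto
  obtain P where P: "\<And>s. 0 < P \<and> P \<le> H s (f s)"
    "\<And>s p q \<eta>. s < p \<Longrightarrow> p \<le> q \<Longrightarrow> q < f s \<Longrightarrow>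
       (\<And>u. u \<in> {p..q} \<Longrightarrow> E u (f s) - E u (f u) \<ge> \<eta>) \<Longrightarrow> P \<ge> \<eta> * (q - p)"
    by (rule potential[of "-\<infinity>" "\<infinity>" f, unfolded I])
      (use caustic_mapD[OF f] caustic_map_E_nonneg[OF f] in auto)
  have "P \<ge> \<eta> * (q - p)"
    if a: "s < p \<and> p \<le> q \<and> q < f s \<and> (\<forall>u\<in>{p..q}. E u (f s) + E u s \<ge> \<eta>)" for s p q \<eta>
  proof (rule P(2))
    show "s < p" "p \<le> q" "q < f s" using a by auto
    show "E u (f s) - E u (f u) \<ge> \<eta>" if "u \<in> {p..q}" for u
    proof -
      have "\<eta> \<le> E u (f s) + E u s" using a that by blast
      moreover have "s < u" "u < f s" using a that by auto
      ultimately show ?thesis using caustic_map_E_le[OF f, of s u] by linarith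
    qed
  qed
  then show ?thesis using P(1) unfolding potential_value_def by blast
qed

text \<open>As u tends to t the first cosine tends to 1, and the second to E t s, which is greater
  than -1.\<close>

lemma E_near_end:
  assumes "s < t" "t < s + L"
  obtains u where "s < u" "u < t" "E u t + E u s > 0"
proof -
  obtain x where x: "\<And>n. s < x n" "\<And>n. x n < t" and lim: "x \<longlonglongrightarrow> t" using approach_left[OF assms(1)] by blast
  have 1: "(\<lambda>n. E (x n) t) \<longlonglongrightarrow> 1" by (rule diagonal_limits(2)[OF lim tendsto_const x(2)])
  have "isCont (\<lambda>z. E (fst z) (snd z)) (t, s)" by (rule E_continuous) (use assms in auto)
  from isCont_tendsto_compose[OF this tendsto_Pair[OF lim tendsto_const]]
  have 2: "(\<lambda>n. E (x n) s) \<longlonglongrightarrow> E t s" by simp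
  have "c t \<noteq> c s" using c_neq[of s t] assms by auto
  then have "0 < 1 + E t s" using E_bounds[of t s] by auto
  then have "\<forall>\<^sub>F n in sequentially. E (x n) t + E (x n) s > 0"
    using order_tendstoD(1)[OF tendsto_add[OF 1 2]] by blast
  then obtain n where "E (x n) t + E (x n) s > 0" using eventually_happens'[OF sequentially_bot] by blast
  then show ?thesis using that[of "x n"] x by blast
qed

text \<open>At one u between s and t the sum of the cosines is positive. By continuity it stays
  above half its value on a short interval around u and for all f s near t, whatever f is.\<close>

lemma potential_lower_local:
  assumes "s < t" "t < s + L"
  shows "\<exists>d>0. \<exists>\<eta>>0. \<forall>f P. potential_value f P \<and> \<bar>f s - t\<bar> < d \<longrightarrow> P \<ge> \<eta>"
proof -
  obtain u where u: "s < u" "u < t" "E u t + E u s > 0" using E_near_end[OF assms] .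
  define \<eta> where "\<eta> = (E u t + E u s) / 2"
  have \<eta>: "\<eta> > 0" using u by (simp add: \<eta>_def)
  have c1: "isCont (\<lambda>z. E (fst z) (snd z)) (u, t)" "isCont (\<lambda>z. E (fst z) (snd z)) (u, s)"
    by (rule E_continuous; use assms u in auto)+
  have ecd: "\<exists>d>0. \<forall>u' t'. \<bar>u' - u\<bar> < d \<and> \<bar>t' - t\<bar> < d \<longrightarrow> \<bar>E u' t' - E u t\<bar> < \<eta> / 2"
    if cont: "isCont (\<lambda>z. E (fst z) (snd z)) (u, t)" for t
  proof -
    obtain d where d: "d > 0" "\<And>z. dist z (u, t) < d \<Longrightarrow> dist (E (fst z) (snd z)) (E u t) < \<eta> / 2"
      using cont half_gt_zero[OF \<eta>] unfolding continuous_at_eps_delta by (metis fst_conv snd_conv)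
    have "\<bar>E u' t' - E u t\<bar> < \<eta> / 2" if "\<bar>u' - u\<bar> < d / 2" "\<bar>t' - t\<bar> < d / 2" for u' t'
    proof -
      have "dist (u', t') (u, t) \<le> \<bar>u' - u\<bar> + \<bar>t' - t\<bar>"
        using norm_Pair_le[of "u' - u" "t' - t"] by (simp add: dist_norm)
      then show ?thesis using d(2)[of "(u', t')"] that by (simp add: dist_real_def)
    qed
    then show ?thesis using d(1) by (intro exI[of _ "d / 2"]) auto
  qed
  obtain d1 where d1: "d1 > 0" "\<And>u' t'. \<bar>u' - u\<bar> < d1 \<Longrightarrow> \<bar>t' - t\<bar> < d1 \<Longrightarrow> \<bar>E u' t' - E u t\<bar> < \<eta> / 2"
    using ecd[OF c1(1)] by blast
  obtain d2 where d2: "d2 > 0" "\<And>u' t'. \<bar>u' - u\<bar> < d2 \<Longrightarrow> \<bar>t' - s\<bar> < d2 \<Longrightarrow> \<bar>E u' t' - E u s\<bar> < \<eta> / 2"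
    using ecd[OF c1(2)] by blast
  define d where "d = min (min d1 d2) (min ((u - s) / 2) ((t - u) / 2))"
  have d: "d > 0" "d \<le> d1" "d \<le> d2" "s + d < u" "u + d + d \<le> t"
  proof -
    show "d > 0" using d1(1) d2(1) u by (simp add: d_def)
    show "d \<le> d1" "d \<le> d2" by (auto simp: d_def)
    have "d \<le> (u - s) / 2" unfolding d_def by (intro min.coboundedI2 min.cobounded1)
    moreover have "d \<le> (t - u) / 2" unfolding d_def by (intro min.coboundedI2 min.cobounded2)
    ultimately have "2 * d \<le> u - s" "2 * d \<le> t - u" by simp_all
    then show "s + d < u" "u + d + d \<le> t" using u(1,2) \<open>d > 0\<close> by auto
  qed
  have "P \<ge> \<eta> * d" if f: "potential_value f P" "\<bar>f s - t\<bar> < d" for f P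
  proof -
    define p q where "p = u - d / 2" and "q = u + d / 2"
    have pq: "s < p" "p \<le> q" "q < f s" using d f(2) by (auto simp: p_def q_def)
    have "E u' (f s) + E u' s \<ge> \<eta>" if "u' \<in> {p..q}" for u'
    proof -
      have "\<bar>u' - u\<bar> < d" using that d(1) by (auto simp: p_def q_def)
      then have "\<bar>E u' (f s) - E u t\<bar> < \<eta> / 2" "\<bar>E u' s - E u s\<bar> < \<eta> / 2"
        using d1(2)[of u' "f s"] d2(2)[of u' s] d f(2) d2(1) by auto
      moreover have "E u t + E u s = 2 * \<eta>" by (simp add: \<eta>_def)
      ultimately show ?thesis by linarith
    qed
    then have "P \<ge> \<eta> * (q - p)" using f(1) pq unfolding potential_value_def by blast
    then show ?thesis by (simp add: p_def q_def)
  qed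
  then show ?thesis using d(1) \<eta> by (intro exI[of _ d] conjI exI[of _ "\<eta> * d"]) auto
qed

text \<open>Near s + L the chord from c s points backwards. Since caustic maps have nonnegative
  cosines, this keeps f s uniformly away from s + L.\<close>

lemma E_negative_end:
  obtains t where "s < t" "t < s + L" "E s t < 0"
proof -
  obtain x where x: "\<And>n. s < x n" "\<And>n. x n < s + L" and lim: "x \<longlonglongrightarrow> s + L"
    using approach_left[of s "s + L"] L_pos by auto
  have "(\<lambda>n. E (s + L) (x n)) \<longlonglongrightarrow> -1" by (rule diagonal_limits(3)[OF lim tendsto_const x(2)])
  then have "\<forall>\<^sub>F n in sequentially. E (s + L) (x n) < 0" by (rule order_tendstoD(2)) simp
  then obtain n where "E (s + L) (x n) < 0" using eventually_happens'[OF sequentially_bot] by blast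
  then show ?thesis using that[of "x n"] x E_per by auto
qed

text \<open>By \<open>E_negative_end\<close> the values f s at least s + \<epsilon> range over a
  compact interval, on which the local bounds have a positive minimum.\<close>

lemma potential_lower:
  assumes "\<epsilon> > 0"
  shows "\<exists>\<eta>>0. \<forall>f P. caustic_map f \<and> potential_value f P \<and> f s \<ge> s + \<epsilon> \<longrightarrow> P \<ge> \<eta>"
proof -
  obtain t0 where t0: "s < t0" "t0 < s + L" "E s t0 < 0" using E_negative_end .
  have fs: "f s < t0" if "caustic_map f" for f
  proof (rule ccontr)
    assume "\<not> f s < t0"
    then have "E s (f s) \<le> E s t0" using t0 caustic_mapD(2)[OF that] by (intro E_decreasing_le) auto
    then show False using caustic_map_E_nonneg[OF that, of s] t0 by simp
  qed
  show ?thesis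
  proof (cases "s + \<epsilon> \<le> t0")
    case False
    then have "\<not> (caustic_map f \<and> potential_value f P \<and> f s \<ge> s + \<epsilon>)" for f P using fs[of f] by auto
    then show ?thesis by (intro exI[of _ 1]) auto
  next
    case True
    have "\<exists>\<eta>>0. \<forall>f P. potential_value f P \<and> f s \<in> {s + \<epsilon>..t0} \<longrightarrow> P \<ge> \<eta>"
    proof (rule Bolzano[where P = "\<lambda>a b. \<exists>\<eta>>0. \<forall>f P. potential_value f P \<and> f s \<in> {a..b} \<longrightarrow> P \<ge> \<eta>", OF True])
      fix a b d
      assume "\<exists>\<eta>>0. \<forall>f P. potential_value f P \<and> f s \<in> {a..b} \<longrightarrow> P \<ge> \<eta>"
        "\<exists>\<eta>>0. \<forall>f P. potential_value f P \<and> f s \<in> {b..d} \<longrightarrow> P \<ge> \<eta>"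
      then obtain e1 e2 where e: "e1 > 0" "e2 > 0"
        "\<And>f P. potential_value f P \<and> f s \<in> {a..b} \<Longrightarrow> P \<ge> e1"
        "\<And>f P. potential_value f P \<and> f s \<in> {b..d} \<Longrightarrow> P \<ge> e2" by blast
      have "P \<ge> min e1 e2" if "potential_value f P" "f s \<in> {a..d}" for f P
        using e(3)[of f P] e(4)[of f P] that by (cases "f s \<le> b") auto
      then show "\<exists>\<eta>>0. \<forall>f P. potential_value f P \<and> f s \<in> {a..d} \<longrightarrow> P \<ge> \<eta>"
        using e(1,2) by (intro exI[of _ "min e1 e2"]) auto
    next
      fix x assume x: "s + \<epsilon> \<le> x" "x \<le> t0"
      then obtain d \<eta> where d: "d > 0" "\<eta> > 0" "\<And>f P. potential_value f P \<and> \<bar>f s - x\<bar> < d \<Longrightarrow> P \<ge> \<eta>"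
        using potential_lower_local[of s x] assms t0 by auto
      show "\<exists>d>0. \<forall>a b. a \<le> x \<and> x \<le> b \<and> b - a < d \<longrightarrow> (\<exists>\<eta>>0. \<forall>f P. potential_value f P \<and> f s \<in> {a..b} \<longrightarrow> P \<ge> \<eta>)"
      proof (rule exI[of _ d], intro conjI allI impI d(1))
        fix a b assume ab: "a \<le> x \<and> x \<le> b \<and> b - a < d"
        have "P \<ge> \<eta>" if "potential_value f P" "f s \<in> {a..b}" for f P
          by (rule d(3)[of f]) (use that ab in auto)
        then show "\<exists>\<eta>>0. \<forall>f P. potential_value f P \<and> f s \<in> {a..b} \<longrightarrow> P \<ge> \<eta>" using d(2) by blast
      qed
    qed
    then obtain \<eta> where \<eta>: "\<eta> > 0" "\<And>f P. potential_value f P \<Longrightarrow> f s \<in> {s + \<epsilon>..t0} \<Longrightarrow> P \<ge> \<eta>" by blast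
    have "P \<ge> \<eta>" if "caustic_map f" "potential_value f P" "f s \<ge> s + \<epsilon>" for f P
      using \<eta>(2)[OF that(2)] that(3) fs[OF that(1)] by auto
    then show ?thesis using \<eta>(1) by blast
  qed
qed

text \<open>The hypothesis is phrased with r - \<epsilon> and r + \<epsilon> so that it can be read
  off from one chord that cuts off c r from the rest of the boundary. It gives P at most the length
  of a short chord, and \<open>potential_lower\<close> carries this to every s.\<close>

lemma caustic_maps_collapse:
  assumes f: "\<And>n. caustic_map (f n)"
    and r: "\<And>\<epsilon>. \<epsilon> > 0 \<Longrightarrow> \<forall>\<^sub>F n in sequentially. f n (r - \<epsilon>) < r + \<epsilon>"
  shows "(\<lambda>n. f n s) \<longlonglongrightarrow> s"
proof -
  obtain P where P: "\<And>n. potential_value (f n) (P n)" using potential_value_exists[OF f] by metis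
  have P0: "\<forall>\<^sub>F n in sequentially. P n < \<eta>" if \<eta>: "\<eta> > 0" for \<eta>
  proof -
    have "isCont (\<lambda>z. H (fst z) (snd z)) (r, r)"
      using H_cont[of UNIV] by (simp add: continuous_on_eq_continuous_at)
    then obtain d where d: "d > 0" "\<And>z. dist z (r, r) < d \<Longrightarrow> dist (H (fst z) (snd z)) (H r r) < \<eta>"
      using \<eta> unfolding continuous_at_eps_delta by (metis fst_conv snd_conv)
    define e where "e = d / 3"
    have e: "e > 0" using d(1) by (simp add: e_def)
    show ?thesis using r[OF e]
    proof eventually_elim
      case (elim n)
      have "r - e < f n (r - e)" using caustic_mapD(1)[OF f] .
      then have "\<bar>f n (r - e) - r\<bar> < e" using elim by auto
      moreover have "dist (r - e, f n (r - e)) (r, r) \<le> \<bar>- e\<bar> + \<bar>f n (r - e) - r\<bar>"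
        using norm_Pair_le[of "- e" "f n (r - e) - r"] by (simp add: dist_norm)
      ultimately have "dist (r - e, f n (r - e)) (r, r) < d" using e d(1) by (simp add: e_def)
      then have "H (r - e) (f n (r - e)) < \<eta>" using d(2)[of "(r - e, f n (r - e))"] by (simp add: dist_real_def)
      then show ?case using P[of n] unfolding potential_value_def by (meson le_less_trans)
    qed
  qed
  show ?thesis
  proof (rule tendstoI)
    fix e :: real assume e: "e > 0"
    obtain \<eta> where \<eta>: "\<eta> > 0" "\<And>g Q. caustic_map g \<and> potential_value g Q \<and> g s \<ge> s + e \<Longrightarrow> Q \<ge> \<eta>"
      using potential_lower[OF e, of s] by blast
    show "\<forall>\<^sub>F n in sequentially. dist (f n s) s < e" using P0[OF \<eta>(1)]
    proof eventually_elim
      case (elim n)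
      then have "f n s < s + e" using \<eta>(2)[of "f n" "P n"] f P by force
      then show ?case using caustic_mapD(1)[OF f, of s n] by (simp add: dist_real_def)
    qed
  qed
qed

end

section \<open>The map defined by a caustic, and the exclusion of contact with the boundary\<close>

context caustic
begin

text \<open>Together with \<open>after_contact\<close> this characterises \<open>nxt s\<close> by
  strict inequalities, which survive small changes of s; hence the continuity of
  \<open>nxt\<close>.\<close>

lemma before_contact:
  assumes "c s \<notin> C" "T s t" "s < u" "u < t" "x \<in> C"
  shows "det3 (c s) (c u) x > 0"
proof (rule ccontr)
  assume n: "\<not> det3 (c s) (c u) x > 0"
  have "x \<in> K" "x \<noteq> c s" using assms C_K by auto
  then obtain w la nu where w: "s < w" "w < s + L" "la \<ge> 0" "nu > 0" "x = la *\<^sub>R c s + nu *\<^sub>R c w"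
    using ray_exit by metis
  have st: "t < s + L" using assms(2) by (simp add: T_def)
  have "det3 (c s) (c u) x = nu * det3 (c s) (c u) (c w)" unfolding w(5) by simp
  then have "det3 (c s) (c u) (c w) \<le> 0" using n w(4) by (simp add: not_less mult_le_0_iff)
  then have "w \<le> u" using chord_sign(1)[of s u w] assms st w(2) by fastforce
  then have "det3 (c s) (c t) (c w) < 0" using chord_sign(2)[of s t w] assms st w(1) by auto
  moreover have "det3 (c s) (c t) x = nu * det3 (c s) (c t) (c w)" unfolding w(5) by simp
  ultimately have "det3 (c s) (c t) x < 0" using w(4) by (simp add: mult_pos_neg)
  then show False using assms(2,5) unfolding T_def by (meson not_le)
qed

lemma after_contact:
  assumes "c s \<notin> C" "T s t" "t < u" "u < s + L"
  shows "\<exists>x\<in>C. det3 (c s) (c u) x < 0"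
proof -
  obtain la nu where l: "nu > 0" "la *\<^sub>R c s + nu *\<^sub>R c t \<in> C" using contact[OF assms(2)] assms(1) by metis
  have "det3 (c s) (c u) (c t) < 0" using chord_sign(2)[of s u t] assms by (auto simp: T_def)
  then show ?thesis using l by (intro bexI[OF _ l(2)]) (simp add: mult_pos_neg)
qed

definition nxt :: "real \<Rightarrow> real" where "nxt s = (THE t. T s t)"

lemma T_nxt: "c s \<notin> C \<Longrightarrow> T s (nxt s)"
  unfolding nxt_def by (rule theI') (use T_exists(1)[of s] T_unique[of s] in blast)

lemma nxt_eq: "c s \<notin> C \<Longrightarrow> T s t \<Longrightarrow> nxt s = t"
  using T_nxt T_unique by blast

lemma nxt_bounds: "c s \<notin> C \<Longrightarrow> s < nxt s" "c s \<notin> C \<Longrightarrow> nxt s < s + L"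
  using T_nxt unfolding T_def by blast+

text \<open>A single point of C to the right of a chord bounds the step from above. Besides
  continuity, this is how a caustic close to the boundary is seen to have a short step.\<close>

lemma nxt_less:
  assumes "c s \<notin> C" "s < u" "u < s + L" "x \<in> C" "det3 (c s) (c u) x < 0"
  shows "nxt s < u"
proof (rule ccontr)
  assume "\<not> nxt s < u"
  then consider "u < nxt s" | "u = nxt s" by linarith
  then show False
  proof cases
    case 1
    then show False using before_contact[OF assms(1) T_nxt[OF assms(1)] assms(2) _ assms(4)] assms(5) by auto
  next
    case 2
    then show False using T_nxt[OF assms(1)] assms(4,5) unfolding T_def by (metis not_le)
  qed
qed

lemma nxt_greater:
  assumes "c s \<notin> C" "s < u" "u < s + L" "\<And>x. x \<in> C \<Longrightarrow> det3 (c s) (c u) x > 0"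
  shows "u < nxt s"
proof (rule ccontr)
  assume "\<not> u < nxt s"
  then consider "nxt s < u" | "u = nxt s" by linarith
  then show False
  proof cases
    case 1
    then show False using after_contact[OF assms(1) T_nxt[OF assms(1)] _ assms(3)] assms(4) by fastforce
  next
    case 2
    then show False using T_nxt[OF assms(1)] assms(4) unfolding T_def by fastforce
  qed
qed

lemma isCont_nxt:
  assumes s: "c s \<notin> C"
  shows "isCont nxt s"
  unfolding isCont_def
proof (rule tendstoI)
  fix e :: real assume e: "e > 0"
  define t where "t = nxt s"
  have t: "s < t" "t < s + L" using nxt_bounds[OF s] by (auto simp: t_def)
  define h where "h = min e (min (t - s) (s + L - t)) / 2"
  have h: "h > 0" "h < e" "s < t - h" "t + h < s + L" 
  proof -
    show "h > 0" using e t by (simp add: h_def)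
    have "h \<le> e / 2" "h \<le> (t - s) / 2" "h \<le> (s + L - t) / 2" by (auto simp: h_def)
    then have "2 * h \<le> e" "2 * h \<le> t - s" "2 * h \<le> s + L - t" by simp_all
    then show "h < e" "s < t - h" "t + h < s + L" using \<open>h > 0\<close> by simp_all
  qed
  have cont: "continuous_on C (\<lambda>x. det3 (c s) (c (t - h)) x)" by (intro continuous_intros)
  obtain x1 where x1: "x1 \<in> C" "\<And>x. x \<in> C \<Longrightarrow> det3 (c s) (c (t - h)) x1 \<le> det3 (c s) (c (t - h)) x"
    using continuous_attains_inf[OF C_compact C_nonempty cont] by blast
  define \<eta> where "\<eta> = det3 (c s) (c (t - h)) x1"
  have \<eta>: "\<eta> > 0" unfolding \<eta>_def by (rule before_contact[OF s T_nxt[OF s]]) (use h x1 t_def in auto)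
  have "bounded ((\<lambda>x. cross3 (c (t - h)) x) ` C)"
    by (intro compact_imp_bounded compact_continuous_image C_compact continuous_on_cross continuous_intros)
  \<comment> \<open>Replacing c s by c r changes the determinant by at most B times the distance of
    c r and c s, for all x in C at once.\<close>
  then obtain B where B: "B > 0" "\<And>x. x \<in> C \<Longrightarrow> norm (cross3 (c (t - h)) x) \<le> B"
    unfolding bounded_pos by auto
  obtain x2 where x2: "x2 \<in> C" "det3 (c s) (c (t + h)) x2 < 0"
    using after_contact[OF s T_nxt[OF s], of "t + h"] h t_def by auto
  have tc: "(c \<longlongrightarrow> c s) (at s)" using isCont_c by (simp add: isCont_def)
  have "((\<lambda>r. norm (c r - c s) * B) \<longlongrightarrow> norm (c s - c s) * B) (at s)" by (intro tendsto_intros tc)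
  then have 1: "\<forall>\<^sub>F r in at s. norm (c r - c s) * B < \<eta>" using \<eta> by (auto dest: order_tendstoD)
  have "((\<lambda>r. det3 (c r) (c (t + h)) x2) \<longlongrightarrow> det3 (c s) (c (t + h)) x2) (at s)" by (intro tendsto_intros tc)
  then have 2: "\<forall>\<^sub>F r in at s. det3 (c r) (c (t + h)) x2 < 0" using x2(2) by (rule order_tendstoD)
  have 3: "\<forall>\<^sub>F r in at s. c r \<in> - C"
    by (rule topological_tendstoD[OF tc]) (use C_compact s in \<open>auto simp: compact_imp_closed open_Compl\<close>)
  have 4: "\<forall>\<^sub>F r in at s. r < t - h" "\<forall>\<^sub>F r in at s. r > t + h - L"
    using order_tendstoD[OF tendsto_ident_at[of s UNIV]] h by auto
  show "\<forall>\<^sub>F r in at s. dist (nxt r) (nxt s) < e" using 1 2 3 4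
  proof eventually_elim
    case (elim r)
    have r: "c r \<notin> C" using elim by simp
    have "t - h < nxt r"
    proof (rule nxt_greater[OF r])
      fix x assume x: "x \<in> C"
      have "\<bar>(c r - c s) \<bullet> cross3 (c (t - h)) x\<bar> \<le> norm (c r - c s) * norm (cross3 (c (t - h)) x)"
        by (rule Cauchy_Schwarz_ineq2)
      also have "\<dots> \<le> norm (c r - c s) * B" using B(2)[OF x] by (intro mult_left_mono) auto
      finally have "\<bar>det3 (c r) (c (t - h)) x - det3 (c s) (c (t - h)) x\<bar> < \<eta>"
        using elim(1) by (simp add: det3_def inner_diff_left)
      then show "det3 (c r) (c (t - h)) x > 0" using x1(2)[OF x] unfolding \<eta>_def by linarith
    qed (use elim h in auto)
    moreover have "nxt r < t + h"
      by (rule nxt_less[OF r _ _ x2(1)]) (use elim h in auto)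
    ultimately show ?case using h unfolding t_def[symmetric] by (simp add: dist_real_def)
  qed
qed

lemma caustic_map_nxt:
  assumes out: "\<And>s. c s \<notin> C"
  shows "caustic_map nxt"
proof -
  have T: "T s (nxt s)" for s using T_nxt out by blast
  have mono: "nxt s < nxt t" if "s < t" for s t
  proof (cases "t < nxt s")
    case True
    then show ?thesis using T_mono(2)[OF T T, of s t] that out by auto
  next
    case False
    then show ?thesis using nxt_bounds(1)[OF out, of t] by simp
  qed
  have "surj nxt"
  proof (rule surjI[of _ "\<lambda>t. SOME r. T r t"])
    fix t
    have "T (SOME r. T r t) t" using T_exists(2)[OF out, of t] by (rule someI_ex)
    then show "nxt (SOME r. T r t) = t" using nxt_eq out by blast
  qed
  moreover have "nxt (nxt s) \<le> s + L" for s
  proof (rule ccontr)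
    \<comment> \<open>Otherwise c (s + L) = c s is strictly to the right of the second chord, and so
      is the contact point of the first one, which is a combination of c s and c (nxt s) with
      positive weight at c s.\<close>
    assume n: "\<not> nxt (nxt s) \<le> s + L"
    obtain la nu where l: "la > 0" "la *\<^sub>R c s + nu *\<^sub>R c (nxt s) \<in> C" using contact[OF T[of s]] out by metis
    have "det3 (c (nxt s)) (c (nxt (nxt s))) (c (s + L)) < 0"
      using chord_sign(2)[of "nxt s" "nxt (nxt s)" "s + L"] nxt_bounds[OF out] n by auto
    then have "la * det3 (c (nxt s)) (c (nxt (nxt s))) (c s) < 0" using l(1) per by (simp add: mult_pos_neg)
    then have "det3 (c (nxt s)) (c (nxt (nxt s))) (la *\<^sub>R c s + nu *\<^sub>R c (nxt s)) < 0" by simp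
    then show False using T[of "nxt s"] l(2) unfolding T_def by (meson not_le)
  qed
  ultimately show ?thesis unfolding caustic_map_def
    using nxt_bounds[OF out] mono isCont_nxt[OF out] reflection[OF out T T] by blast
qed

text \<open>The ends of the arc belong to C and cannot lie to the right of a supporting chord, so
  chords from the arc do not jump over them. Once they are known to end strictly inside,
  \<open>potential\<close> applies to the open arc, with steps that shrink to zero at b.\<close>

lemma no_free_arc:
  assumes ab: "a < b" "b \<le> a + L" and ends: "c a \<in> C" "c b \<in> C"
    and free: "\<And>t. a < t \<Longrightarrow> t < b \<Longrightarrow> c t \<notin> C"
  shows False
proof -
  have T: "T s (nxt s)" if "a < s" "s < b" for s using T_nxt free that by blast
  have le_b: "t \<le> b" if "T s t" "a < s" "s < b" for s t
  proof (rule ccontr)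
    assume "\<not> t \<le> b"
    then have "det3 (c s) (c t) (c b) < 0" using chord_sign(2)[of s t b] that by (auto simp: T_def)
    then show False using that(1) ends unfolding T_def by (meson not_le)
  qed
  have ge_a: "r \<ge> a" if "T r s" "a < s" "s < b" for r s
  proof (rule ccontr)
    assume "\<not> r \<ge> a"
    then have "det3 (c r) (c s) (c a) < 0" using chord_sign(2)[of r s a] that by (auto simp: T_def)
    then show False using that(1) ends unfolding T_def by (meson not_le)
  qed
  \<comment> \<open>If nxt s = b, every u between s and b is also sent to b, its predecessor is at
    most s, and the reflection law gives E u b + E u s \<le> 0, against
    \<open>E_near_end\<close>.\<close>
  have mid: "nxt s < b" if s: "a < s" "s < b" for s
  proof (rule ccontr)
    assume "\<not> nxt s < b"
    then have sb: "nxt s = b" using le_b[OF T[OF s] s] by simp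
    have Eu: "E u b + E u s \<le> 0" if u: "s < u" "u < b" for u
    proof -
      have ub: "nxt u = b"
        using T_mono(1)[OF T[OF s] T[of u], of ] u s free[of u] sb le_b[OF T[of u]] by auto
      obtain r where r: "T r u" using T_exists(2)[of u] free[of u] u s by auto
      have "r \<le> s"
      proof (rule ccontr)
        assume "\<not> r \<le> s"
        then have rs: "s < r" "r < u" using r by (auto simp: T_def)
        have "nxt r = b"
          using T_mono(1)[OF T[OF s] T[of r], of ] rs u s free[of r] sb le_b[OF T[of r]] by auto
        moreover have "nxt r = u" using nxt_eq[of r u] free[of r] r rs u s by auto
        ultimately show False using u by simp
      qed
      then have "E u s \<le> E u r" using r u by (intro E_backward) (auto simp: T_def)
      moreover have "E u b = - E u r" using reflection(1)[of u b r] free[of u] T[of u] ub r u s by auto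
      ultimately show ?thesis by simp
    qed
    obtain u where "s < u" "u < b" "E u b + E u s > 0" using E_near_end[of s b] s ab by auto
    then show False using Eu by fastforce
  qed
  define I where "I = {s. ereal a < ereal s \<and> ereal s < ereal b}"
  have I: "s \<in> I \<longleftrightarrow> a < s \<and> s < b" for s by (simp add: I_def)
  have TI: "T s (nxt s)" if "s \<in> I" for s using T that I by blast
  have nI: "nxt s \<in> I" if "s \<in> I" for s using mid[of s] TI[OF that] that by (auto simp: I T_def)
  have out: "c s \<notin> C" if "s \<in> I" for s using free that I by blast
  have mono: "nxt s < nxt t" if "s \<in> I" "t \<in> I" "s < t" for s t
  proof (cases "t < nxt s")
    case True
    then show ?thesis using T_mono(2)[OF TI TI, of s t] that out nI by auto
  next
    case False
    then show ?thesis using nxt_bounds(1)[OF out[OF that(2)]] by simp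
  qed
  have E0: "E s (nxt s) \<ge> 0" if s: "s \<in> I" for s
  proof -
    obtain r where r: "T r s" using T_exists(2)[OF out[OF s]] by blast
    \<comment> \<open>b \<le> a + L and a \<le> r put r + L beyond nxt s.\<close>
    have "E s (r + L) \<le> E s (nxt s)"
      using nI[OF s] ge_a[OF r] s ab r nxt_bounds(1)[OF out[OF s]] by (intro E_decreasing_le) (auto simp: I T_def)
    then show ?thesis using reflection(1)[OF out[OF s] TI[OF s] r] E_per by simp
  qed
  have "ereal a < ereal b" using ab by simp
  then obtain P where P: "\<And>s. s \<in> I \<Longrightarrow> 0 < P \<and> P \<le> H s (nxt s)"
    by (rule potential[of "ereal a" "ereal b" nxt, folded I_def])
      (use nI nxt_bounds out mono isCont_nxt reflection(1) TI E0 in \<open>auto\<close>)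
  obtain x where x: "\<And>n. a < x n" "\<And>n. x n < b" and lim: "x \<longlonglongrightarrow> b" using approach_left[OF ab(1)] by blast
  have xI: "x n \<in> I" for n using x by (simp add: I)
  have lim2: "(\<lambda>n. nxt (x n)) \<longlonglongrightarrow> b"
    by (rule real_tendsto_sandwich[OF _ _ lim tendsto_const])
      (use nxt_bounds(1)[OF out[OF xI]] nI[OF xI] in \<open>auto simp: I less_imp_le\<close>)
  have "isCont (\<lambda>z. H (fst z) (snd z)) (b, b)"
    using H_cont[of UNIV] by (simp add: continuous_on_eq_continuous_at)
  from isCont_tendsto_compose[OF this tendsto_Pair[OF lim lim2]]
  have "(\<lambda>n. H (x n) (nxt (x n))) \<longlonglongrightarrow> 0" by simp
  then have "P \<le> 0" by (rule LIMSEQ_le_const) (use P xI in auto)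
  then show False using P[OF xI[of 0]] by simp
qed

text \<open>The contact parameters closest to s on its two sides bound a free arc; they exist
  because the contact set is closed and periodic. As b - L is itself a contact parameter before s,
  the arc is at most one period long.\<close>

lemma touching_impossible:
  assumes "c s \<notin> C"
  shows "c t \<notin> C"
proof
  assume t: "c t \<in> C"
  have cl: "closed {t. c t \<in> C}"
    using closed_vimage[OF compact_imp_closed[OF C_compact] c_cont[of UNIV]] by (simp add: vimage_def)
  define B where "B = {s..s + L} \<inter> {t. c t \<in> C}"
  define A' where "A' = {s - L..s} \<inter> {t. c t \<in> C}"
  have comp: "compact B" "compact A'" unfolding B_def A'_def by (intro compact_Int_closed compact_Icc cl)+
  obtain n where n: "t - of_int n * L \<in> {s..<s + L}" using shift_to_period .
  have "c (t - of_int n * L) = c t" using per_int[of "t - of_int n * L" n] by simp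
  then have "t - of_int n * L \<in> B" using n t by (auto simp: B_def)
  then obtain b where b: "b \<in> B" "\<And>y. y \<in> B \<Longrightarrow> b \<le> y" using compact_attains_inf[OF comp(1)] by blast
  have "c (b - L) = c b" using per[of "b - L"] by simp
  then have "b - L \<in> A'" using b(1) by (auto simp: A'_def B_def)
  then obtain a where a: "a \<in> A'" "\<And>y. y \<in> A' \<Longrightarrow> y \<le> a" using compact_attains_sup[OF comp(2)] by blast
  have "a \<noteq> s" "b \<noteq> s" using a(1) b(1) assms by (auto simp: A'_def B_def)
  then have ab: "a < s" "s < b" "s - L \<le> a" "b \<le> s + L" "c a \<in> C" "c b \<in> C"
    using a(1) b(1) by (auto simp: A'_def B_def)
  have "b - L \<le> a" using a(2)[OF \<open>b - L \<in> A'\<close>] .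
  moreover have "c r \<notin> C" if "a < r" "r < b" for r
    using a(2)[of r] b(2)[of r] that ab by (force simp: A'_def B_def)
  ultimately show False using no_free_arc[of a b] ab by auto
qed

end

section \<open>Asymptotics of steps near a jump of the curvature\<close>

text \<open>
  The orbits of s and y n interlace, and the first N steps of each are asymptotically equal among
  themselves; so the ratio of the two step lengths is asymptotically between (N - 1) / N and
  (N + 1) / N.
\<close>
lemma step_ratio_tendsto_1:
  fixes A :: "real \<Rightarrow> real \<Rightarrow> real" and f :: "nat \<Rightarrow> real \<Rightarrow> real"
  assumes k: "k > 0"
    and est: "\<And>u v. (\<And>n. s \<le> u n) \<Longrightarrow> (\<And>n. u n < v n) \<Longrightarrow> v \<longlonglongrightarrow> s \<Longrightarrow>
       (\<lambda>n. A (u n) (v n) / (v n - u n)) \<longlonglongrightarrow> k \<and> (\<lambda>n. A (v n) (u n) / (v n - u n)) \<longlonglongrightarrow> k"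
    and up: "\<And>n x. x < f n x" and mono: "\<And>n x y. x < y \<Longrightarrow> f n x < f n y"
    and refl: "\<And>n x. A (f n x) (f n (f n x)) = A (f n x) x"
    and collapse: "\<And>x. (\<lambda>n. f n x) \<longlonglongrightarrow> x"
    and y: "\<And>n. s \<le> y n" "\<And>n. y n \<le> f n s"
  shows "(\<lambda>n. (f n (y n) - y n) / (f n s - s)) \<longlonglongrightarrow> 1"
proof -
  have mono': "f n x \<le> f n y" if "x \<le> y" for n x y using mono[of x y n] that by (cases "x = y") auto
  \<comment> \<open>Convergence is given only at fixed points; monotonicity of f n extends it to
    moving arguments.\<close>
  have img: "(\<lambda>n. f n (z n)) \<longlonglongrightarrow> s" if z: "\<And>n. s \<le> z n" "z \<longlonglongrightarrow> s" for z
  proof (rule tendstoI)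
    fix e :: real assume e: "e > 0"
    have "\<forall>\<^sub>F n in sequentially. z n < s + e / 2" using order_tendstoD(2)[OF z(2)] e by simp
    moreover have "\<forall>\<^sub>F n in sequentially. f n (s + e / 2) < s + e"
      using order_tendstoD(2)[OF collapse] e by simp
    ultimately show "\<forall>\<^sub>F n in sequentially. dist (f n (z n)) s < e"
    proof eventually_elim
      case (elim n)
      then show ?case using mono[of "z n" "s + e / 2" n] up[of "z n" n] z(1)[of n] by (simp add: dist_real_def)
    qed
  qed
  have it: "(\<forall>n. s \<le> (f n ^^ j) (z n)) \<and> (\<lambda>n. (f n ^^ j) (z n)) \<longlonglongrightarrow> s"
    if z: "\<And>n. s \<le> z n" "z \<longlonglongrightarrow> s" for z j
  proof (induction j)
    case 0 then show ?case using z by simp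
  next
    case (Suc j)
    have "s \<le> f n ((f n ^^ j) (z n))" for n using spec[OF conjunct1[OF Suc], of n] up[of "(f n ^^ j) (z n)" n] by simp
    then show ?case using img[of "\<lambda>n. (f n ^^ j) (z n)"] Suc by simp
  qed
  \<comment> \<open>Two consecutive steps make equal angles at their common vertex, and each angle
    is asymptotic to k times the step.\<close>
  have one: "(\<lambda>n. (f n (f n (z n)) - f n (z n)) / (f n (z n) - z n)) \<longlonglongrightarrow> 1"
    if z: "\<And>n. s \<le> z n" "z \<longlonglongrightarrow> s" for z
  proof -
    have z1: "s \<le> f n (z n)" for n using z(1)[of n] up[of "z n" n] by simp
    have l: "(\<lambda>n. A (f n (z n)) (z n) / (f n (z n) - z n)) \<longlonglongrightarrow> k"
      using est[of z "\<lambda>n. f n (z n)"] z(1) up img[OF z] by auto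
    have l': "(\<lambda>n. A (f n (z n)) (f n (f n (z n))) / (f n (f n (z n)) - f n (z n))) \<longlonglongrightarrow> k"
      using est[of "\<lambda>n. f n (z n)" "\<lambda>n. f n (f n (z n))"] z1 up img[of "\<lambda>n. f n (z n)", OF z1 img[OF z]] by auto
    have "(\<lambda>n. (A (f n (z n)) (z n) / (f n (z n) - z n)) /
         (A (f n (z n)) (f n (f n (z n))) / (f n (f n (z n)) - f n (z n)))) \<longlonglongrightarrow> k / k"
      using k by (intro tendsto_divide l l') auto
    moreover have "\<forall>\<^sub>F n in sequentially. (A (f n (z n)) (z n) / (f n (z n) - z n)) /
         (A (f n (z n)) (f n (f n (z n))) / (f n (f n (z n)) - f n (z n)))
         = (f n (f n (z n)) - f n (z n)) / (f n (z n) - z n)"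
      using order_tendstoD(1)[OF l k]
    proof eventually_elim
      case (elim n)
      then have "A (f n (z n)) (z n) \<noteq> 0" by auto
      then show ?case using up[of "z n" n] up[of "f n (z n)" n] by (simp add: refl)
    qed
    ultimately show ?thesis using k by (auto intro: Lim_transform_eventually)
  qed
  have steps: "(\<lambda>n. ((f n ^^ Suc j) (z n) - (f n ^^ j) (z n)) / (f n (z n) - z n)) \<longlonglongrightarrow> 1"
    if z: "\<And>n. s \<le> z n" "z \<longlonglongrightarrow> s" for z j
  proof (induction j)
    case 0
    have "f n (z n) - z n \<noteq> 0" for n using up[of "z n" n] by simp
    then show ?case by simp
  next
    case (Suc j)
    define w where "w n = (f n ^^ j) (z n)" for n
    have w: "\<And>n. s \<le> w n" "w \<longlonglongrightarrow> s" using it[OF z, of j] unfolding w_def[abs_def] by auto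
    have "(\<lambda>n. (f n (f n (w n)) - f n (w n)) / (f n (w n) - w n) * ((f n (w n) - w n) / (f n (z n) - z n))) \<longlonglongrightarrow> 1 * 1"
      by (intro tendsto_mult one[OF w]) (use Suc in \<open>simp add: w_def\<close>)
    moreover have "(f n (f n (w n)) - f n (w n)) / (f n (w n) - w n) * ((f n (w n) - w n) / (f n (z n) - z n))
        = (f n (f n (w n)) - f n (w n)) / (f n (z n) - z n)" for n
      using up[of "w n" n] by simp
    ultimately have "(\<lambda>n. (f n (f n (w n)) - f n (w n)) / (f n (z n) - z n)) \<longlonglongrightarrow> 1"
      by (simp only: mult_1)
    then show ?case by (simp add: w_def)
  qed
  have total: "(\<lambda>n. ((f n ^^ N) (z n) - z n) / (f n (z n) - z n)) \<longlonglongrightarrow> real N"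
    if z: "\<And>n. s \<le> z n" "z \<longlonglongrightarrow> s" for z N
  proof (induction N)
    case 0 then show ?case by simp
  next
    case (Suc N)
    from tendsto_add[OF Suc steps[OF z, of N]]
    show ?case by (simp add: add_divide_distrib[symmetric] add.commute)
  qed
  define X where "X n = f n s - s" for n
  define Y where "Y n = f n (y n) - y n" for n
  have XY: "X n > 0" "Y n > 0" for n using up[of s n] up[of "y n" n] by (auto simp: X_def Y_def)
  have yl: "y \<longlonglongrightarrow> s" by (rule real_tendsto_sandwich[OF _ _ tendsto_const collapse]) (use y in auto)
  have fm: "(f n ^^ N) x \<le> (f n ^^ N) z" if "x \<le> z" for n N x z
    using that by (induction N) (auto intro: mono')
  have fsw: "(f n ^^ N) (f n s) = (f n ^^ Suc N) s" for n N by (simp add: funpow_swap1)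
  have "\<forall>\<^sub>F n in sequentially. \<bar>Y n / X n - 1\<bar> < e" if e: "e > 0" for e
  proof -
    obtain N0 where N0: "1 / real (Suc N0) < e" using nat_approx_posE[OF e] by blast
    define N where "N = Suc N0"
    have N: "real N > 0" "1 / real N < e" using N0 by (auto simp: N_def)
    \<comment> \<open>U comes from (f n ^^ N) (y n) \<le> (f n ^^ Suc N) s, and V from (f n ^^ N) s
      \<le> (f n ^^ N) (y n) with y n \<le> f n s. The limits are (N + 1) / N and (N - 1) /
      N.\<close>
    define U where "U n = ((f n ^^ Suc N) s - s) / X n / (((f n ^^ N) (y n) - y n) / Y n)" for n
    define V where "V n = (((f n ^^ N) s - s) / X n - 1) / (((f n ^^ N) (y n) - y n) / Y n)" for n
    have Ty: "(\<lambda>n. ((f n ^^ N) (y n) - y n) / Y n) \<longlonglongrightarrow> real N"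
      using total[OF y(1) yl, of N] by (simp add: Y_def)
    have Tx: "(\<lambda>n. ((f n ^^ M) s - s) / X n) \<longlonglongrightarrow> real M" for M
      using total[of "\<lambda>_. s" M] by (simp add: X_def)
    have "U \<longlonglongrightarrow> real (Suc N) / real N" unfolding U_def by (intro tendsto_divide Tx Ty) (use N in auto)
    moreover have "real (Suc N) / real N < 1 + e" using N by (simp add: field_simps)
    ultimately have 1: "\<forall>\<^sub>F n in sequentially. U n < 1 + e" by (rule order_tendstoD)
    have "V \<longlonglongrightarrow> (real N - 1) / real N"
      unfolding V_def by (intro tendsto_divide tendsto_diff Tx Ty tendsto_const) (use N in auto)
    moreover have "1 - e < (real N - 1) / real N" using N by (simp add: field_simps)
    ultimately have 2: "\<forall>\<^sub>F n in sequentially. 1 - e < V n" by (rule order_tendstoD)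
    have 3: "\<forall>\<^sub>F n in sequentially. ((f n ^^ N) (y n) - y n) / Y n > 0"
      using order_tendstoD(1)[OF Ty N(1)] .
    show ?thesis using 1 2 3
    proof eventually_elim
      case (elim n)
      define S where "S = ((f n ^^ N) (y n) - y n) / Y n"
      have S: "S > 0" "(f n ^^ N) (y n) - y n = S * Y n" using elim XY[of n] by (auto simp: S_def)
      have "(f n ^^ N) (y n) \<le> (f n ^^ Suc N) s" using fm[OF y(2)[of n], of N n] fsw by simp
      then have "S * Y n \<le> (f n ^^ Suc N) s - s" using y(1)[of n] S(2) by linarith
      then have "S * (Y n / X n) \<le> ((f n ^^ Suc N) s - s) / X n"
        using XY[of n] by (simp add: divide_right_mono)
      then have "Y n / X n \<le> U n" unfolding U_def S_def[symmetric] pos_le_divide_eq[OF S(1)] by (simp only: mult.commute[of S])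
      moreover have "(f n ^^ N) s \<le> (f n ^^ N) (y n)" by (rule fm[OF y(1)])
      then have "((f n ^^ N) s - s) - X n \<le> S * Y n" using y(2)[of n] S(2) by (simp add: X_def)
      then have "(((f n ^^ N) s - s) - X n) / X n \<le> S * (Y n / X n)"
        using XY[of n] by (simp add: divide_right_mono)
      then have "((f n ^^ N) s - s) / X n - 1 \<le> S * (Y n / X n)"
        using XY[of n] by (simp add: diff_divide_distrib)
      then have "V n \<le> Y n / X n" unfolding V_def S_def[symmetric] pos_divide_le_eq[OF S(1)] by (simp only: mult.commute[of S])
      ultimately show ?case using elim by (simp add: abs_less_iff)
    qed
  qed
  then have "(\<lambda>n. Y n / X n) \<longlonglongrightarrow> 1" by (auto simp: tendsto_iff dist_real_def)
  then show ?thesis by (simp add: X_def Y_def)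
qed

context table
begin

text \<open>A = D / R, where the height D is about k h^2 / 2 and R is about h for a chord of length
  h.\<close>

lemma A_limit:
  assumes u: "u \<longlonglongrightarrow> s" "w \<longlonglongrightarrow> s" "\<And>n. u n < w n"
    and est: "\<And>e. e > 0 \<Longrightarrow> \<forall>\<^sub>F n in sequentially.
       \<bar>D (u n) (w n) - k / 2 * (w n - u n)\<^sup>2\<bar> \<le> e * (w n - u n)\<^sup>2 \<and>
       \<bar>D (w n) (u n) - k / 2 * (w n - u n)\<^sup>2\<bar> \<le> e * (w n - u n)\<^sup>2"
  shows "(\<lambda>n. A (u n) (w n) / (w n - u n)) \<longlonglongrightarrow> k / 2 \<and> (\<lambda>n. A (w n) (u n) / (w n - u n)) \<longlonglongrightarrow> k / 2"
proof -
  have R1: "(\<lambda>n. R (u n) (w n) / (w n - u n)) \<longlonglongrightarrow> 1" by (rule diagonal_limits(1)[OF u])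
  have D1: "(\<lambda>n. D (u n) (w n) / (w n - u n)\<^sup>2) \<longlonglongrightarrow> k / 2 \<and> (\<lambda>n. D (w n) (u n) / (w n - u n)\<^sup>2) \<longlonglongrightarrow> k / 2"
    unfolding tendsto_iff dist_real_def
  proof (intro conjI allI impI)
    fix e :: real assume e: "e > 0"
    have ev: "\<forall>\<^sub>F n in sequentially. \<bar>D (u n) (w n) / (w n - u n)\<^sup>2 - k / 2\<bar> < e \<and>
        \<bar>D (w n) (u n) / (w n - u n)\<^sup>2 - k / 2\<bar> < e"
      using est[OF half_gt_zero[OF e]]
    proof eventually_elim
      case (elim n)
      have h: "(w n - u n)\<^sup>2 > 0" using u(3)[of n] by simp
      have conv: "\<bar>x / (w n - u n)\<^sup>2 - k / 2\<bar> < e" if "\<bar>x - k / 2 * (w n - u n)\<^sup>2\<bar> \<le> e / 2 * (w n - u n)\<^sup>2" for x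
      proof -
        have "x / (w n - u n)\<^sup>2 - k / 2 = (x - k / 2 * (w n - u n)\<^sup>2) / (w n - u n)\<^sup>2"
          using h u(3)[of n] by (simp add: diff_divide_distrib)
        then have "\<bar>x / (w n - u n)\<^sup>2 - k / 2\<bar> = \<bar>x - k / 2 * (w n - u n)\<^sup>2\<bar> / (w n - u n)\<^sup>2"
          by (simp add: abs_divide)
        also have "\<dots> \<le> e / 2" using that h by (simp only: pos_divide_le_eq)
        finally show ?thesis using e by simp
      qed
      show ?case using elim by (intro conjI conv) auto
    qed
    then show "\<forall>\<^sub>F n in sequentially. \<bar>D (u n) (w n) / (w n - u n)\<^sup>2 - k / 2\<bar> < e"
      "\<forall>\<^sub>F n in sequentially. \<bar>D (w n) (u n) / (w n - u n)\<^sup>2 - k / 2\<bar> < e"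
      by (auto elim: eventually_mono)
  qed
  have "A (u n) (w n) / (w n - u n) = (D (u n) (w n) / (w n - u n)\<^sup>2) / (R (u n) (w n) / (w n - u n))"
    "A (w n) (u n) / (w n - u n) = (D (w n) (u n) / (w n - u n)\<^sup>2) / (R (u n) (w n) / (w n - u n))" for n
    using u(3)[of n] by (simp_all add: A_def R_commute[of "w n"] power2_eq_square)
  moreover have "(\<lambda>n. (D (u n) (w n) / (w n - u n)\<^sup>2) / (R (u n) (w n) / (w n - u n))) \<longlonglongrightarrow> k / 2 / 1"
    by (rule tendsto_divide[OF conjunct1[OF D1] R1]) simp
  moreover have "(\<lambda>n. (D (w n) (u n) / (w n - u n)\<^sup>2) / (R (u n) (w n) / (w n - u n))) \<longlonglongrightarrow> k / 2 / 1"
    by (rule tendsto_divide[OF conjunct2[OF D1] R1]) simp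
  ultimately show ?thesis by simp
qed

lemma A_right_limit:
  assumes k: "two_sided_curvature s kl kr" and u: "\<And>n. s \<le> u n" "\<And>n. u n < w n" "w \<longlonglongrightarrow> s"
  shows "(\<lambda>n. A (u n) (w n) / (w n - u n)) \<longlonglongrightarrow> kr / 2 \<and> (\<lambda>n. A (w n) (u n) / (w n - u n)) \<longlonglongrightarrow> kr / 2"
proof (rule A_limit[OF _ u(3,2)])
  show "u \<longlonglongrightarrow> s"
    by (rule real_tendsto_sandwich[OF _ _ tendsto_const u(3)]) (use u(1,2) in \<open>auto simp: less_imp_le\<close>)
  fix e :: real assume "e > 0"
  then obtain d where d: "d > 0" "\<And>u w. s \<le> u \<and> u \<le> w \<and> w \<le> s + d \<Longrightarrow>
     \<bar>D u w - kr / 2 * (w - u)\<^sup>2\<bar> \<le> e * (w - u)\<^sup>2 \<and> \<bar>D w u - kr / 2 * (w - u)\<^sup>2\<bar> \<le> e * (w - u)\<^sup>2"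
    using k unfolding two_sided_curvature_def by metis
  have "\<forall>\<^sub>F n in sequentially. w n < s + d" using order_tendstoD(2)[OF u(3)] d(1) by simp
  then show "\<forall>\<^sub>F n in sequentially.
     \<bar>D (u n) (w n) - kr / 2 * (w n - u n)\<^sup>2\<bar> \<le> e * (w n - u n)\<^sup>2 \<and>
     \<bar>D (w n) (u n) - kr / 2 * (w n - u n)\<^sup>2\<bar> \<le> e * (w n - u n)\<^sup>2"
  proof eventually_elim
    case (elim n)
    show ?case by (rule d(2)) (use elim u(1,2)[of n] in auto)
  qed
qed

lemma A_left_limit:
  assumes k: "two_sided_curvature s kl kr" and u: "\<And>n. w n \<le> s" "\<And>n. u n < w n" "u \<longlonglongrightarrow> s"
  shows "(\<lambda>n. A (u n) (w n) / (w n - u n)) \<longlonglongrightarrow> kl / 2 \<and> (\<lambda>n. A (w n) (u n) / (w n - u n)) \<longlonglongrightarrow> kl / 2"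
proof (rule A_limit[OF u(3) _ u(2)])
  show "w \<longlonglongrightarrow> s"
    by (rule real_tendsto_sandwich[OF _ _ u(3) tendsto_const]) (use u(1,2) in \<open>auto simp: less_imp_le\<close>)
  fix e :: real assume "e > 0"
  then obtain d where d: "d > 0" "\<And>u w. s - d \<le> u \<and> u \<le> w \<and> w \<le> s \<Longrightarrow>
     \<bar>D u w - kl / 2 * (w - u)\<^sup>2\<bar> \<le> e * (w - u)\<^sup>2 \<and> \<bar>D w u - kl / 2 * (w - u)\<^sup>2\<bar> \<le> e * (w - u)\<^sup>2"
    using k unfolding two_sided_curvature_def by metis
  have "\<forall>\<^sub>F n in sequentially. s - d < u n" using order_tendstoD(1)[OF u(3)] d(1) by simp
  then show "\<forall>\<^sub>F n in sequentially.
     \<bar>D (u n) (w n) - kl / 2 * (w n - u n)\<^sup>2\<bar> \<le> e * (w n - u n)\<^sup>2 \<and>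
     \<bar>D (w n) (u n) - kl / 2 * (w n - u n)\<^sup>2\<bar> \<le> e * (w n - u n)\<^sup>2"
  proof eventually_elim
    case (elim n)
    show ?case by (rule d(2)) (use elim u(1,2)[of n] in auto)
  qed
qed

text \<open>The expansion across the jump in units of \<theta>: the error \<epsilon> (a + b)^2 stays
  small after division by \<theta>^2 because (a + b) / \<theta> is bounded.\<close>

lemma mixed_limit:
  assumes k: "two_sided_curvature s kl kr"
    and ab: "a \<longlonglongrightarrow> 0" "b \<longlonglongrightarrow> 0" "\<And>n. 0 \<le> a n" "\<And>n. 0 \<le> b n" and \<theta>: "\<And>n. \<theta> n > (0::real)"
    and bnd: "\<forall>\<^sub>F n in sequentially. (a n + b n) / \<theta> n \<le> M"
  shows "(\<lambda>n. D (s - a n) (s + b n) / (\<theta> n)\<^sup>2 -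
      (kl * (a n / \<theta> n)\<^sup>2 + 2 * kl * (a n / \<theta> n) * (b n / \<theta> n) + kr * (b n / \<theta> n)\<^sup>2) / 2) \<longlonglongrightarrow> 0"
    and "(\<lambda>n. D (s + b n) (s - a n) / (\<theta> n)\<^sup>2 -
      (kl * (a n / \<theta> n)\<^sup>2 + 2 * kr * (a n / \<theta> n) * (b n / \<theta> n) + kr * (b n / \<theta> n)\<^sup>2) / 2) \<longlonglongrightarrow> 0"
proof -
  have gen: "(\<lambda>n. Z n / (\<theta> n)\<^sup>2 -
      (kl * (a n / \<theta> n)\<^sup>2 + 2 * kk * (a n / \<theta> n) * (b n / \<theta> n) + kr * (b n / \<theta> n)\<^sup>2) / 2) \<longlonglongrightarrow> 0"
    if Z: "\<And>\<epsilon>. \<epsilon> > 0 \<Longrightarrow> \<forall>\<^sub>F n in sequentially. \<bar>Z n - (kl * (a n)\<^sup>2 + 2 * kk * a n * b n + kr * (b n)\<^sup>2) / 2\<bar> \<le> \<epsilon> * (a n + b n)\<^sup>2"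
    for Z kk
  proof (rule tendstoI)
    fix e :: real assume e: "e > 0"
    define \<epsilon> where "\<epsilon> = e / (2 * (\<bar>M\<bar> + 1)\<^sup>2)"
    have M1: "(\<bar>M\<bar> + 1)\<^sup>2 > 0" by (simp add: zero_less_power)
    have \<epsilon>: "\<epsilon> > 0" unfolding \<epsilon>_def using e M1 by (intro divide_pos_pos mult_pos_pos) auto
    show "\<forall>\<^sub>F n in sequentially. dist (Z n / (\<theta> n)\<^sup>2 -
      (kl * (a n / \<theta> n)\<^sup>2 + 2 * kk * (a n / \<theta> n) * (b n / \<theta> n) + kr * (b n / \<theta> n)\<^sup>2) / 2) 0 < e"
      using Z[OF \<epsilon>] bnd
    proof eventually_elim
      case (elim n)
      have t: "(\<theta> n)\<^sup>2 > 0" "\<theta> n \<noteq> 0" using \<theta>[of n] by auto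
      have "Z n / (\<theta> n)\<^sup>2 - (kl * (a n / \<theta> n)\<^sup>2 + 2 * kk * (a n / \<theta> n) * (b n / \<theta> n) + kr * (b n / \<theta> n)\<^sup>2) / 2
        = (Z n - (kl * (a n)\<^sup>2 + 2 * kk * a n * b n + kr * (b n)\<^sup>2) / 2) / (\<theta> n)\<^sup>2"
        using t by (simp add: field_simps power2_eq_square)
      also have "\<bar>\<dots>\<bar> \<le> \<epsilon> * (a n + b n)\<^sup>2 / (\<theta> n)\<^sup>2"
        unfolding abs_divide using elim(1) by (simp add: divide_right_mono)
      also have "\<dots> = \<epsilon> * ((a n + b n) / \<theta> n)\<^sup>2" by (simp add: power_divide)
      also have "\<dots> \<le> \<epsilon> * (\<bar>M\<bar> + 1)\<^sup>2"
        using elim(2) \<epsilon> ab(3,4)[of n] \<theta>[of n] by (intro mult_left_mono power_mono) auto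
      also have "\<dots> = e / 2" unfolding \<epsilon>_def using M1 by simp
      also have "\<dots> < e" using e by simp
      finally show ?case by (simp add: dist_real_def)
    qed
  qed
  have est: "\<forall>\<^sub>F n in sequentially.
        \<bar>D (s - a n) (s + b n) - (kl * (a n)\<^sup>2 + 2 * kl * a n * b n + kr * (b n)\<^sup>2) / 2\<bar> \<le> \<epsilon> * (a n + b n)\<^sup>2 \<and>
        \<bar>D (s + b n) (s - a n) - (kl * (a n)\<^sup>2 + 2 * kr * a n * b n + kr * (b n)\<^sup>2) / 2\<bar> \<le> \<epsilon> * (a n + b n)\<^sup>2"
    if "\<epsilon> > 0" for \<epsilon>
  proof -
    obtain d where d: "d > 0" "\<And>a b. 0 \<le> a \<and> a \<le> d \<and> 0 \<le> b \<and> b \<le> d \<Longrightarrow>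
        \<bar>D (s - a) (s + b) - (kl * a\<^sup>2 + 2 * kl * a * b + kr * b\<^sup>2) / 2\<bar> \<le> \<epsilon> * (a + b)\<^sup>2 \<and>
        \<bar>D (s + b) (s - a) - (kl * a\<^sup>2 + 2 * kr * a * b + kr * b\<^sup>2) / 2\<bar> \<le> \<epsilon> * (a + b)\<^sup>2"
      using k \<open>\<epsilon> > 0\<close> unfolding two_sided_curvature_def by metis
    have "\<forall>\<^sub>F n in sequentially. a n < d" "\<forall>\<^sub>F n in sequentially. b n < d"
      using order_tendstoD(2)[OF ab(1)] order_tendstoD(2)[OF ab(2)] d(1) by auto
    then show ?thesis
    proof eventually_elim
      case (elim n)
      show ?case by (rule d(2)) (use elim ab(3,4)[of n] in auto)
    qed
  qed
  show "(\<lambda>n. D (s - a n) (s + b n) / (\<theta> n)\<^sup>2 -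
      (kl * (a n / \<theta> n)\<^sup>2 + 2 * kl * (a n / \<theta> n) * (b n / \<theta> n) + kr * (b n / \<theta> n)\<^sup>2) / 2) \<longlonglongrightarrow> 0"
    by (rule gen, rule eventually_mono[OF est], assumption, blast)
  show "(\<lambda>n. D (s + b n) (s - a n) / (\<theta> n)\<^sup>2 -
      (kl * (a n / \<theta> n)\<^sup>2 + 2 * kr * (a n / \<theta> n) * (b n / \<theta> n) + kr * (b n / \<theta> n)\<^sup>2) / 2) \<longlonglongrightarrow> 0"
    by (rule gen, rule eventually_mono[OF est], assumption, blast)
qed

end

context table
begin

lemma no_collapse_at_jump:
  assumes k: "two_sided_curvature s kl kr" and neq: "kl \<noteq> kr"
    and f: "\<And>n. caustic_map (f n)" and collapse: "\<And>x. (\<lambda>n. f n x) \<longlonglongrightarrow> x"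
  shows False
proof -
  have kp: "kl > 0" "kr > 0" using k by (auto simp: two_sided_curvature_def)
  note up = caustic_mapD(1)[OF f] and mono = caustic_mapD(3)[OF f]
  \<comment> \<open>The backward map, which does on the left of s what f n does on the
    right.\<close>
  define g where "g n = inv (f n)" for n
  have fg: "f n (g n x) = x" for n x unfolding g_def using caustic_mapD(5)[OF f] by (rule surj_f_inv_f)
  have gf: "g n (f n x) = x" for n x
    using fg[of n "f n x"] mono[of "g n (f n x)" x n] mono[of x "g n (f n x)" n]
    by (cases "g n (f n x)" x rule: linorder_cases) auto
  have gmono: "g n x < g n y" if "x < y" for n x y
  proof (rule ccontr)
    assume "\<not> g n x < g n y"
    then have "f n (g n y) \<le> f n (g n x)" using mono[of "g n y" "g n x" n] by (cases "g n y = g n x") auto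
    then show False using that fg by simp
  qed
  have gup: "g n x < x" for n x using up[of "g n x" n] fg[of n x] by simp
  have grefl: "A x (g n x) = A x (f n x)" for n x using caustic_mapD(7)[OF f, of n "g n x"] by (simp add: fg)
  have gcollapse: "(\<lambda>n. g n x) \<longlonglongrightarrow> x" for x
  proof (rule tendstoI)
    fix e :: real assume e: "e > 0"
    have "\<forall>\<^sub>F n in sequentially. f n (x - e) < x" using order_tendstoD(2)[OF collapse] e by simp
    then show "\<forall>\<^sub>F n in sequentially. dist (g n x) x < e"
    proof eventually_elim
      case (elim n)
      have "x - e < g n x" using gmono[OF elim, of n] gf by simp
      then show ?case using gup[of n x] by (simp add: dist_real_def)
    qed
  qed
  \<comment> \<open>The steps at s to the right and to the left have the same angle at c s, so kr X
    n and kl X' n are asymptotically equal.\<close>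
  define X where "X n = f n s - s" for n
  define X' where "X' n = s - g n s" for n
  have Xp: "X n > 0" "X' n > 0" for n using up[of s n] gup[of n s] by (auto simp: X_def X'_def)
  have AX: "(\<lambda>n. A s (f n s) / X n) \<longlonglongrightarrow> kr / 2"
    using A_right_limit[OF k, of "\<lambda>_. s" "\<lambda>n. f n s"] up collapse by (auto simp: X_def)
  have AX': "(\<lambda>n. A s (f n s) / X' n) \<longlonglongrightarrow> kl / 2"
    using A_left_limit[OF k, of "\<lambda>_. s" "\<lambda>n. g n s"] gup gcollapse by (auto simp: X'_def grefl)
  have "\<forall>\<^sub>F n in sequentially. A s (f n s) / X n > 0" using order_tendstoD(1)[OF AX] kp by simp
  then have ev: "\<forall>\<^sub>F n in sequentially. (A s (f n s) / X n) / (A s (f n s) / X' n) = X' n / X n"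
  proof eventually_elim
    case (elim n)
    then have "A s (f n s) \<noteq> 0" by auto
    then show ?case using Xp[of n] by simp
  qed
  have "(\<lambda>n. (A s (f n s) / X n) / (A s (f n s) / X' n)) \<longlonglongrightarrow> (kr / 2) / (kl / 2)"
    by (rule tendsto_divide[OF AX AX']) (use kp in simp)
  then have XX: "(\<lambda>n. X' n / X n) \<longlonglongrightarrow> kr / kl" using Lim_transform_eventually[OF _ ev] by simp
  define \<theta> where "\<theta> n = kr * X n / 2" for n
  have \<theta>: "\<theta> n > 0" for n using kp Xp[of n] by (simp add: \<theta>_def)
  have X\<theta>: "X n / \<theta> n = 2 / kr" for n using kp Xp[of n] by (simp add: \<theta>_def)
  have X'\<theta>: "(\<lambda>n. X' n / \<theta> n) \<longlonglongrightarrow> 2 / kl"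
  proof -
    have "(\<lambda>n. (X' n / X n) * (2 / kr)) \<longlonglongrightarrow> (kr / kl) * (2 / kr)" by (intro tendsto_intros XX)
    moreover have "(X' n / X n) * (2 / kr) = X' n / \<theta> n" for n using kp Xp[of n] by (simp add: \<theta>_def)
    ultimately show ?thesis using kp by simp
  qed
  \<comment> \<open>Half of the left step, which is about 2 \<theta> / kl. Starting inside that
    step, the chord from y n crosses the jump and ends inside the step to the right of s.\<close>
  define a where "a n = X' n / 2" for n
  define y where "y n = s - a n" for n
  define b where "b n = f n (y n) - s" for n
  have a_pos: "a n > 0" for n using Xp by (simp add: a_def)
  have y1: "g n s < y n" "y n < s" for n using Xp(2)[of n] by (auto simp: y_def a_def X'_def field_simps)
  have fy: "f n (y n) = s + b n" for n by (simp add: b_def)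
  have b0: "0 < b n" "b n < X n" for n
    using mono[OF y1(1)[of n], of n] mono[OF y1(2)[of n], of n] fg[of n s] by (auto simp: b_def X_def)
  have "(\<lambda>n. f n s - s) \<longlonglongrightarrow> s - s" "(\<lambda>n. (s - g n s) / 2) \<longlonglongrightarrow> (s - s) / 2"
    by (intro tendsto_intros collapse gcollapse; simp)+
  then have Xl: "X \<longlonglongrightarrow> 0" and al: "a \<longlonglongrightarrow> 0" by (simp_all add: X_def[abs_def] a_def[abs_def] X'_def)
  have bl: "b \<longlonglongrightarrow> 0"
    by (rule real_tendsto_sandwich[OF _ _ tendsto_const Xl]) (use b0 in \<open>auto simp: less_imp_le\<close>)
  have yl: "y \<longlonglongrightarrow> s" using tendsto_diff[OF tendsto_const al, of s] by (simp add: y_def[abs_def])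
  have fyl: "(\<lambda>n. f n (y n)) \<longlonglongrightarrow> s" using tendsto_add[OF tendsto_const bl, of s] by (simp add: fy)
  define Y where "Y n = f n (f n (y n)) - f n (y n)" for n
  define Y' where "Y' n = y n - g n (y n)" for n
  have YX: "(\<lambda>n. Y n / X n) \<longlonglongrightarrow> 1"
    unfolding Y_def X_def
  \<comment> \<open>Here the second orbit starts at the end f n (y n) of the crossing chord, which
    lies between s and f n s.\<close>
  proof (rule step_ratio_tendsto_1[of "kr / 2" s A])
    show "kr / 2 > 0" using kp by simp
    show "A (f n x) (f n (f n x)) = A (f n x) x" for n x by (rule caustic_mapD(7)[OF f])
    show "s \<le> f n (y n)" "f n (y n) \<le> f n s" for n using b0[of n] by (auto simp: fy X_def)
  qed (use A_right_limit[OF k] up mono collapse in auto)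
  have YX': "(\<lambda>n. Y' n / X' n) \<longlonglongrightarrow> 1"
  proof -
    \<comment> \<open>Conjugation with x \<mapsto> -x turns the backward map into a forward one, so
      that the left side is treated by the same lemma.\<close>
    define f' where "f' n x = - g n (- x)" for n x
    have "(\<lambda>n. (f' n (- y n) - (- y n)) / (f' n (- s) - (- s))) \<longlonglongrightarrow> 1"
    proof (rule step_ratio_tendsto_1[of "kl / 2" "- s" "\<lambda>u w. A (- u) (- w)"])
      show "kl / 2 > 0" using kp by simp
      show "(\<lambda>n. A (- u n) (- w n) / (w n - u n)) \<longlonglongrightarrow> kl / 2 \<and> (\<lambda>n. A (- w n) (- u n) / (w n - u n)) \<longlonglongrightarrow> kl / 2"
        if "\<And>n. - s \<le> u n" "\<And>n. u n < w n" "w \<longlonglongrightarrow> - s" for u w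
        using A_left_limit[OF k, of "\<lambda>n. - u n" "\<lambda>n. - w n"] that tendsto_minus[OF that(3)]
        by (auto simp: minus_le_iff)
      show "x < f' n x" for n x using gup[of n "- x"] by (simp add: f'_def)
      show "f' n x < f' n z" if "x < z" for n x z using gmono[of "- z" "- x" n] that by (simp add: f'_def)
      show "A (- f' n x) (- f' n (f' n x)) = A (- f' n x) (- x)" for n x
        using grefl[of "g n (- x)" n] by (simp add: f'_def fg)
      show "(\<lambda>n. f' n x) \<longlonglongrightarrow> x" for x
        using tendsto_minus[OF gcollapse[of "- x"]] by (simp add: f'_def)
      show "- s \<le> - y n" "- y n \<le> f' n (- s)" for n using y1[of n] by (auto simp: f'_def)
    qed
    then show ?thesis by (simp add: f'_def Y'_def X'_def)
  qed
  \<comment> \<open>The angle of the crossing chord at its start equals that of the preceding chord,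
    which lies entirely on the left of the jump; at its end, in \<open>A2\<close>, it equals that of
    the following chord on the right.\<close>
  have A1: "(\<lambda>n. A (y n) (f n (y n)) / \<theta> n) \<longlonglongrightarrow> 1"
  proof -
    have "(\<lambda>n. A (y n) (f n (y n)) / Y' n) \<longlonglongrightarrow> kl / 2"
    proof -
      have "(\<lambda>n. g n (y n)) \<longlonglongrightarrow> s"
      proof (rule tendstoI)
        fix e :: real assume e: "e > 0"
        have "\<forall>\<^sub>F n in sequentially. s - e / 2 < y n" using order_tendstoD(1)[OF yl] e by simp
        moreover have "\<forall>\<^sub>F n in sequentially. s - e < g n (s - e / 2)" using order_tendstoD(1)[OF gcollapse] e by simp
        ultimately show "\<forall>\<^sub>F n in sequentially. dist (g n (y n)) s < e"
        proof eventually_elim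
          case (elim n)
          then show ?case using gmono[of "s - e / 2" "y n" n] gup[of n "y n"] y1(2)[of n] by (simp add: dist_real_def)
        qed
      qed
      then show ?thesis using A_left_limit[OF k, of y "\<lambda>n. g n (y n)"] y1(2) gup
        by (auto simp: Y'_def grefl less_imp_le)
    qed
    from tendsto_mult[OF tendsto_mult[OF this YX'] X'\<theta>]
    have "(\<lambda>n. A (y n) (f n (y n)) / Y' n * (Y' n / X' n) * (X' n / \<theta> n)) \<longlonglongrightarrow> 1" using kp by simp
    moreover have "A (y n) (f n (y n)) / Y' n * (Y' n / X' n) * (X' n / \<theta> n) = A (y n) (f n (y n)) / \<theta> n" for n
      using Xp(2)[of n] gup[of n "y n"] by (simp add: Y'_def)
    ultimately show ?thesis by (simp only:)
  qed
  have A2: "(\<lambda>n. A (f n (y n)) (y n) / \<theta> n) \<longlonglongrightarrow> 1"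
  proof -
    have "(\<lambda>n. f n (f n (y n))) \<longlonglongrightarrow> s"
    proof (rule tendstoI)
      fix e :: real assume e: "e > 0"
      have "\<forall>\<^sub>F n in sequentially. f n (y n) < s + e / 2" using order_tendstoD(2)[OF fyl] e by simp
      moreover have "\<forall>\<^sub>F n in sequentially. f n (s + e / 2) < s + e" using order_tendstoD(2)[OF collapse] e by simp
      ultimately show "\<forall>\<^sub>F n in sequentially. dist (f n (f n (y n))) s < e"
      proof eventually_elim
        case (elim n)
        then show ?case using mono[of "f n (y n)" "s + e / 2" n] up[of "f n (y n)" n] b0(1)[of n] fy[of n]
          by (simp add: dist_real_def)
      qed
    qed
    then have "(\<lambda>n. A (f n (y n)) (f n (f n (y n))) / Y n) \<longlonglongrightarrow> kr / 2"
      using A_right_limit[OF k, of "\<lambda>n. f n (y n)" "\<lambda>n. f n (f n (y n))"] b0(1) up by (auto simp: Y_def fy less_imp_le)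
    then have "(\<lambda>n. A (f n (y n)) (y n) / Y n) \<longlonglongrightarrow> kr / 2" by (simp add: caustic_mapD(7)[OF f])
    from tendsto_mult[OF tendsto_mult[OF this YX] tendsto_const[of "2 / kr"]]
    have "(\<lambda>n. A (f n (y n)) (y n) / Y n * (Y n / X n) * (X n / \<theta> n)) \<longlonglongrightarrow> 1" using kp unfolding X\<theta> by simp
    moreover have "A (f n (y n)) (y n) / Y n * (Y n / X n) * (X n / \<theta> n) = A (f n (y n)) (y n) / \<theta> n" for n
      using Xp(1)[of n] up[of "f n (y n)" n] by (simp add: Y_def)
    ultimately show ?thesis by (simp only:)
  qed
  define \<alpha> where "\<alpha> n = a n / \<theta> n" for n
  define \<beta> where "\<beta> n = b n / \<theta> n" for n
  have \<alpha>l: "\<alpha> \<longlonglongrightarrow> 1 / kl"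
    using tendsto_mult[OF X'\<theta> tendsto_const[of "1 / 2"]] by (simp add: \<alpha>_def[abs_def] a_def mult.commute)
  have \<beta>b: "0 \<le> \<beta> n" "\<beta> n \<le> 2 / kr" for n
  proof -
    show "0 \<le> \<beta> n" using b0(1)[of n] \<theta>[of n] by (simp add: \<beta>_def)
    have "\<beta> n \<le> X n / \<theta> n" unfolding \<beta>_def using b0(2)[of n] \<theta>[of n] by (simp add: divide_right_mono)
    then show "\<beta> n \<le> 2 / kr" by (simp add: X\<theta>)
  qed
  define M where "M = 1 / kl + 1 + 2 / kr"
  have \<alpha>ev: "\<forall>\<^sub>F n in sequentially. \<alpha> n < 1 / kl + 1" using order_tendstoD(2)[OF \<alpha>l] by simp
  have bnd: "\<forall>\<^sub>F n in sequentially. (a n + b n) / \<theta> n \<le> M" using \<alpha>ev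
  proof eventually_elim
    case (elim n)
    then show ?case using \<beta>b(2)[of n] unfolding add_divide_distrib \<alpha>_def[symmetric] \<beta>_def[symmetric] M_def by simp
  qed
  have \<rho>: "(\<lambda>n. R (y n) (f n (y n)) / (f n (y n) - y n)) \<longlonglongrightarrow> 1"
    by (rule diagonal_limits(1)[OF yl fyl up])
  \<comment> \<open>D = A R, with A asymptotic to \<theta> and R to a + b, gives D / \<theta>^2
    close to \<alpha> + \<beta>. Boundedness of (a + b) / \<theta> turns the relative error into an
    absolute one.\<close>
  have lin: "(\<lambda>n. Z n * R (y n) (f n (y n)) / (\<theta> n)\<^sup>2 - (\<alpha> n + \<beta> n)) \<longlonglongrightarrow> 0"
    if Z: "(\<lambda>n. Z n / \<theta> n) \<longlonglongrightarrow> 1" for Z :: "nat \<Rightarrow> real"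
  proof -
    define q where "q n = (Z n / \<theta> n) * (R (y n) (f n (y n)) / (f n (y n) - y n)) - 1" for n
    have "q \<longlonglongrightarrow> 1 * 1 - 1" unfolding q_def[abs_def] by (intro tendsto_intros Z \<rho>)
    then have "(\<lambda>n. norm (q n) * M) \<longlonglongrightarrow> norm (0::real) * M" by (intro tendsto_intros) simp
    then have q0: "(\<lambda>n. norm (q n) * M) \<longlonglongrightarrow> 0" by simp
    have eq: "Z n * R (y n) (f n (y n)) / (\<theta> n)\<^sup>2 - (\<alpha> n + \<beta> n) = q n * ((a n + b n) / \<theta> n)" for n
    proof -
      have h: "f n (y n) - y n = a n + b n" unfolding fy by (simp add: y_def)
      define \<rho> where "\<rho> = R (y n) (f n (y n))"
      have "a n + b n > 0" using a_pos[of n] b0(1)[of n] by simp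
      then show ?thesis using \<theta>[of n] unfolding q_def h \<rho>_def[symmetric] \<alpha>_def \<beta>_def add_divide_distrib[symmetric]
        by (simp add: left_diff_distrib diff_divide_distrib power2_eq_square)
    qed
    show ?thesis unfolding eq
    proof (rule Lim_null_comparison[OF _ q0])
      show "\<forall>\<^sub>F n in sequentially. norm (q n * ((a n + b n) / \<theta> n)) \<le> norm (q n) * M" using bnd
      proof eventually_elim
        case (elim n)
        have "(a n + b n) / \<theta> n \<ge> 0" using a_pos[of n] b0(1)[of n] \<theta>[of n] by simp
        then show ?case unfolding norm_mult using elim by (intro mult_left_mono) auto
      qed
    qed
  qed
  have ne: "c (y n) \<noteq> c (f n (y n))" for n using c_neq(1) caustic_mapD(1,2)[OF f] by blast
  have e: "s - a n = y n" "s + b n = f n (y n)" for n by (simp_all add: y_def b_def)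
  have D1: "D (s - a n) (s + b n) = A (y n) (f n (y n)) * R (y n) (f n (y n))" for n
    unfolding e using R_pos[OF ne, of n] by (simp add: A_def)
  have D2: "D (s + b n) (s - a n) = A (f n (y n)) (y n) * R (y n) (f n (y n))" for n
    unfolding e using R_pos[OF ne, of n] R_commute[of "f n (y n)" "y n"] by (simp add: A_def)
  note mx = mixed_limit[OF k al bl less_imp_le[OF a_pos] less_imp_le[OF b0(1)] \<theta> bnd, folded \<alpha>_def \<beta>_def]
  have Q1: "(\<lambda>n. (kl * (\<alpha> n)\<^sup>2 + 2 * kl * \<alpha> n * \<beta> n + kr * (\<beta> n)\<^sup>2) / 2 - (\<alpha> n + \<beta> n)) \<longlonglongrightarrow> 0"
  proof -
    have *: "x - y - (x - z) = z - y" for x y z :: real by simp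
    show ?thesis using tendsto_diff[OF lin[OF A1] mx(1)] unfolding D1 * by (simp only: diff_self)
  qed
  have Q2: "(\<lambda>n. (kl * (\<alpha> n)\<^sup>2 + 2 * kr * \<alpha> n * \<beta> n + kr * (\<beta> n)\<^sup>2) / 2 - (\<alpha> n + \<beta> n)) \<longlonglongrightarrow> 0"
  proof -
    have *: "x - y - (x - z) = z - y" for x y z :: real by simp
    show ?thesis using tendsto_diff[OF lin[OF A2] mx(2)] unfolding D2 * by (simp only: diff_self)
  qed
  \<comment> \<open>The difference of \<open>Q1\<close> and \<open>Q2\<close> is (kl - kr) \<alpha>
    \<beta>, and \<alpha> has the nonzero limit 1 / kl.\<close>
  have \<beta>l: "\<beta> \<longlonglongrightarrow> 0"
  proof -
    have "(\<lambda>n. (((kl * (\<alpha> n)\<^sup>2 + 2 * kl * \<alpha> n * \<beta> n + kr * (\<beta> n)\<^sup>2) / 2 - (\<alpha> n + \<beta> n))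
       - ((kl * (\<alpha> n)\<^sup>2 + 2 * kr * \<alpha> n * \<beta> n + kr * (\<beta> n)\<^sup>2) / 2 - (\<alpha> n + \<beta> n))) / ((kl - kr) * \<alpha> n))
       \<longlonglongrightarrow> (0 - 0) / ((kl - kr) * (1 / kl))"
      by (rule tendsto_divide[OF tendsto_diff[OF Q1 Q2] tendsto_mult[OF tendsto_const \<alpha>l]]) (use kp neq in simp)
    moreover have "(((kl * (\<alpha> n)\<^sup>2 + 2 * kl * \<alpha> n * \<beta> n + kr * (\<beta> n)\<^sup>2) / 2 - (\<alpha> n + \<beta> n))
       - ((kl * (\<alpha> n)\<^sup>2 + 2 * kr * \<alpha> n * \<beta> n + kr * (\<beta> n)\<^sup>2) / 2 - (\<alpha> n + \<beta> n))) / ((kl - kr) * \<alpha> n) = \<beta> n" for n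
    proof -
      have "\<alpha> n > 0" using a_pos[of n] \<theta>[of n] by (simp add: \<alpha>_def)
      moreover have "((kl * (\<alpha> n)\<^sup>2 + 2 * kl * \<alpha> n * \<beta> n + kr * (\<beta> n)\<^sup>2) / 2 - (\<alpha> n + \<beta> n))
       - ((kl * (\<alpha> n)\<^sup>2 + 2 * kr * \<alpha> n * \<beta> n + kr * (\<beta> n)\<^sup>2) / 2 - (\<alpha> n + \<beta> n)) = ((kl - kr) * \<alpha> n) * \<beta> n"
        by (simp add: field_simps)
      ultimately show ?thesis using neq by simp
    qed
    ultimately show ?thesis by simp
  qed
  \<comment> \<open>With \<alpha> = 1 / kl and \<beta> = 0 the expression is 1 / (2 kl) - 1 / kl,
    which is not 0.\<close>
  have "(\<lambda>n. (kl * (\<alpha> n)\<^sup>2 + 2 * kl * \<alpha> n * \<beta> n + kr * (\<beta> n)\<^sup>2) / 2 - (\<alpha> n + \<beta> n))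
     \<longlonglongrightarrow> (kl * (1 / kl)\<^sup>2 + 2 * kl * (1 / kl) * 0 + kr * 0\<^sup>2) / 2 - (1 / kl + 0)"
    by (intro tendsto_intros \<alpha>l \<beta>l) auto
  from LIMSEQ_unique[OF this Q1] show False using kp by (simp add: power2_eq_square field_simps)
qed

section \<open>From caustics to the neighbourhood of the boundary\<close>

text \<open>If C contained one boundary point it would contain them all by
  \<open>touching_impossible\<close>, and then C = K and \<gamma> is the boundary. So every point of
  the boundary is outside C and the map is defined everywhere.\<close>

lemma caustic_map_of_caustic:
  assumes \<gamma>: "convex_caustic G K \<gamma>" "\<gamma> \<noteq> bdry G K"
  obtains C f where "\<gamma> \<subseteq> C" "caustic_map f"
    "\<And>u w x. u < w \<Longrightarrow> w < u + L \<Longrightarrow> x \<in> C \<Longrightarrow> det3 (c u) (c w) x < 0 \<Longrightarrow> f u < w"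
proof -
  note def = \<gamma>(1)[unfolded convex_caustic_def]
  obtain C where C0: "compact C \<and> geo_convex G C \<and> bdry G C = \<gamma> \<and>
      (\<forall>p u q w. billiard_step G K p u q w \<and> supporting_line G C p u \<longrightarrow> supporting_line G C q w)"
    using def[THEN conjunct2, THEN conjunct2] by (elim exE)
  have C: "compact C" "geo_convex G C" "bdry G C = \<gamma>"
    "\<And>p u q w. billiard_step G K p u q w \<Longrightarrow> supporting_line G C p u \<Longrightarrow> supporting_line G C q w"
    using C0 by blast+
  obtain g where "path_image g = \<gamma>" using def[THEN conjunct2, THEN conjunct1] by (elim exE conjE)
  then have \<gamma>ne: "\<gamma> \<noteq> {}" using path_image_nonempty by blast
  have sC: "C \<subseteq> surf G" using C(2) by (simp add: geo_convex_def)
  have \<gamma>C: "\<gamma> \<subseteq> C" using C(3) closedin_surf_compact[OF C(1) sC] by auto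
  have Kne: "K \<noteq> {}" using c_K by blast
  have CK: "C \<subseteq> K"
    by (rule compact_convex_subset_if_bdry_subset[OF K_convex K_compact Kne C(2,1)])
      (use conjunct1[OF def] C(3) in simp)
  have Cne: "C \<noteq> {}" using \<gamma>C \<gamma>ne by blast
  interpret caustic G K c L m C
    by unfold_locales (use C CK Cne in auto)
  have out: "c s \<notin> C" for s
  proof
    assume s: "c s \<in> C"
    then have "c t \<in> C" for t using touching_impossible[of t s] by blast
    then have "bdry G K \<subseteq> C" unfolding range_c[symmetric] by blast
    then have "K \<subseteq> C"
      by (rule compact_convex_subset_if_bdry_subset[OF C(2,1) Cne K_convex K_compact])
    then show False using CK C(3) \<gamma>(2) by auto
  qed
  show thesis by (rule that[OF \<gamma>C caustic_map_nxt[OF out]]) (use nxt_less[OF out] in auto)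
qed

text \<open>If the neighbourhoods of radius 1 / (n + 1) all meet caustics, points of these caustics
  accumulate at some c r0. This point has no relation to the jump at s; it is the collapse of the
  maps at every parameter that transfers the information to s.\<close>

lemma neighbourhood_without_caustics:
  assumes k: "two_sided_curvature s kl kr" and neq: "kl \<noteq> kr"
  shows "\<exists>U. openin (surf_top G) U \<and> bdry G K \<subseteq> U \<and>
           (\<forall>\<gamma>. convex_caustic G K \<gamma> \<and> \<gamma> \<noteq> bdry G K \<longrightarrow> \<gamma> \<inter> U = {})"
proof (rule ccontr)
  assume neg: "\<not> ?thesis"
  define U where "U n = surf G \<inter> (\<Union>y\<in>bdry G K. ball y (1 / real (Suc n)))" for n
  have U: "openin (surf_top G) (U n)" "bdry G K \<subseteq> U n" for n
  proof -
    show "openin (surf_top G) (U n)" unfolding U_def by (intro openin_open_Int open_UN ballI open_ball)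
    have "bdry G K \<subseteq> surf G" using bdry_K K_surf by auto
    then show "bdry G K \<subseteq> U n" unfolding U_def by auto
  qed
  have "\<exists>\<gamma>. convex_caustic G K \<gamma> \<and> \<gamma> \<noteq> bdry G K \<and> \<gamma> \<inter> U n \<noteq> {}" for n
    using neg U[of n] by blast
  then obtain \<gamma> where \<gamma>: "\<And>n. convex_caustic G K (\<gamma> n)" "\<And>n. \<gamma> n \<noteq> bdry G K" "\<And>n. \<gamma> n \<inter> U n \<noteq> {}"
    by metis
  have "\<exists>f x r. caustic_map f \<and> r \<in> {0..L} \<and> dist (c r) x < 1 / real (Suc n) \<and>
     (\<forall>u w. u < w \<longrightarrow> w < u + L \<longrightarrow> det3 (c u) (c w) x < 0 \<longrightarrow> f u < w)" for n
  proof -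
    obtain C f where Cf: "\<gamma> n \<subseteq> C" "caustic_map f"
      "\<And>u w x. u < w \<Longrightarrow> w < u + L \<Longrightarrow> x \<in> C \<Longrightarrow> det3 (c u) (c w) x < 0 \<Longrightarrow> f u < w"
      using caustic_map_of_caustic[OF \<gamma>(1,2)] by blast
    obtain x y where xy: "x \<in> \<gamma> n" "y \<in> bdry G K" "dist y x < 1 / real (Suc n)"
      using \<gamma>(3)[of n] unfolding U_def by auto
    obtain r where r: "y = c r" "0 \<le> r" "r < 0 + L" using bdry_param[OF xy(2)] .
    show ?thesis
      by (rule exI[of _ f], rule exI[of _ x], rule exI[of _ r]) (use Cf xy r in auto)
  qed
  then obtain f x r where fx: "\<And>n. caustic_map (f n)" "\<And>n. r n \<in> {0..L}" "\<And>n. dist (c (r n)) (x n) < 1 / real (Suc n)"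
    "\<And>n u w. u < w \<Longrightarrow> w < u + L \<Longrightarrow> det3 (c u) (c w) (x n) < 0 \<Longrightarrow> f n u < w"
    by metis
  obtain r0 \<phi> where \<phi>: "r0 \<in> {0..L}" "strict_mono \<phi>" "(r \<circ> \<phi>) \<longlonglongrightarrow> r0"
    using compact_Icc[of 0 L] fx(2) unfolding compact_def by blast
  have "(\<lambda>n. c (r n) - x n) \<longlonglongrightarrow> 0"
  proof (rule Lim_null_comparison)
    show "(\<lambda>n. 1 / real (Suc n)) \<longlonglongrightarrow> 0" using LIMSEQ_inverse_real_of_nat by (simp add: inverse_eq_divide)
    show "\<forall>\<^sub>F n in sequentially. norm (c (r n) - x n) \<le> 1 / real (Suc n)"
      using fx(3) by (auto simp: dist_norm less_imp_le)
  qed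
  from LIMSEQ_subseq_LIMSEQ[OF this \<phi>(2)]
  have d0: "(\<lambda>n. c (r (\<phi> n)) - x (\<phi> n)) \<longlonglongrightarrow> 0" by (simp add: o_def)
  have "(\<lambda>n. c (r (\<phi> n))) \<longlonglongrightarrow> c r0" using isCont_tendsto_compose[OF isCont_c \<phi>(3)] by (simp add: o_def)
  from tendsto_diff[OF this d0] have xl: "(\<lambda>n. x (\<phi> n)) \<longlonglongrightarrow> c r0" by simp
  have near: "\<forall>\<^sub>F n in sequentially. f (\<phi> n) (r0 - \<epsilon>) < r0 + \<epsilon>" if \<epsilon>: "\<epsilon> > 0" for \<epsilon>
  proof -
    \<comment> \<open>At most L / 4, so that the chord from r0 - e to r0 + e spans less than a
      period and has c r0 strictly on its right; nearby points of the caustic are then on its right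
      as well.\<close>
    define e where "e = min \<epsilon> (L / 4)"
    have e: "e > 0" "e \<le> \<epsilon>" "e \<le> L / 4" using \<epsilon> L_pos by (auto simp: e_def)
    have "det3 (c (r0 - e)) (c (r0 + e)) (c r0) < 0" by (rule chord_sign(2)) (use e L_pos in auto)
    moreover have "(\<lambda>n. det3 (c (r0 - e)) (c (r0 + e)) (x (\<phi> n))) \<longlonglongrightarrow> det3 (c (r0 - e)) (c (r0 + e)) (c r0)"
      by (intro tendsto_intros xl)
    ultimately have "\<forall>\<^sub>F n in sequentially. det3 (c (r0 - e)) (c (r0 + e)) (x (\<phi> n)) < 0" using order_tendstoD(2) by blast
    then show ?thesis
    proof eventually_elim
      case (elim n)
      have "f (\<phi> n) (r0 - e) < r0 + e" by (rule fx(4)[OF _ _ elim]) (use e L_pos in auto)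
      moreover have "f (\<phi> n) (r0 - \<epsilon>) \<le> f (\<phi> n) (r0 - e)"
        using caustic_mapD(3)[OF fx(1), of "r0 - \<epsilon>" "r0 - e" "\<phi> n"] e by (cases "e = \<epsilon>") auto
      ultimately show ?case using e by simp
    qed
  qed
  show False
    by (rule no_collapse_at_jump[OF k neq, of "\<lambda>n. f (\<phi> n)"], rule fx(1),
        rule caustic_maps_collapse[OF fx(1) near])
qed

end

theorem theorem1p2:
  fixes G :: geometry and K :: "(real^3) set" and c :: "real \<Rightarrow> real^3" and L :: real
  assumes "convex_billiard_table G K"
    and "arclength_boundary G K c L"
    and "piecewise_C2 c L"
    and "finite {t\<in>{0..<L}. \<not> isCont (geodesic_curvature G c) t}"
    and "\<And>t. \<not> isCont (geodesic_curvature G c) t \<Longrightarrow> jump_discontinuity (geodesic_curvature G c) t"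
    and "\<exists>m>0. \<forall>t. isCont (geodesic_curvature G c) t \<longrightarrow> geodesic_curvature G c t \<ge> m"
    and "\<exists>t. \<not> isCont (geodesic_curvature G c) t"
  shows "\<exists>U. openin (surf_top G) U \<and> bdry G K \<subseteq> U \<and>
           (\<forall>\<gamma>. convex_caustic G K \<gamma> \<and> \<gamma> \<noteq> bdry G K \<longrightarrow> \<gamma> \<inter> U = {})"
proof -
  obtain m where m: "m > 0" "\<And>t. isCont (geodesic_curvature G c) t \<Longrightarrow> geodesic_curvature G c t \<ge> m"
    using assms(6) by blast
  interpret table G K c L m
    by unfold_locales (use assms(1-3) m in auto)
  obtain s where "\<not> isCont (geodesic_curvature G c) s" using assms(7) by blast
  then obtain a b where ab: "(geodesic_curvature G c \<longlongrightarrow> a) (at_left s)"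
    "(geodesic_curvature G c \<longlongrightarrow> b) (at_right s)" "a \<noteq> b"
    using assms(5) unfolding jump_discontinuity_def by blast
  obtain kl kr where k: "two_sided_curvature s kl kr" using two_sided_exists by blast
  then have lim: "(geodesic_curvature G c \<longlongrightarrow> kl) (at_left s)" "(geodesic_curvature G c \<longlongrightarrow> kr) (at_right s)"
    by (simp_all add: two_sided_curvature_def)
  \<comment> \<open>Uniqueness of one-sided limits transfers the inequality of the jump to the
    curvatures of the expansion.\<close>
  have "kl = a" by (rule tendsto_unique[OF trivial_limit_at_left_real lim(1) ab(1)])
  moreover have "kr = b" by (rule tendsto_unique[OF trivial_limit_at_right_real lim(2) ab(2)])
  ultimately show ?thesis using neighbourhood_without_caustics[OF k] ab(3) by simp
qed

end
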